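(* Let $(X,d)$ be a complete separable metric space in which closed balls are compact, let $\mu$ be a Borel probability measure on $X$, and let $\alpha:\mathbb{R}^+\to\mathbb{R}^+$ be an increasing convex function of class $\mathcal{C}^1$ with $\alpha(0)=0$. Suppose that $\alpha$ satisfies the $\Delta_2$-condition: there is a constant $K>0$ with $\alpha(2x)\le K\alpha(x)$ for all $x\ge0$. Let $r_\alpha\le p_\alpha$ be the (finite) exponents $$r_\alpha=\inf_{x>0}\frac{x\alpha'(x)}{\alpha(x)}\ \ge 1\qquad\text{and}\qquad 1<p_\alpha=\sup_{x>0}\frac{x\alpha'(x)}{\alpha(x)}.$$ If $\mu$ satisfies ${\bf LSI}_\alpha^-(C)$ (for a constant $C>0$), then it satisfies ${\bf T}_\alpha(A)$ with $$A=\max\left(((p_\alpha-1)C)^{r_\alpha-1};\ ((p_\alpha-1)C)^{p_\alpha-1}\right).$$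
   Context: Entropy: $\operatorname{Ent}_\mu(g)=\int g\log\left(\frac{g}{\int g\,d\mu}\right)d\mu$ for $g>0$. Let $\alpha^*(u)=\sup_{h\ge0}\{hu-\alpha(h)\}$, $u\ge0$, and $|\nabla^-f|(x)=\limsup_{y\to x}\frac{[f(y)-f(x)]_-}{d(x,y)}$ (negative part; $0$ if $x$ is isolated). For $r>0$, $\mathrm{Lip}(f,r)=\sup\left\{\frac{|f(y)-f(x)|}{d(x,y)}:\ x\neq y,\ d(x,y)\le r\right\}$ and $\mathrm{Lip}(f)=\sup_{r>0}\mathrm{Lip}(f,r)$. $\mathcal{F}_\alpha$ is the set of bounded functions $f:X\to\mathbb{R}$ such that $\mathrm{Lip}(f,r)<\infty$ for some $r>0$ and $\mathrm{Lip}(f)\le\lim_{h\to\infty}\alpha(h)/h$ (empty condition if this limit is $+\infty$). The measure $\mu$ satisfies ${\bf LSI}_\alpha^-(C)$ if $\operatorname{Ent}_\mu(e^f)\le C\int\alpha^*(|\nabla^-f|)\,e^f\,d\mu$ for all $f\in\mathcal{F}_\alpha$. Transport: for Borel probability measures $\nu_1,\nu_2$ on $X$, $\mathcal{T}_\alpha(\nu_1,\nu_2)=\inf_\pi\iint\alpha(d(x,y))\,\pi(dx\,dy)$, the infimum over all probability measures $\pi$ on $X\times X$ with marginals $\nu_1$ and $\nu_2$. $\mu$ satisfies ${\bf T}_\alpha(A)$ if $\mathcal{T}_\alpha(\mu,\nu)\le A\,H(\nu|\mu)$ for all Borel probability measures $\nu$ on $X$, where $H(\nu|\mu)=\int\log\frac{d\nu}{d\mu}\,d\nu$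 if $\nu\ll\mu$ and $+\infty$ otherwise. *)

theory Defs
  imports "HOL-Probability.Probability"
begin

text \<open>Cost functions are total functions on the reals, of which only the values on \<open>{0..}\<close> matter.
  The derivative at \<open>0\<close> is one-sided.\<close>

definition C1_halfline :: "(real \<Rightarrow> real) \<Rightarrow> bool" where
  "C1_halfline \<alpha> \<longleftrightarrow> (\<exists>\<alpha>'. (\<forall>x\<ge>0. (\<alpha> has_real_derivative \<alpha>' x) (at x within {0..}))
      \<and> continuous_on {0..} \<alpha>')"

definition Delta2 :: "(real \<Rightarrow> real) \<Rightarrow> bool" where
  "Delta2 \<alpha> \<longleftrightarrow> (\<exists>K>0. \<forall>x\<ge>0. \<alpha> (2 * x) \<le> K * \<alpha> x)"

text \<open>These are infima and suprema in the reals. For convex \<open>\<alpha>\<close> with \<open>\<alpha> 0 = 0\<close> that is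
  positive on \<open>{0<..}\<close> and satisfies \<open>Delta2\<close> with constant \<open>K\<close>, the quotient lies
  between \<open>1\<close> and \<open>K - 1\<close>, so both are genuine.\<close>

definition lower_exponent :: "(real \<Rightarrow> real) \<Rightarrow> real" where
  "lower_exponent \<alpha> = (INF x\<in>{0<..}. x * deriv \<alpha> x / \<alpha> x)"

definition upper_exponent :: "(real \<Rightarrow> real) \<Rightarrow> real" where
  "upper_exponent \<alpha> = (SUP x\<in>{0<..}. x * deriv \<alpha> x / \<alpha> x)"

definition conj_fun :: "(real \<Rightarrow> real) \<Rightarrow> ereal \<Rightarrow> ereal" where
  "conj_fun \<alpha> u = (SUP h\<in>{0..}. ereal h * u - ereal (\<alpha> h))"

text \<open>At an isolated point \<open>at x = bot\<close>, and the \<open>ennreal\<close>-valued \<open>Limsup\<close> along \<open>bot\<close> is \<open>0\<close>.\<close>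

definition neg_slope :: "('a::metric_space \<Rightarrow> real) \<Rightarrow> 'a \<Rightarrow> ennreal" where
  "neg_slope f x = Limsup (at x) (\<lambda>y. ennreal (max 0 (- (f y - f x)) / dist x y))"

definition Lip_upto :: "('a::metric_space \<Rightarrow> real) \<Rightarrow> real \<Rightarrow> ennreal" where
  "Lip_upto f r = (SUP (x, y)\<in>{(x, y). x \<noteq> y \<and> dist x y \<le> r}. ennreal (\<bar>f y - f x\<bar> / dist x y))"

definition Lip :: "('a::metric_space \<Rightarrow> real) \<Rightarrow> ennreal" where
  "Lip f = (SUP r\<in>{0<..}. Lip_upto f r)"

text \<open>The limit of \<open>\<alpha> h / h\<close> is taken in \<open>[0, \<infinity>]\<close>; it exists for convex \<open>\<alpha>\<close> with \<open>\<alpha> 0 = 0\<close>,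
  because \<open>\<alpha> h / h\<close> is then nondecreasing.\<close>

definition F_class :: "(real \<Rightarrow> real) \<Rightarrow> ('a::metric_space \<Rightarrow> real) set" where
  "F_class \<alpha> = {f. bounded (range f) \<and> (\<exists>r>0. Lip_upto f r < \<infinity>)
      \<and> Lip f \<le> Lim at_top (\<lambda>h. ennreal (\<alpha> h / h))}"

definition Ent :: "'a measure \<Rightarrow> ('a \<Rightarrow> real) \<Rightarrow> real" where
  "Ent \<mu> g = (\<integral>x. g x * ln (g x / (\<integral>y. g y \<partial>\<mu>)) \<partial>\<mu>)"

text \<open>Members of \<open>F_class \<alpha>\<close> are bounded and continuous, so the entropy below is a genuine
  integral. The right-hand side may be infinite; its integrand is nonnegative because
  \<open>conj_fun \<alpha> u \<ge> 0\<close> when \<open>\<alpha> 0 = 0\<close>, so \<open>e2ennreal\<close> loses nothing.\<close>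

definition LSI_minus :: "(real \<Rightarrow> real) \<Rightarrow> real \<Rightarrow> 'a::metric_space measure \<Rightarrow> bool" where
  "LSI_minus \<alpha> C \<mu> \<longleftrightarrow> (\<forall>f\<in>F_class \<alpha>.
     ereal (Ent \<mu> (\<lambda>x. exp (f x)))
       \<le> ereal C * enn2ereal (\<integral>\<^sup>+x. e2ennreal (conj_fun \<alpha> (enn2ereal (neg_slope f x)))
                                       * ennreal (exp (f x)) \<partial>\<mu>))"

definition borel_prob :: "'a::topological_space measure \<Rightarrow> bool" where
  "borel_prob \<nu> \<longleftrightarrow> prob_space \<nu> \<and> sets \<nu> = sets borel"

definition couplings :: "'a::metric_space measure \<Rightarrow> 'a measure \<Rightarrow> ('a \<times> 'a) measure set" where
  "couplings \<nu>1 \<nu>2 = {\<pi>. prob_space \<pi> \<and> sets \<pi> = sets (borel \<Otimes>\<^sub>M borel)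
      \<and> distr \<pi> borel fst = \<nu>1 \<and> distr \<pi> borel snd = \<nu>2}"

definition transport_cost :: "(real \<Rightarrow> real) \<Rightarrow> 'a::metric_space measure \<Rightarrow> 'a measure \<Rightarrow> ennreal" where
  "transport_cost \<alpha> \<nu>1 \<nu>2
     = (INF \<pi>\<in>couplings \<nu>1 \<nu>2. \<integral>\<^sup>+z. ennreal (\<alpha> (dist (fst z) (snd z))) \<partial>\<pi>)"

text \<open>For probability measures the negative part of \<open>ln (d\<nu>/d\<mu>)\<close> is always \<open>\<nu>\<close>-integrable, so
  failure of integrability means that the integral is \<open>+\<infinity>\<close>. The Bochner integral behind
  \<open>KL_divergence\<close> would return \<open>0\<close> in that case.\<close>

definition rel_entropy :: "'a measure \<Rightarrow> 'a measure \<Rightarrow> ereal" where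
  "rel_entropy \<nu> \<mu> =
     (if absolutely_continuous \<mu> \<nu> \<and> integrable \<nu> (entropy_density (exp 1) \<mu> \<nu>)
      then ereal (KL_divergence (exp 1) \<mu> \<nu>) else \<infinity>)"

definition transport_ineq :: "(real \<Rightarrow> real) \<Rightarrow> real \<Rightarrow> 'a::metric_space measure \<Rightarrow> bool" where
  "transport_ineq \<alpha> A \<mu> \<longleftrightarrow> (\<forall>\<nu>. borel_prob \<nu> \<longrightarrow>
     enn2ereal (transport_cost \<alpha> \<mu> \<nu>) \<le> ereal A * rel_entropy \<nu> \<mu>)"

end

theory Submission
  imports Defs
begin

text \<open>
  Let \<open>Q t f x = inf y. f y + t * \<alpha> (d x y / t)\<close> be the Hopf-Lax semigroup. A minimizer \<open>y\<close> at \<open>x\<close> bounds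
  the right derivative of \<open>Q t f x\<close> in \<open>t\<close> by \<open>- \<alpha>\<^sup>* (\<alpha>' h)\<close> with \<open>h = d x y / t\<close>, and a suitable
  minimizer has \<open>\<alpha>' h\<close> at least the descending slope of \<open>Q t f\<close>. With
  \<open>k t = (t / t0) powr (m - 1)\<close>, \<open>t0 = (p - 1) * C\<close>, where \<open>m\<close> is \<open>p\<close> before \<open>t0\<close> and \<open>r\<close> after it, the
  logarithmic Sobolev inequality applied to \<open>k t * Q t f\<close> makes \<open>ln (\<integral> exp (k t * Q t f) d\<mu>) / k t\<close>
  nonincreasing. Comparing the times \<open>0\<close> and \<open>1\<close>, where \<open>k 1 = 1 / A\<close>, gives
  \<open>\<integral> exp (Q 1 f / A) d\<mu> \<le> exp (\<integral> f d\<mu> / A)\<close>, hence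
  \<open>\<integral> Q 1 f d\<nu> - \<integral> f d\<mu> \<le> A * H(\<nu>|\<mu>)\<close> for all bounded lower semicontinuous \<open>f\<close>. This is the dual form of
  the transport inequality. As the transport cost is an infimum, no optimal coupling is needed: it suffices to
  quantize \<open>\<mu>\<close> and \<open>\<nu>\<close>, to solve the resulting finite transport problem by linear programming duality,
  and to control the mass far away by the exponential moments that the dual inequality provides.
\<close>

subsection \<open>Cost functions\<close>

text \<open>The form of \<open>k\<close> comes from a balance. Formally, the derivative of
  \<open>ln (\<integral> exp (k t * Q t f) d\<mu>) / k t\<close> is \<open>k' / k\<^sup>2\<close>
  times the normalized entropy, minus the weighted mean of
  \<open>\<alpha>\<^sup>* (\<alpha>' h)\<close>. For l = t / t0 and k = l powr (m - 1), the scaling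
  bound \<open>\<alpha>\<^sup>* (l powr (m - 1) * \<alpha>' h) \<le> l powr m * \<alpha>\<^sup>*
  (\<alpha>' h)\<close> and the Sobolev inequality bound the entropy by C * l * k times that mean.
  As k' / k = (m - 1) / t, the balance reads (m - 1) * C \<le> t0, with equality for m = p. The
  scaling bound holds with m = p for l \<le> 1 and with m = r for l \<ge> 1, hence the switch at
  \<open>t0\<close> and the maximum in \<open>A\<close>. As p > 1, k vanishes at time 0, where the
  logarithmic mean becomes the ordinary mean of \<open>f\<close>. The obstacle is regularity:
  neither time derivatives of the semigroup nor measurable minimizers are at hand. Right Dini
  derivatives along sequences and Fatou's lemma for difference quotients replace them. The data
  \<open>f\<close> are only lower semicontinuous because the dual inequality is tested with the
  indicator of an open set and with suprema of continuous functions.\<close>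

locale power_cost =
  fixes \<alpha> \<alpha>' :: "real \<Rightarrow> real" and r p :: real
  assumes zero: "\<alpha> 0 = 0"
    and pos: "x > 0 \<Longrightarrow> \<alpha> x > 0"
    and deriv: "x \<ge> 0 \<Longrightarrow> (\<alpha> has_real_derivative \<alpha>' x) (at x within {0..})"
    and deriv_cont: "continuous_on {0..} \<alpha>'"
    and convex: "convex_on {0..} \<alpha>"
    and lower: "x > 0 \<Longrightarrow> r * \<alpha> x \<le> x * \<alpha>' x"
    and upper: "x > 0 \<Longrightarrow> x * \<alpha>' x \<le> p * \<alpha> x"
    and r_ge_1: "1 \<le> r" and r_le_p: "r \<le> p" and p_gt_1: "1 < p"
begin

section \<open>Tangent inequality and monotonicity of the cost\<close>

lemma nonneg: "x \<ge> 0 \<Longrightarrow> \<alpha> x \<ge> 0"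
  using pos[of x] zero by (cases "x = 0") auto

lemma deriv_at: "x > 0 \<Longrightarrow> (\<alpha> has_real_derivative \<alpha>' x) (at x)"
  using deriv[of x] at_within_interior[of x "{0..}"] by simp

lemma cont: "continuous_on {0..} \<alpha>"
  using deriv by (meson DERIV_continuous atLeast_iff continuous_on_eq_continuous_within)

lemma tangent_pos:
  assumes "c > 0" "x \<ge> 0"
  shows "\<alpha> c + \<alpha>' c * (x - c) \<le> \<alpha> x"
  using convex_on_imp_above_tangent[OF convex _ _ _ deriv[of c], of x] assms by simp

text \<open>At an interior point convexity suffices. At the endpoint \<open>c = 0\<close> the
  inequality is the limit of those for \<open>c > 0\<close>, by continuity of
  \<open>\<alpha>'\<close>.\<close>

lemma tangent:
  assumes "c \<ge> 0" "x \<ge> 0"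
  shows "\<alpha> c + \<alpha>' c * (x - c) \<le> \<alpha> x"
proof (cases "c = 0")
  case True
  have "((\<lambda>c. \<alpha> c + \<alpha>' c * (x - c)) \<longlongrightarrow> \<alpha> 0 + \<alpha>' 0 * (x - 0)) (at 0 within {0..})"
    using cont deriv_cont by (intro tendsto_intros) (auto simp: continuous_on)
  then have "((\<lambda>c. \<alpha> c + \<alpha>' c * (x - c)) \<longlongrightarrow> \<alpha> 0 + \<alpha>' 0 * (x - 0)) (at_right 0)"
    by (rule tendsto_within_subset) auto
  moreover have "eventually (\<lambda>c. \<alpha> c + \<alpha>' c * (x - c) \<le> \<alpha> x) (at_right 0)"
    using tangent_pos assms by (auto simp: eventually_at_filter intro!: always_eventually)
  ultimately show ?thesis
    using True tendsto_upperbound trivial_limit_at_right_real by blast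
qed (use tangent_pos assms in auto)

lemma deriv_nonneg: "x \<ge> 0 \<Longrightarrow> \<alpha>' x \<ge> 0"
proof -
  have "\<alpha>' x \<ge> 0" if "x > 0" for x
  proof -
    have "0 \<le> r * \<alpha> x" using nonneg[of x] that r_ge_1 by simp
    also have "\<dots> \<le> x * \<alpha>' x" using lower that by simp
    finally show ?thesis using that by (simp add: zero_le_mult_iff)
  qed note * = this
  assume "x \<ge> 0"
  have "\<alpha>' 0 \<ge> 0"
  proof -
    have "(\<alpha>' \<longlongrightarrow> \<alpha>' 0) (at_right 0)"
      using deriv_cont by (auto simp: continuous_on intro: tendsto_within_subset)
    then show ?thesis
      using * by (intro tendsto_lowerbound[where f = \<alpha>' and F = "at_right 0"])
        (auto simp: eventually_at_filter intro!: always_eventually)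
  qed
  then show ?thesis using * \<open>x \<ge> 0\<close> by (cases "x = 0") auto
qed

lemma diff_le: "0 \<le> x \<Longrightarrow> 0 \<le> y \<Longrightarrow> \<alpha> y - \<alpha> x \<le> \<alpha>' y * (y - x)"
  using tangent[of y x] by (simp add: algebra_simps)

lemma mono: "0 \<le> x \<Longrightarrow> x \<le> y \<Longrightarrow> \<alpha> x \<le> \<alpha> y"
proof -
  assume a: "0 \<le> x" "x \<le> y"
  have "0 \<le> \<alpha>' x * (y - x)" using deriv_nonneg a by simp
  then show "\<alpha> x \<le> \<alpha> y" using tangent[of x y] a by linarith
qed

lemma deriv_mono: "0 \<le> x \<Longrightarrow> x \<le> y \<Longrightarrow> \<alpha>' x \<le> \<alpha>' y"
proof -
  assume a: "0 \<le> x" "x \<le> y"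
  have "\<alpha>' x * (y - x) \<le> \<alpha>' y * (y - x)"
    using tangent[of x y] diff_le[of x y] a by linarith
  then show ?thesis using a by (cases "x = y") (auto simp: mult_le_cancel_right)
qed

lemma abs_diff_le:
  assumes "0 \<le> a" "0 \<le> b" "a \<le> c" "b \<le> c"
  shows "\<bar>\<alpha> a - \<alpha> b\<bar> \<le> \<alpha>' c * \<bar>a - b\<bar>"
proof -
  have "\<alpha> x - \<alpha> y \<le> \<alpha>' c * \<bar>x - y\<bar>" if "0 \<le> x" "0 \<le> y" "x \<le> c" "y \<le> c" for x y
  proof (cases "x \<le> y")
    case True
    then have "\<alpha> x - \<alpha> y \<le> 0" using mono that by simp
    also have "0 \<le> \<alpha>' c * \<bar>x - y\<bar>" using deriv_nonneg[of c] that by simp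
    finally show ?thesis .
  next
    case False
    have "\<alpha> x - \<alpha> y \<le> \<alpha>' x * (x - y)" using diff_le that by simp
    also have "\<dots> \<le> \<alpha>' c * (x - y)" using deriv_mono[of x c] that False by (intro mult_right_mono) auto
    finally show ?thesis using False by simp
  qed
  from this[of a b] this[of b a] assms show ?thesis by (auto simp: abs_le_iff abs_minus_commute)
qed

text \<open>The derivative has the sign of \<open>x * \<alpha>' x - m * \<alpha> x\<close>, so the
  function is nonincreasing for \<open>m = p\<close> and nondecreasing for \<open>m = r\<close>.
  This is how the two exponents become power bounds.\<close>

lemma powr_scaled:
  assumes "x > 0"
  shows "((\<lambda>x. x powr (- m) * \<alpha> x) has_real_derivative x powr (- m - 1) * (x * \<alpha>' x - m * \<alpha> x)) (at x)"
proof -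
  have "((\<lambda>x. x powr (- m) * \<alpha> x) has_real_derivative (- m * x powr (- m - 1)) * \<alpha> x + \<alpha>' x * x powr (- m)) (at x)"
    using assms by (intro DERIV_mult deriv_at has_real_derivative_powr)
  moreover have "x powr (- m) = x powr (- m - 1) * x"
    using assms by (metis add.commute diff_add_cancel mult.commute powr_add powr_one order_less_imp_le)
  ultimately show ?thesis by (simp add: algebra_simps)
qed

lemma scale_upper:
  assumes "0 < l" "l \<le> 1" "y \<ge> 0"
  shows "l powr p * \<alpha> y \<le> \<alpha> (l * y)"
proof (cases "y = 0")
  case False
  then have y: "y > 0" using assms by simp
  have "y powr (- p) * \<alpha> y \<le> (l * y) powr (- p) * \<alpha> (l * y)"
  proof (rule DERIV_nonpos_imp_nonincreasing[where f = "\<lambda>x. x powr (- p) * \<alpha> x"])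
    show "l * y \<le> y" using assms by (simp add: mult_left_le_one_le)
    fix x assume "l * y \<le> x" "x \<le> y"
    then have "x > 0" using assms y by (smt (verit) mult_pos_pos)
    then show "\<exists>z. ((\<lambda>x. x powr (- p) * \<alpha> x) has_real_derivative z) (at x) \<and> z \<le> 0"
      using powr_scaled[of x p] upper[of x] by (intro exI[of _ "x powr (- p - 1) * (x * \<alpha>' x - p * \<alpha> x)"])
        (simp add: mult_nonneg_nonpos)
  qed
  then show ?thesis using y assms
    by (simp add: powr_mult powr_minus field_simps)
qed (auto simp: zero)

lemma scale_lower:
  assumes "1 \<le> l" "y \<ge> 0"
  shows "l powr r * \<alpha> y \<le> \<alpha> (l * y)"
proof (cases "y = 0")
  case False
  then have y: "y > 0" using assms by simp
  have "y powr (- r) * \<alpha> y \<le> (l * y) powr (- r) * \<alpha> (l * y)"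
  proof (rule DERIV_nonneg_imp_nondecreasing[where f = "\<lambda>x. x powr (- r) * \<alpha> x"])
    show "y \<le> l * y" using assms by (simp add: mult_le_cancel_right1)
    fix x assume "y \<le> x"
    then have "x > 0" using y by simp
    then show "\<exists>z. ((\<lambda>x. x powr (- r) * \<alpha> x) has_real_derivative z) (at x) \<and> 0 \<le> z"
      using powr_scaled[of x r] lower[of x] by (intro exI[of _ "x powr (- r - 1) * (x * \<alpha>' x - r * \<alpha> x)"])
        simp
  qed
  then show ?thesis using y assms
    by (simp add: powr_mult powr_minus field_simps)
qed (auto simp: zero)

text \<open>Since \<open>h * \<alpha>' h - \<alpha> h\<close> is the conjugate of
  \<open>\<alpha>\<close> at \<open>\<alpha>' h\<close>, this is the scaling bound for the
  conjugate, tested at \<open>x\<close>. Substituting \<open>x = l * y\<close> reduces it to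
  \<open>l powr m * \<alpha> y \<le> \<alpha> (l * y)\<close>.\<close>

lemma conj_scale:
  assumes "0 < l" "(m = p \<and> l \<le> 1) \<or> (m = r \<and> 1 \<le> l)" "h \<ge> 0" "x \<ge> 0"
  shows "x * (l powr (m - 1) * \<alpha>' h) - \<alpha> x \<le> l powr m * (h * \<alpha>' h - \<alpha> h)"
proof -
  define y where "y = x / l"
  have x: "x = l * y" "y \<ge> 0" using assms by (auto simp: y_def)
  have "l powr m * \<alpha> y \<le> \<alpha> x"
    using assms scale_upper[of l y] scale_lower[of l y] x by auto
  moreover have "x * (l powr (m - 1) * \<alpha>' h) = l powr m * (y * \<alpha>' h)"
    using assms by (simp add: x powr_diff)
  ultimately have "x * (l powr (m - 1) * \<alpha>' h) - \<alpha> x \<le> l powr m * (y * \<alpha>' h - \<alpha> y)"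
    by (simp only: right_diff_distrib)
  also have "\<dots> \<le> l powr m * (h * \<alpha>' h - \<alpha> h)"
    using tangent[of h y] assms x by (intro mult_left_mono) (auto simp: algebra_simps)
  finally show ?thesis .
qed

lemma young_nonneg: "h \<ge> 0 \<Longrightarrow> 0 \<le> h * \<alpha>' h - \<alpha> h"
  using tangent[of h 0] zero by (simp add: algebra_simps)

lemma unbounded: 
  obtains R where "R > 0" "\<And>x. x > R \<Longrightarrow> \<alpha> x > B"
proof -
  have "\<alpha> x > B" if "x > \<bar>B\<bar> / \<alpha> 1 + 1" for x
  proof -
    have x: "x \<ge> 1" using that pos[of 1] by (smt (verit) divide_nonneg_pos)
    have "x powr 1 \<le> x powr r" using x r_ge_1 by (intro powr_mono) auto
    then have "x * \<alpha> 1 \<le> \<alpha> x" using scale_lower[of x 1] x pos[of 1]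
      by (smt (verit) mult_right_mono mult.right_neutral powr_one)
    moreover have "x * \<alpha> 1 > B" using that pos[of 1] by (simp add: field_simps)
    ultimately show ?thesis by simp
  qed
  moreover have "\<bar>B\<bar> / \<alpha> 1 + 1 > 0" using pos[of 1] by (smt (verit) divide_nonneg_pos)
  ultimately show ?thesis using that by blast
qed

lemma quasi_triangle:
  assumes "0 \<le> a" "0 \<le> b" "c \<le> a + b" "0 \<le> c"
  shows "\<alpha> c \<le> 2 powr p * (\<alpha> a + \<alpha> b)"
proof -
  have d: "\<alpha> (2 * x) \<le> 2 powr p * \<alpha> x" if "x \<ge> 0" for x
    using scale_upper[of "1/2" "2 * x"] that by (simp add: powr_divide field_simps)
  have "\<alpha> c \<le> \<alpha> (2 * max a b)" using assms by (intro mono) auto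
  also have "\<dots> \<le> 2 powr p * \<alpha> (max a b)" using d assms by simp
  also have "\<dots> \<le> 2 powr p * (\<alpha> a + \<alpha> b)"
    using nonneg[of a] nonneg[of b] assms by (intro mult_left_mono) (auto simp: max_def)
  finally show ?thesis .
qed

text \<open>The tangent at \<open>d / t\<close>, evaluated at \<open>d / s\<close>, leaves the Young
  gap at \<open>d / t\<close> with the factor \<open>t - s \<ge> 0\<close>. It is the source of
  monotonicity in time of the semigroup.\<close>

lemma perspective_antimono:
  assumes "0 < s" "s \<le> t" "d \<ge> 0"
  shows "t * \<alpha> (d / t) \<le> s * \<alpha> (d / s)"
proof -
  have "\<alpha> (d / t) + \<alpha>' (d / t) * (d / s - d / t) \<le> \<alpha> (d / s)"
    using assms by (intro tangent) auto
  then have "s * (\<alpha> (d / t) + \<alpha>' (d / t) * (d / s - d / t)) \<le> s * \<alpha> (d / s)"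
    using assms by simp
  moreover have "s * (\<alpha> (d / t) + \<alpha>' (d / t) * (d / s - d / t))
     = t * \<alpha> (d / t) + (t - s) * ((d / t) * \<alpha>' (d / t) - \<alpha> (d / t))"
    using assms by (simp add: field_simps)
  moreover have "0 \<le> (t - s) * ((d / t) * \<alpha>' (d / t) - \<alpha> (d / t))"
    using assms young_nonneg[of "d / t"] by (intro mult_nonneg_nonneg) auto
  ultimately show ?thesis by linarith
qed

lemma perspective_deriv:
  assumes "0 < t" "d \<ge> 0"
  shows "((\<lambda>s. s * \<alpha> (d / s)) has_real_derivative - ((d / t) * \<alpha>' (d / t) - \<alpha> (d / t))) (at t)"
proof (cases "d = 0")
  case True then show ?thesis using zero by simp
next
  case False
  then have "((\<lambda>s. \<alpha> (d / s)) has_real_derivative \<alpha>' (d / t) * (- d / t\<^sup>2)) (at t)"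
    using assms by (intro DERIV_chain2[OF deriv_at])
      (auto intro!: derivative_eq_intros simp: power2_eq_square)
  then have "((\<lambda>s. s * \<alpha> (d / s)) has_real_derivative 1 * \<alpha> (d / t) + \<alpha>' (d / t) * (- d / t\<^sup>2) * t) (at t)"
    by (intro DERIV_mult DERIV_ident)
  moreover have "1 * \<alpha> (d / t) + \<alpha>' (d / t) * (- d / t\<^sup>2) * t = - ((d / t) * \<alpha>' (d / t) - \<alpha> (d / t))"
    using assms by (simp add: field_simps power2_eq_square)
  ultimately show ?thesis by simp
qed

section \<open>The growth ratio at infinity and the conjugate\<close>

lemma ratio_mono: "0 < x \<Longrightarrow> x \<le> y \<Longrightarrow> \<alpha> x / x \<le> \<alpha> y / y"
  \<comment> \<open>At distance 1 the perspective at time \<open>1 / x\<close> is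
    \<open>\<alpha> x / x\<close>.\<close>
  using perspective_antimono[of "1 / y" "1 / x" 1] by (simp add: field_simps)

lemma Lim_ratio:
  "Lim at_top (\<lambda>h. ennreal (\<alpha> h / h)) = (SUP h\<in>{0<..}. ennreal (\<alpha> h / h))"
proof (rule tendsto_Lim)
  let ?L = "SUP h\<in>{0<..}. ennreal (\<alpha> h / h)"
  show "((\<lambda>h. ennreal (\<alpha> h / h)) \<longlongrightarrow> ?L) at_top"
  proof (rule increasing_tendsto)
    show "eventually (\<lambda>h. ennreal (\<alpha> h / h) \<le> ?L) at_top"
      using eventually_gt_at_top[of "0::real"] by eventually_elim (rule SUP_upper, simp)
    fix c assume "c < ?L"
    then obtain x where x: "x > 0" "c < ennreal (\<alpha> x / x)" unfolding less_SUP_iff by auto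
    show "eventually (\<lambda>h. c < ennreal (\<alpha> h / h)) at_top"
      using eventually_ge_at_top[of x]
      by eventually_elim (meson x ratio_mono less_le_trans ennreal_leI)
  qed
qed simp

text \<open>Treats the case where the Lipschitz condition in \<open>F_class\<close> has content,
  that is, where \<open>\<alpha>\<close> grows at most linearly. Growth of order
  \<open>h powr r\<close> then forces \<open>r = 1\<close>, so the coefficient \<open>k\<close>
  never exceeds 1, and convexity bounds all slopes by the growth rate.\<close>

lemma finite_ratio:
  assumes "\<And>h. h > 0 \<Longrightarrow> \<alpha> h / h \<le> l"
  shows "r = 1" "z \<ge> 0 \<Longrightarrow> \<alpha>' z \<le> l"
proof -
  show "r = 1"
  proof (rule ccontr)
    assume "r \<noteq> 1"
    then have r: "r > 1" using r_ge_1 by simp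
    \<comment> \<open>Chosen so that \<open>b * \<alpha> 1 > l\<close>; the next \<open>h\<close>
      satisfies \<open>h powr (r - 1) = b\<close>.\<close>
    define b where "b = \<bar>l\<bar> / \<alpha> 1 + 1"
    have b: "b \<ge> 1" using pos[of 1] by (simp add: b_def)
    define h where "h = b powr (1 / (r - 1))"
    have h: "h \<ge> 1" using b r by (simp add: h_def ge_one_powr_ge_zero)
    have "h powr r * \<alpha> 1 \<le> l * h"
      using scale_lower[of h 1] h assms[of h] by (simp add: field_simps)
    moreover have "h powr r = h powr (r - 1) * h" using h by (simp add: powr_diff)
    ultimately have "h powr (r - 1) * \<alpha> 1 \<le> l" using h by (simp add: field_simps)
    moreover have "h powr (r - 1) = b" using b r by (simp add: h_def powr_powr)
    ultimately show False using pos[of 1] by (simp add: b_def field_simps)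
  qed
  assume z: "z \<ge> 0"
  show "\<alpha>' z \<le> l"
  proof (rule ccontr)
    assume "\<not> \<alpha>' z \<le> l"
    then have g: "\<alpha>' z - l > 0" by simp
    \<comment> \<open>At this \<open>h\<close> the tangent at \<open>z\<close> exceeds
      \<open>l * h\<close> by exactly 1.\<close>
    define h where "h = (z * \<alpha>' z - \<alpha> z + 1) / (\<alpha>' z - l)"
    have h: "h > 0" using g young_nonneg[OF z] by (simp add: h_def)
    have "\<alpha> z + \<alpha>' z * (h - z) \<le> l * h"
      using tangent[of z h] z h assms[of h] by (simp add: field_simps)
    then have "h * (\<alpha>' z - l) \<le> z * \<alpha>' z - \<alpha> z" by (simp add: algebra_simps)
    moreover have "h * (\<alpha>' z - l) = z * \<alpha>' z - \<alpha> z + 1" using g by (simp add: h_def)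
    ultimately show False by simp
  qed
qed

lemma conj_fun_scale:
  assumes "0 < l" "(m = p \<and> l \<le> 1) \<or> (m = r \<and> 1 \<le> l)" "h \<ge> 0"
    and "u \<le> ennreal (l powr (m - 1) * \<alpha>' h)"
  shows "e2ennreal (conj_fun \<alpha> (enn2ereal u)) \<le> ennreal (l powr m * (h * \<alpha>' h - \<alpha> h))"
proof -
  have "u < \<top>" using assms(4) by (simp add: le_less_trans)
  then obtain v where v: "u = ennreal v" "v \<ge> 0" by (cases u) auto
  have nn: "0 \<le> l powr (m - 1) * \<alpha>' h" using deriv_nonneg assms by simp
  have vle: "v \<le> l powr (m - 1) * \<alpha>' h" using assms(4) v nn by (simp add: ennreal_le_iff)
  have "conj_fun \<alpha> (enn2ereal u) \<le> ereal (l powr m * (h * \<alpha>' h - \<alpha> h))"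
    unfolding conj_fun_def
  proof (rule SUP_least)
    fix x :: real assume x: "x \<in> {0..}"
    then have "x * v - \<alpha> x \<le> x * (l powr (m - 1) * \<alpha>' h) - \<alpha> x"
      using vle by (simp add: mult_left_mono)
    also have "\<dots> \<le> l powr m * (h * \<alpha>' h - \<alpha> h)" using conj_scale assms x by auto
    finally show "ereal x * enn2ereal u - ereal (\<alpha> x) \<le> ereal (l powr m * (h * \<alpha>' h - \<alpha> h))"
      using v by (simp add: enn2ereal_ennreal)
  qed
  then have "e2ennreal (conj_fun \<alpha> (enn2ereal u)) \<le> e2ennreal (ereal (l powr m * (h * \<alpha>' h - \<alpha> h)))"
    by (rule e2ennreal_mono)
  then show ?thesis by (simp add: e2ennreal_ereal)
qed

end

text \<open>Positivity of \<open>\<alpha>\<close> is extracted from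
  \<open>1 < upper_exponent \<alpha>\<close>: a zero at some \<open>x > 0\<close> spreads to all
  \<open>2 ^ n * x\<close> by \<open>Delta2\<close> and from there to the half-line by
  convexity.\<close>

lemma power_costI:
  assumes nn: "\<And>x. x \<ge> 0 \<Longrightarrow> \<alpha> x \<ge> 0"
    and convex: "convex_on {0..} \<alpha>"
    and C1: "C1_halfline \<alpha>"
    and zero: "\<alpha> 0 = 0"
    and D: "Delta2 \<alpha>"
    and "1 < upper_exponent \<alpha>"
  obtains \<alpha>' where "power_cost \<alpha> \<alpha>' (lower_exponent \<alpha>) (upper_exponent \<alpha>)"
proof -
  obtain \<alpha>' where d: "\<And>x. x \<ge> 0 \<Longrightarrow> (\<alpha> has_real_derivative \<alpha>' x) (at x within {0..})"
    and c: "continuous_on {0..} \<alpha>'" using C1 unfolding C1_halfline_def by blast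
  obtain K where K: "K > 0" "\<And>x. x \<ge> 0 \<Longrightarrow> \<alpha> (2 * x) \<le> K * \<alpha> x"
    using D unfolding Delta2_def by blast
  have deriv: "deriv \<alpha> x = \<alpha>' x" if "x > 0" for x
    using d[of x] that at_within_interior[of x "{0..}"] by (auto intro: DERIV_imp_deriv)
  have tan: "\<alpha> c + \<alpha>' c * (x - c) \<le> \<alpha> x" if "c > 0" "x \<ge> 0" for c x
    using convex_on_imp_above_tangent[OF convex _ _ _ d[of c], of x] that by simp
  have pos: "\<alpha> x > 0" if "x > 0" for x
  proof (rule ccontr)
    assume "\<not> \<alpha> x > 0"
    then have x: "\<alpha> x = 0" using nn[of x] that by simp
    have pw: "\<alpha> (2 ^ n * x) = 0" for n
    proof (induction n)
      case (Suc n)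
      then have "\<alpha> (2 * (2 ^ n * x)) \<le> 0" using K(2)[of "2 ^ n * x"] that by simp
      then show ?case using nn[of "2 * (2 ^ n * x)"] that by (simp add: mult.assoc)
    qed (use x in simp)
    have all0: "\<alpha> y = 0" if "y > 0" for y
    proof -
      obtain n where n: "y / x < 2 ^ n" using real_arch_pow[of 2] by auto
      define z where "z = 2 ^ n * x"
      have z: "z > 0" "y < z" using n \<open>x > 0\<close> by (auto simp: z_def field_simps)
      have "\<alpha> ((y / z) * z) \<le> (1 - y / z) * \<alpha> 0 + (y / z) * \<alpha> z"
        using convex_onD[OF convex, of "y / z" 0 z] z that by (simp del: times_divide_eq_left)
      moreover have "(y / z) * z = y" using z by simp
      ultimately have "\<alpha> y \<le> 0" using pw[of n] zero by (simp add: z_def)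
      then show ?thesis using nn[of y] that by simp
    qed
    \<comment> \<open>Division by zero yields 0, so the supremum of the quotients would be
      0.\<close>
    have "(\<lambda>x. x * deriv \<alpha> x / \<alpha> x) ` {0<..} = {0}"
      by (auto simp: all0 image_iff intro: exI[of _ "1::real"] zero_less_one)
    then show False using assms(6) by (simp add: upper_exponent_def)
  qed
  \<comment> \<open>The tangent at \<open>x\<close> is evaluated at 0 for the lower bound and at
    \<open>2 * x\<close> for the upper one.\<close>
  have lo: "1 \<le> x * \<alpha>' x / \<alpha> x" if "x > 0" for x
    using tan[of x 0] that pos[of x] zero by (simp add: field_simps)
  have up: "x * \<alpha>' x / \<alpha> x \<le> K - 1" if "x > 0" for x
    using tan[of x "2 * x"] K(2)[of x] that pos[of x] by (simp add: field_simps)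
  have low: "lower_exponent \<alpha> = (INF x\<in>{0<..}. x * \<alpha>' x / \<alpha> x)"
    unfolding lower_exponent_def by (intro arg_cong[where f = Inf] image_cong) (auto simp: deriv)
  have upp: "upper_exponent \<alpha> = (SUP x\<in>{0<..}. x * \<alpha>' x / \<alpha> x)"
    unfolding upper_exponent_def by (intro arg_cong[where f = Sup] image_cong) (auto simp: deriv)
  have l: "lower_exponent \<alpha> \<le> x * \<alpha>' x / \<alpha> x" if "x > 0" for x
    unfolding low using that lo by (intro cINF_lower bdd_belowI2[where m = 1]) auto
  have u: "x * \<alpha>' x / \<alpha> x \<le> upper_exponent \<alpha>" if "x > 0" for x
    unfolding upp using that up by (intro cSUP_upper bdd_aboveI2[where M = "K - 1"]) auto
  have "1 \<le> lower_exponent \<alpha>" unfolding low using lo by (intro cINF_greatest) auto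
  moreover have "lower_exponent \<alpha> \<le> upper_exponent \<alpha>" using l[of 1] u[of 1] by simp
  moreover have "lower_exponent \<alpha> * \<alpha> x \<le> x * \<alpha>' x" if "x > 0" for x
    using l[of x] pos[of x] that by (simp add: field_simps)
  moreover have "x * \<alpha>' x \<le> upper_exponent \<alpha> * \<alpha> x" if "x > 0" for x
    using u[of x] pos[of x] that by (simp add: field_simps)
  ultimately have "power_cost \<alpha> \<alpha>' (lower_exponent \<alpha>) (upper_exponent \<alpha>)"
    using zero pos d c convex assms(6) by unfold_locales
  then show thesis by (rule that)
qed

subsection \<open>The Hopf-Lax semigroup\<close>

definition lsc :: "('a::topological_space \<Rightarrow> real) \<Rightarrow> bool" where
  "lsc f \<longleftrightarrow> (\<forall>x c. c < f x \<longrightarrow> eventually (\<lambda>y. c < f y) (nhds x))"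

lemma lsc_le_lim:
  assumes "lsc f" "u \<longlonglongrightarrow> y" "(\<lambda>n. f (u n)) \<longlonglongrightarrow> l"
  shows "f y \<le> l"
proof (rule ccontr)
  assume "\<not> f y \<le> l"
  then obtain c where c: "l < c" "c < f y" using dense[of l "f y"] by auto
  have "eventually (\<lambda>z. c < f z) (nhds y)" using assms(1) c unfolding lsc_def by blast
  then have "eventually (\<lambda>n. c < f (u n)) sequentially"
    using assms(2) unfolding filterlim_iff by blast
  then have "eventually (\<lambda>n. c \<le> f (u n)) sequentially"
    by (rule eventually_mono) simp
  then have "c \<le> l" by (intro tendsto_lowerbound[OF assms(3)]) simp_all
  then show False using c by simp
qed

lemma lsc_borel:
  fixes f :: "'a::topological_space \<Rightarrow> real"
  assumes "lsc f" shows "f \<in> borel_measurable borel"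
proof -
  have "open {x. c < f x}" for c
  proof (subst open_subopen, clarify)
    fix x assume "c < f x"
    then obtain S where "open S" "x \<in> S" "\<forall>y\<in>S. c < f y"
      using assms unfolding lsc_def eventually_nhds by blast
    then show "\<exists>T. open T \<and> x \<in> T \<and> T \<subseteq> {x. c < f x}" by blast
  qed
  then have "{x \<in> space borel. c < f x} \<in> sets borel" for c by simp
  then show ?thesis unfolding borel_measurable_iff_greater by blast
qed

locale hopf_lax = power_cost \<alpha> \<alpha>' r p for \<alpha> \<alpha>' r p +
  fixes f :: "'a::metric_space \<Rightarrow> real" and M :: real
  assumes proper: "compact (cball (x::'a) \<rho>)"
    and lsc: "lsc f"
    and f_bound: "\<bar>f x\<bar> \<le> M"
begin

definition Q :: "real \<Rightarrow> 'a \<Rightarrow> real" where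
  "Q t x = (INF y. f y + t * \<alpha> (dist x y / t))"

definition minimizer :: "real \<Rightarrow> 'a \<Rightarrow> 'a \<Rightarrow> bool" where
  "minimizer t x y \<longleftrightarrow> Q t x = f y + t * \<alpha> (dist x y / t)"

section \<open>Bounds and minimizers of the Hopf-Lax infimum\<close>

lemma cost_nonneg: "t > 0 \<Longrightarrow> 0 \<le> t * \<alpha> (dist x y / t)"
  using nonneg by simp

lemma Q_le: "t > 0 \<Longrightarrow> Q t x \<le> f y + t * \<alpha> (dist x y / t)"
proof -
  assume t: "t > 0"
  have "- M \<le> f y + t * \<alpha> (dist x y / t)" for y
    using f_bound[of y] cost_nonneg[OF t, of x y] by linarith
  then show ?thesis unfolding Q_def by (intro cINF_lower bdd_belowI2[where m = "- M"]) auto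
qed

lemma Q_greatest: "(\<And>y. c \<le> f y + t * \<alpha> (dist x y / t)) \<Longrightarrow> c \<le> Q t x"
  unfolding Q_def by (intro cINF_greatest) auto

lemma Q_le_f: "t > 0 \<Longrightarrow> Q t x \<le> f x"
  using Q_le[of t x x] zero by simp

lemma Q_bound:
  assumes "t > 0" shows "\<bar>Q t x\<bar> \<le> M"
proof -
  have "- M \<le> f y + t * \<alpha> (dist x y / t)" for y
    using f_bound[of y] cost_nonneg[OF assms, of x y] by linarith
  then have "- M \<le> Q t x" by (rule Q_greatest)
  then show ?thesis using Q_le_f[OF assms, of x] f_bound[of x] by linarith
qed

lemma Q_antimono:
  assumes "0 < s" "s \<le> t" shows "Q t x \<le> Q s x"
proof (rule Q_greatest)
  fix y show "Q t x \<le> f y + s * \<alpha> (dist x y / s)"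
    using Q_le[of t x y] perspective_antimono[of s t "dist x y"] assms by simp
qed

text \<open>As \<open>f \<ge> - M\<close>, at most \<open>2 * M + 1\<close> is left for the cost.
  The slack 1 admits almost minimizers, which are needed before minimizers are known to exist;
  \<open>R\<close> is independent of the base point.\<close>

lemma near_minimizer_bound:
  assumes "t > 0"
  obtains R where "R > 0" "\<And>x y. f y + t * \<alpha> (dist x y / t) \<le> M + 1 \<Longrightarrow> dist x y \<le> t * R"
proof -
  obtain R where R: "R > 0" "\<And>x. x > R \<Longrightarrow> \<alpha> x > (2 * M + 1) / t"
    using unbounded by blast
  have "dist x y \<le> t * R" if "f y + t * \<alpha> (dist x y / t) \<le> M + 1" for x y
  proof (rule ccontr)
    assume "\<not> dist x y \<le> t * R"
    then have "dist x y / t > R" using assms by (simp add: field_simps)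
    then have "t * \<alpha> (dist x y / t) > 2 * M + 1"
      using R(2) assms by (simp add: field_simps)
    then show False using that f_bound[of y] by linarith
  qed
  then show ?thesis using that R(1) by blast
qed

text \<open>Closedness of the minimizer relation: lower semicontinuity along \<open>v\<close> gives
  one inequality, the infimum the other. Existence of minimizers takes \<open>u\<close> constant;
  the slope estimate needs moving base points.\<close>

lemma minimizerI:
  assumes "t > 0" "u \<longlonglongrightarrow> x" "v \<longlonglongrightarrow> y"
    and "(\<lambda>n. f (v n) + t * \<alpha> (dist (u n) (v n) / t)) \<longlonglongrightarrow> Q t x"
  shows "minimizer t x y"
proof -
  have "(\<lambda>n. dist (u n) (v n) / t) \<longlonglongrightarrow> dist x y / t"
    using assms by (intro tendsto_intros) auto
  then have "(\<lambda>n. \<alpha> (dist (u n) (v n) / t)) \<longlonglongrightarrow> \<alpha> (dist x y / t)"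
    using assms(1) by (intro continuous_on_tendsto_compose[OF cont]) auto
  then have "(\<lambda>n. f (v n) + t * \<alpha> (dist (u n) (v n) / t) - t * \<alpha> (dist (u n) (v n) / t))
     \<longlonglongrightarrow> Q t x - t * \<alpha> (dist x y / t)"
    using assms by (intro tendsto_intros)
  then have "f y \<le> Q t x - t * \<alpha> (dist x y / t)"
    using lsc_le_lim[OF lsc assms(3)] by simp
  then show ?thesis using Q_le[of t x y] assms(1) unfolding minimizer_def by simp
qed

lemma minimizer_exists:
  assumes "t > 0" obtains y where "minimizer t x y"
proof -
  define v where "v n = (SOME y. f y + t * \<alpha> (dist x y / t) < Q t x + 1 / Suc n)" for n
  have v: "f (v n) + t * \<alpha> (dist x (v n) / t) < Q t x + 1 / Suc n" for n
  proof -
    have "\<exists>y. f y + t * \<alpha> (dist x y / t) < Q t x + 1 / Suc n"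
    proof (rule ccontr)
      assume "\<not> ?thesis"
      then have "Q t x + 1 / Suc n \<le> Q t x" by (intro Q_greatest) (simp add: not_less)
      then show False by (simp add: field_simps)
    qed
    then show ?thesis unfolding v_def by (rule someI_ex)
  qed
  have lim: "(\<lambda>n. f (v n) + t * \<alpha> (dist x (v n) / t)) \<longlonglongrightarrow> Q t x"
  proof (rule tendsto_sandwich[where f = "\<lambda>_. Q t x" and h = "\<lambda>n. Q t x + 1 / Suc n"])
    show "(\<lambda>n. Q t x + 1 / Suc n) \<longlonglongrightarrow> Q t x"
      using tendsto_add[OF tendsto_const LIMSEQ_inverse_real_of_nat, of "Q t x"]
      by (simp add: inverse_eq_divide)
    show "eventually (\<lambda>n. f (v n) + t * \<alpha> (dist x (v n) / t) \<le> Q t x + 1 / Suc n) sequentially"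
      using v by (intro always_eventually allI less_imp_le)
  qed (use Q_le[OF assms] in auto)
  obtain R where R: "\<And>x y. f y + t * \<alpha> (dist x y / t) \<le> M + 1 \<Longrightarrow> dist x y \<le> t * R"
    using near_minimizer_bound[OF assms] by metis
  have "v n \<in> cball x (t * R)" for n
  proof -
    have "(1::real) / Suc n \<le> 1" by simp
    then have "f (v n) + t * \<alpha> (dist x (v n) / t) \<le> M + 1"
      using v[of n] Q_bound[OF assms, of x] by linarith
    then show ?thesis using R[of "v n" x] by simp
  qed
  then obtain y s where s: "strict_mono s" "(v \<circ> s) \<longlonglongrightarrow> y"
    using proper[of x "t * R"] unfolding compact_def by metis
  then have "minimizer t x y"
    using LIMSEQ_subseq_LIMSEQ[OF lim s(1)] assms
    by (intro minimizerI[where u = "\<lambda>_. x" and v = "v \<circ> s"]) (auto simp: o_def)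
  then show ?thesis by (rule that)
qed

lemma minimizer_bound:
  assumes "t > 0"
  obtains R where "R > 0" "\<And>x y. minimizer t x y \<Longrightarrow> dist x y \<le> t * R"
proof -
  obtain R where R: "R > 0" "\<And>x y. f y + t * \<alpha> (dist x y / t) \<le> M + 1 \<Longrightarrow> dist x y \<le> t * R"
    using near_minimizer_bound[OF assms] by metis
  have "dist x y \<le> t * R" if "minimizer t x y" for x y
    using R(2)[of y x] that Q_bound[OF assms, of x] unfolding minimizer_def by simp
  then show ?thesis using R(1) that by blast
qed

text \<open>The minimizer for \<open>x'\<close> competes at \<open>x\<close>. Taking
  \<open>\<alpha>'\<close> at the distance from \<open>x\<close> makes the convexity bound valid
  whichever of the two distances is larger.\<close>

lemma Q_diff_le:
  assumes "t > 0" "minimizer t x' y"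
  shows "Q t x - Q t x' \<le> \<alpha>' (dist x y / t) * dist x x'"
proof -
  have "Q t x - Q t x' \<le> t * (\<alpha> (dist x y / t) - \<alpha> (dist x' y / t))"
    using Q_le[OF assms(1), of x y] assms(2) unfolding minimizer_def by (simp add: algebra_simps)
  also have "\<dots> \<le> t * (\<alpha>' (dist x y / t) * (dist x y / t - dist x' y / t))"
    using diff_le[of "dist x' y / t" "dist x y / t"] assms(1) by simp
  also have "\<dots> = \<alpha>' (dist x y / t) * (dist x y - dist x' y)"
    using assms(1) by (simp add: field_simps)
  also have "\<dots> \<le> \<alpha>' (dist x y / t) * dist x x'"
    using deriv_nonneg[of "dist x y / t"] assms(1) dist_triangle[of x y x']
    by (intro mult_left_mono) auto
  finally show ?thesis .
qed

text \<open>The radius confining minimizers is the same for all base points, so one constant serves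
  the whole space at scale 1, as the finiteness of \<open>Lip_upto\<close> requires.\<close>

lemma Q_local_Lipschitz:
  assumes "t > 0"
  obtains L where "L \<ge> 0" "\<And>x x'. dist x x' \<le> 1 \<Longrightarrow> \<bar>Q t x - Q t x'\<bar> \<le> L * dist x x'"
proof -
  obtain R where R: "R > 0" "\<And>x y. minimizer t x y \<Longrightarrow> dist x y \<le> t * R"
    using minimizer_bound[OF assms] by metis
  have *: "Q t x - Q t x' \<le> \<alpha>' (R + 1 / t) * dist x x'" if "dist x x' \<le> 1" for x x'
  proof -
    obtain y where y: "minimizer t x' y" using minimizer_exists[OF assms] by blast
    have "dist x y \<le> 1 + t * R"
      using dist_triangle[of x y x'] R(2)[OF y] that by simp
    then have "\<alpha>' (dist x y / t) \<le> \<alpha>' (R + 1 / t)"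
      using assms by (intro deriv_mono) (auto simp: field_simps)
    then have "\<alpha>' (dist x y / t) * dist x x' \<le> \<alpha>' (R + 1 / t) * dist x x'"
      by (rule mult_right_mono) simp
    then show ?thesis using Q_diff_le[OF assms y, of x] by linarith
  qed
  show ?thesis
  proof (rule that)
    show "\<alpha>' (R + 1 / t) \<ge> 0" using deriv_nonneg R(1) assms by simp
    show "\<bar>Q t x - Q t x'\<bar> \<le> \<alpha>' (R + 1 / t) * dist x x'" if "dist x x' \<le> 1" for x x'
      using *[of x x'] *[of x' x] that by (simp add: dist_commute abs_le_iff)
  qed
qed

lemma Q_continuous: "t > 0 \<Longrightarrow> continuous_on UNIV (Q t)"
proof -
  assume t: "t > 0"
  obtain L where L: "L \<ge> 0" "\<And>x x'. dist x x' \<le> 1 \<Longrightarrow> \<bar>Q t x - Q t x'\<bar> \<le> L * dist x x'"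
    using Q_local_Lipschitz[OF t] by metis
  show ?thesis unfolding continuous_on_iff
  proof (intro ballI allI impI)
    fix x :: 'a and e :: real assume e: "e > 0"
    show "\<exists>d>0. \<forall>x'\<in>UNIV. dist x' x < d \<longrightarrow> dist (Q t x') (Q t x) < e"
    proof (intro exI[of _ "min 1 (e / (L + 1))"] conjI ballI impI)
      show "0 < min 1 (e / (L + 1))" using e L(1) by simp
      fix x' assume d: "dist x' x < min 1 (e / (L + 1))"
      have "dist (Q t x') (Q t x) \<le> L * dist x' x" using L(2)[of x' x] d by (simp add: dist_real_def)
      also have "\<dots> \<le> (L + 1) * dist x' x" by (intro mult_right_mono) auto
      also have "\<dots> < e" using d L(1) by (simp add: field_simps)
      finally show "dist (Q t x') (Q t x) < e" .
    qed
  qed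
qed

lemma Q_borel: "t > 0 \<Longrightarrow> Q t \<in> borel_measurable borel"
  by (intro borel_measurable_continuous_onI Q_continuous)

text \<open>Minimizers for base points tending to \<open>x\<close> accumulate at a minimizer for \<open>x\<close>, which
  realizes the limsup in the descending slope.\<close>

lemma neg_slope_Q_le:
  assumes "t > 0" "k > 0"
  obtains y where "minimizer t x y" "neg_slope (\<lambda>x. k * Q t x) x \<le> ennreal (k * \<alpha>' (dist x y / t))"
proof -
  let ?g = "\<lambda>z. max 0 (- (k * Q t z - k * Q t x)) / dist x z"
  obtain L where L: "L \<ge> 0" "\<And>x x'. dist x x' \<le> 1 \<Longrightarrow> \<bar>Q t x - Q t x'\<bar> \<le> L * dist x x'"
    using Q_local_Lipschitz[OF assms(1)] by metis
  obtain R where R: "R > 0" "\<And>x y. minimizer t x y \<Longrightarrow> dist x y \<le> t * R"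
    using minimizer_bound[OF assms(1)] by metis
  have near: "eventually (\<lambda>z. dist z x < e) (at x)" if "e > 0" for e
    using that by (auto simp: eventually_at)
  have "eventually (\<lambda>z. ennreal (?g z) \<le> ennreal (k * L)) (at x)"
    using near[of 1]
  proof (rule eventually_mono)
    fix z assume "dist z x < 1"
    then have "k * (Q t x - Q t z) \<le> k * (L * dist x z)"
      using L(2)[of x z] assms by (intro mult_left_mono) (auto simp: dist_commute)
    then have "?g z \<le> k * L" using L(1) assms
      by (cases "x = z") (auto simp: field_simps)
    then show "ennreal (?g z) \<le> ennreal (k * L)" by (rule ennreal_leI)
  qed simp
  then have "neg_slope (\<lambda>x. k * Q t x) x \<le> ennreal (k * L)"
    unfolding neg_slope_def by (rule Limsup_bounded)
  then have "neg_slope (\<lambda>x. k * Q t x) x < \<top>" by (simp add: le_less_trans)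
  then obtain l where l: "neg_slope (\<lambda>x. k * Q t x) x = ennreal l" "l \<ge> 0"
    by (cases "neg_slope (\<lambda>x. k * Q t x) x") auto
  show ?thesis
  proof (cases "l = 0")
    \<comment> \<open>Any minimizer serves here. This case includes isolated points, where no
      sequence of nearby points exists.\<close>
    case True
    obtain y where "minimizer t x y" using minimizer_exists[OF assms(1)] by blast
    then show ?thesis using that l True by simp
  next
    case False
    have "\<exists>z. l - 1 / Suc n < ?g z \<and> dist z x < 1 / Suc n" for n
    proof (rule ccontr)
      assume "\<not> ?thesis"
      then have "ennreal (?g z) \<le> ennreal (l - 1 / Suc n)" if "dist z x < 1 / Suc n" for z
        using that by (intro ennreal_leI) (auto simp: not_less)
      then have "eventually (\<lambda>z. ennreal (?g z) \<le> ennreal (l - 1 / Suc n)) (at x)"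
        by (intro eventually_mono[OF near[of "1 / Suc n"]]) simp_all
      then have "neg_slope (\<lambda>x. k * Q t x) x \<le> ennreal (l - 1 / Suc n)"
        unfolding neg_slope_def by (rule Limsup_bounded)
      moreover have "ennreal (l - 1 / Suc n) < ennreal l"
        using l False by (intro ennreal_lessI) auto
      ultimately show False using l by simp
    qed
    then obtain u where u: "\<And>n. l - 1 / Suc n < ?g (u n)" "\<And>n. dist (u n) x < 1 / Suc n"
      by metis
    have inv: "(\<lambda>n. 1 / Suc n) \<longlonglongrightarrow> (0::real)"
      using LIMSEQ_inverse_real_of_nat by (simp add: inverse_eq_divide)
    have ulim: "u \<longlonglongrightarrow> x"
    proof (rule metric_LIMSEQ_I)
      fix e :: real assume "e > 0"
      then have "eventually (\<lambda>n. 1 / Suc n < e) sequentially"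
        using order_tendstoD(2)[OF inv] by simp
      then show "\<exists>N. \<forall>n\<ge>N. dist (u n) x < e"
        unfolding eventually_sequentially using u(2) less_trans by blast
    qed
    have "\<exists>y. minimizer t (u n) y" for n using minimizer_exists[OF assms(1)] by blast
    then obtain v where v: "\<And>n. minimizer t (u n) (v n)" by metis
    have slope: "l - 1 / Suc n \<le> k * \<alpha>' (dist x (v n) / t)" for n
    proof -
      have "k * (Q t x - Q t (u n)) \<le> k * (\<alpha>' (dist x (v n) / t) * dist x (u n))"
        using Q_diff_le[OF assms(1) v, of x] assms by simp
      then have "?g (u n) \<le> k * \<alpha>' (dist x (v n) / t)"
        using deriv_nonneg[of "dist x (v n) / t"] assms
        by (cases "x = u n") (auto simp: field_simps)
      then show ?thesis using u(1)[of n] by simp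
    qed
    have "v n \<in> cball x (1 + t * R)" for n
    proof -
      have "(1::real) / Suc n \<le> 1" by simp
      then have "dist (u n) x \<le> 1" using u(2)[of n] by linarith
      then show ?thesis using R(2)[OF v, of n] dist_triangle[of x "v n" "u n"]
        by (simp add: dist_commute)
    qed
    then obtain y s where s: "strict_mono s" "(v \<circ> s) \<longlonglongrightarrow> y"
      using proper[of x "1 + t * R"] unfolding compact_def by metis
    have us: "(u \<circ> s) \<longlonglongrightarrow> x" using LIMSEQ_subseq_LIMSEQ[OF ulim s(1)] .
    have "(\<lambda>n. Q t (u (s n))) \<longlonglongrightarrow> Q t x"
      using continuous_on_tendsto_compose[OF Q_continuous[OF assms(1)] us] by (simp add: o_def)
    then have min: "minimizer t x y"
      using us s assms(1) v[unfolded minimizer_def]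
      by (intro minimizerI[where u = "u \<circ> s" and v = "v \<circ> s"]) (auto simp: o_def)
    have "(\<lambda>n. dist x ((v \<circ> s) n) / t) \<longlonglongrightarrow> dist x y / t"
      using assms(1) by (intro tendsto_divide tendsto_dist tendsto_const s(2)) simp
    then have "(\<lambda>n. \<alpha>' (dist x ((v \<circ> s) n) / t)) \<longlonglongrightarrow> \<alpha>' (dist x y / t)"
      using assms(1) by (intro continuous_on_tendsto_compose[OF deriv_cont]) auto
    then have klim: "(\<lambda>n. k * \<alpha>' (dist x ((v \<circ> s) n) / t)) \<longlonglongrightarrow> k * \<alpha>' (dist x y / t)"
      by (intro tendsto_intros)
    have llim: "(\<lambda>n. l - 1 / Suc (s n)) \<longlonglongrightarrow> l - 0"
      using LIMSEQ_subseq_LIMSEQ[OF inv s(1)] by (intro tendsto_intros) (simp add: o_def)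
    have "l - 0 \<le> k * \<alpha>' (dist x y / t)"
      by (rule LIMSEQ_le[OF llim klim]) (use slope in auto)
    then show ?thesis using that min l by (auto intro: ennreal_leI)
  qed
qed

text \<open>The global Lipschitz bound matters only if \<open>\<alpha> h / h\<close> has a finite
  limit. Then all slopes of \<open>\<alpha>\<close>, hence of \<open>Q t\<close>, are at most that
  limit, and \<open>r = 1\<close> leaves only the alternative \<open>k \<le> 1\<close>.\<close>

lemma Q_in_F_class:
  assumes t: "t > 0" and k: "k > 0" "k \<le> 1 \<or> 1 < r"
  shows "(\<lambda>x. k * Q t x) \<in> F_class \<alpha>"
proof -
  have "bounded (range (\<lambda>x. k * Q t x))"
    unfolding bounded_iff using Q_bound[OF t] k
    by (intro exI[of _ "k * M"]) (auto simp: abs_mult)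
  moreover have "Lip_upto (\<lambda>x. k * Q t x) 1 < \<infinity>"
  proof -
    obtain L where L: "L \<ge> 0" "\<And>x x'. dist x x' \<le> 1 \<Longrightarrow> \<bar>Q t x - Q t x'\<bar> \<le> L * dist x x'"
      using Q_local_Lipschitz[OF t] by metis
    have "Lip_upto (\<lambda>x. k * Q t x) 1 \<le> ennreal (k * L)"
      unfolding Lip_upto_def
    proof (rule SUP_least, clarify)
      fix x y :: 'a assume d: "x \<noteq> y" "dist x y \<le> 1"
      have "\<bar>k * Q t y - k * Q t x\<bar> = k * \<bar>Q t y - Q t x\<bar>"
        using k by (simp add: abs_mult right_diff_distrib[symmetric])
      also have "\<dots> \<le> k * (L * dist x y)"
        using k L(2)[of y x] d by (intro mult_left_mono) (auto simp: dist_commute)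
      finally show "ennreal (\<bar>k * Q t y - k * Q t x\<bar> / dist x y) \<le> ennreal (k * L)"
        using d by (intro ennreal_leI) (simp add: field_simps)
    qed
    then show ?thesis by (simp add: le_less_trans)
  qed
  moreover have "Lip (\<lambda>x. k * Q t x) \<le> Lim at_top (\<lambda>h. ennreal (\<alpha> h / h))"
  proof (cases "(SUP h\<in>{0<..}. ennreal (\<alpha> h / h)) = \<top>")
    case True show ?thesis unfolding Lim_ratio True by simp
  next
    case False
    then obtain l where l: "(SUP h\<in>{0<..}. ennreal (\<alpha> h / h)) = ennreal l" "l \<ge> 0"
      by (cases "SUP h\<in>{0<..}. ennreal (\<alpha> h / h)") auto
    have "\<alpha> h / h \<le> l" if "h > 0" for h
      using SUP_upper[of h "{0<..}" "\<lambda>h. ennreal (\<alpha> h / h)"] l that by (simp add: ennreal_le_iff)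
    note fr = finite_ratio[OF this]
    have k1: "k \<le> 1" using fr(1) k by simp
    have Qd: "Q t x - Q t x' \<le> l * dist x x'" for x x'
    proof -
      obtain y where y: "minimizer t x' y" using minimizer_exists[OF t] by blast
      have "\<alpha>' (dist x y / t) * dist x x' \<le> l * dist x x'"
        using fr(2) t by (intro mult_right_mono) auto
      then show ?thesis using Q_diff_le[OF t y, of x] by linarith
    qed
    show ?thesis unfolding Lim_ratio l(1) Lip_def Lip_upto_def
    proof (intro SUP_least, clarify)
      fix x y :: 'a assume d: "x \<noteq> y"
      have "\<bar>k * Q t y - k * Q t x\<bar> = k * \<bar>Q t y - Q t x\<bar>"
        using k by (simp add: abs_mult right_diff_distrib[symmetric])
      also have "\<dots> \<le> 1 * (l * dist x y)"
        using k1 k(1) Qd[of x y] Qd[of y x]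
        by (intro mult_mono) (auto simp: dist_commute abs_le_iff)
      finally show "ennreal (\<bar>k * Q t y - k * Q t x\<bar> / dist x y) \<le> ennreal l"
        using d by (intro ennreal_leI) (simp add: field_simps)
    qed
  qed
  ultimately show ?thesis unfolding F_class_def by (auto intro!: exI[of _ 1])
qed

end

subsection \<open>Exponential integrals\<close>

text \<open>A continuation argument for
  \<open>\<phi> s \<le> \<phi> a + \<epsilon> * (s - a)\<close>. The condition \<open>right\<close>
  says that the upper right Dini derivative is nowhere positive; it is phrased with sequences so
  that Fatou's lemma can be used to verify it. The condition \<open>left\<close> excludes an upward
  jump at the end of the interval reached so far.\<close>

lemma right_Dini_antimono:
  fixes \<phi> :: "real \<Rightarrow> real"
  assumes "a \<le> b"
    and right: "\<And>t \<epsilon> S. a \<le> t \<Longrightarrow> t < b \<Longrightarrow> \<epsilon> > 0 \<Longrightarrow> S \<longlonglongrightarrow> t \<Longrightarrow> (\<And>n. t < S n)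
       \<Longrightarrow> (\<And>n::nat. \<phi> t + \<epsilon> * (S n - t) < \<phi> (S n)) \<Longrightarrow> False"
    and left: "\<And>t e. a < t \<Longrightarrow> t \<le> b \<Longrightarrow> e > 0 \<Longrightarrow> \<exists>d>0. \<forall>s. t - d < s \<longrightarrow> a \<le> s \<longrightarrow> s < t \<longrightarrow> \<phi> t \<le> \<phi> s + e"
  shows "\<phi> b \<le> \<phi> a"
proof -
  have *: "\<phi> b \<le> \<phi> a + \<epsilon> * (b - a)" if \<epsilon>: "\<epsilon> > 0" for \<epsilon>
  proof -
    define T where "T = {t \<in> {a..b}. \<forall>s\<in>{a..t}. \<phi> s \<le> \<phi> a + \<epsilon> * (s - a)}"
    define c where "c = Sup T"
    have aT: "a \<in> T" using assms(1) by (auto simp: T_def)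
    have bdd: "bdd_above T" by (auto simp: T_def intro!: bdd_aboveI[where M = b])
    have "x \<le> b" if "x \<in> T" for x using that by (simp add: T_def)
    then have cab: "a \<le> c" "c \<le> b"
      using cSup_upper[OF aT bdd] aT unfolding c_def by (auto intro: cSup_least)
    have below: "\<phi> s \<le> \<phi> a + \<epsilon> * (s - a)" if s: "a \<le> s" "s < c" for s
    proof -
      obtain t where "t \<in> T" "s < t" using less_cSup_iff[OF _ bdd, of s] aT s unfolding c_def by blast
      then show ?thesis using s by (auto simp: T_def)
    qed
    have at: "\<phi> c \<le> \<phi> a + \<epsilon> * (c - a)"
    proof (cases "a = c")
      case False
      show ?thesis
      proof (rule field_le_epsilon)
        fix e :: real assume "e > 0"
        then obtain d where d: "d > 0" "\<And>s. c - d < s \<Longrightarrow> a \<le> s \<Longrightarrow> s < c \<Longrightarrow> \<phi> c \<le> \<phi> s + e"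
          using left[of c e] cab False by (meson order.not_eq_order_implies_strict)
        define s where "s = max a (c - d / 2)"
        have s: "a \<le> s" "s < c" "c - d < s" using d cab False by (auto simp: s_def)
        have "\<epsilon> * (s - a) \<le> \<epsilon> * (c - a)" using s \<epsilon> by simp
        then show "\<phi> c \<le> \<phi> a + \<epsilon> * (c - a) + e"
          using d(2)[of s] below[of s] s by linarith
      qed
    qed simp
    have "c = b"
    proof (rule ccontr)
      assume "c \<noteq> b"
      then have cb: "c < b" using cab by simp
      have "\<exists>s. c < s \<and> s < c + 1 / Suc n \<and> \<phi> c + \<epsilon> * (s - c) < \<phi> s" for n
      proof (rule ccontr)
        assume "\<not> (\<exists>s. c < s \<and> s < c + 1 / Suc n \<and> \<phi> c + \<epsilon> * (s - c) < \<phi> s)"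
        then have no: "\<phi> s \<le> \<phi> c + \<epsilon> * (s - c)" if "c < s" "s < c + 1 / Suc n" for s
          using that by (meson not_le)
        define e :: real where "e = 1 / Suc n"
        define u where "u = min b (c + e / 2)"
        have "e > 0" by (simp add: e_def)
        then have u: "c < u" "u \<le> b" "u < c + 1 / Suc n"
          using cb unfolding u_def e_def[symmetric] by auto
        have "\<phi> s \<le> \<phi> a + \<epsilon> * (s - a)" if "s \<in> {a..u}" for s
        proof (cases "s \<le> c")
          case True then show ?thesis using below[of s] at that by (cases "s = c") auto
        next
          case False
          then have "\<phi> s \<le> \<phi> c + \<epsilon> * (s - c)" using no[of s] that u by simp
          then show ?thesis using at by (simp add: algebra_simps)
        qed
        then have "u \<in> T" using u cab by (auto simp: T_def)
        then show False using cSup_upper[OF _ bdd, of u] u by (auto simp: c_def)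
      qed
      then obtain S where S: "\<And>n. c < S n" "\<And>n. S n < c + 1 / Suc n" "\<And>n. \<phi> c + \<epsilon> * (S n - c) < \<phi> (S n)"
        by metis
      have "S \<longlonglongrightarrow> c"
      proof (rule tendsto_sandwich[where f = "\<lambda>_. c" and h = "\<lambda>n. c + 1 / Suc n"])
        show "(\<lambda>n. c + 1 / Suc n) \<longlonglongrightarrow> c"
          using tendsto_add[OF tendsto_const LIMSEQ_inverse_real_of_nat, of c]
          by (simp add: inverse_eq_divide)
        show "eventually (\<lambda>n. c \<le> S n) sequentially" "eventually (\<lambda>n. S n \<le> c + 1 / Suc n) sequentially"
          by (rule always_eventually, rule allI, rule less_imp_le, rule S)+
      qed simp
      then show False using right[of c \<epsilon> S] S cab cb \<epsilon> by blast
    qed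
    then show ?thesis using at by simp
  qed
  show ?thesis
  proof (rule field_le_epsilon)
    fix e :: real assume e: "e > 0"
    \<comment> \<open>The summand 1 keeps the chosen slope positive when
      \<open>a = b\<close>.\<close>
    have "e / (b - a + 1) * (b - a) \<le> e" using e assms(1) by (simp add: field_simps)
    then show "\<phi> b \<le> \<phi> a + e" using *[of "e / (b - a + 1)"] e assms(1) by simp
  qed
qed

section \<open>Exponential moments and entropy of bounded functions\<close>

lemma exp_diff_bound: "\<bar>exp a - exp b\<bar> \<le> \<bar>a - b\<bar> * exp (max a b)" for a b :: real
proof -
  have "exp x - exp y \<le> (x - y) * exp x" for x y :: real
  proof -
    have "exp x * (1 + (y - x)) \<le> exp x * exp (y - x)" by (intro mult_left_mono exp_ge_add_one_self) auto
    then show ?thesis by (simp add: exp_diff algebra_simps)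
  qed
  from this[of a b] this[of b a] show ?thesis by (auto simp: abs_if max_def)
qed

context prob_space begin

lemma integrable_bounded:
  fixes g :: "'a \<Rightarrow> real"
  assumes "g \<in> borel_measurable M" "\<And>x. \<bar>g x\<bar> \<le> B"
  shows "integrable M g"
  using assms by (intro integrable_const_bound[where B = B]) auto

lemma exp_integral_deriv:
  fixes g :: "'a \<Rightarrow> real"
  assumes [measurable]: "g \<in> borel_measurable M" and B: "\<And>x. \<bar>g x\<bar> \<le> B"
  shows "((\<lambda>k. \<integral>x. exp (k * g x) \<partial>M) has_real_derivative (\<integral>x. g x * exp (k * g x) \<partial>M)) (at k)"
proof -
  have B0: "B \<ge> 0" using B[of undefined] by linarith
  have int: "integrable M (\<lambda>x. exp (c * g x))" for c
  proof (rule integrable_bounded[where B = "exp (\<bar>c\<bar> * B)"])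
    fix x have "\<bar>c * g x\<bar> \<le> \<bar>c\<bar> * B" using B[of x] by (auto simp: abs_mult intro: mult_left_mono)
    then show "\<bar>exp (c * g x)\<bar> \<le> exp (\<bar>c\<bar> * B)" by simp
  qed simp
  show ?thesis unfolding has_field_derivative_iff tendsto_at_iff_sequentially comp_def
  proof (intro allI impI)
    fix u :: "nat \<Rightarrow> real" assume u: "\<forall>i. u i \<in> UNIV - {k}" "u \<longlonglongrightarrow> k"
    obtain K where K: "\<And>n. \<bar>u n\<bar> \<le> K" using convergent_imp_Bseq[of u] u(2)
      by (auto simp: Bseq_def convergent_def)
    define E where "E = exp ((K + \<bar>k\<bar>) * B)"
    have "(\<lambda>n. \<integral>x. (exp (u n * g x) - exp (k * g x)) / (u n - k) \<partial>M) \<longlonglongrightarrow> (\<integral>x. g x * exp (k * g x) \<partial>M)"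
    proof (rule integral_dominated_convergence[where w = "\<lambda>_. B * E"])
      show "AE x in M. (\<lambda>n. (exp (u n * g x) - exp (k * g x)) / (u n - k)) \<longlonglongrightarrow> g x * exp (k * g x)"
      proof (rule AE_I2)
        fix x
        have "((\<lambda>c. exp (c * g x)) has_real_derivative g x * exp (k * g x)) (at k)"
          by (auto intro!: derivative_eq_intros)
        then show "(\<lambda>n. (exp (u n * g x) - exp (k * g x)) / (u n - k)) \<longlonglongrightarrow> g x * exp (k * g x)"
          using u unfolding has_field_derivative_iff tendsto_at_iff_sequentially comp_def by blast
      qed
      show "AE x in M. norm ((exp (u n * g x) - exp (k * g x)) / (u n - k)) \<le> B * E" for n
      proof (rule AE_I2)
        fix x
        have "K \<ge> 0" using K[of 0] by linarith
        have 1: "\<bar>c * g x\<bar> \<le> (K + \<bar>k\<bar>) * B" if "\<bar>c\<bar> \<le> K + \<bar>k\<bar>" for c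
          using that B[of x] \<open>K \<ge> 0\<close> by (auto simp: abs_mult intro!: mult_mono)
        have "max (u n * g x) (k * g x) \<le> (K + \<bar>k\<bar>) * B"
          using abs_le_D1[OF 1[of "u n"]] abs_le_D1[OF 1[of k]] K[of n] \<open>K \<ge> 0\<close> by simp
        then have "exp (max (u n * g x) (k * g x)) \<le> E" by (simp add: E_def)
        moreover have "\<bar>u n * g x - k * g x\<bar> \<le> \<bar>u n - k\<bar> * B"
          using B[of x] by (simp add: left_diff_distrib[symmetric] abs_mult mult_left_mono)
        ultimately have "\<bar>exp (u n * g x) - exp (k * g x)\<bar> \<le> (\<bar>u n - k\<bar> * B) * E"
          using B0 by (intro order_trans[OF exp_diff_bound] mult_mono) auto
        then show "norm ((exp (u n * g x) - exp (k * g x)) / (u n - k)) \<le> B * E"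
          using u(1) by (simp add: abs_divide field_simps)
      qed
    qed auto
    moreover have "(\<integral>x. (exp (u n * g x) - exp (k * g x)) / (u n - k) \<partial>M)
       = ((\<integral>x. exp (u n * g x) \<partial>M) - (\<integral>x. exp (k * g x) \<partial>M)) / (u n - k)" for n
      using int by simp
    ultimately have "(\<lambda>n. ((\<integral>x. exp (u n * g x) \<partial>M) - (\<integral>x. exp (k * g x) \<partial>M)) / (u n - k))
      \<longlonglongrightarrow> (\<integral>x. g x * exp (k * g x) \<partial>M)" by (simp only:)
    then show "(\<lambda>n. ((\<integral>x. exp (u n * g x) \<partial>M) - (\<integral>x. exp (k * g x) \<partial>M)) / (u n - k))
      \<longlonglongrightarrow> (\<integral>x. g x * exp (k * g x) \<partial>M)" .
  qed
qed

lemma exp_integrable: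
  fixes g :: "'a \<Rightarrow> real"
  assumes [measurable]: "g \<in> borel_measurable M" and B: "\<And>x. \<bar>g x\<bar> \<le> B"
  shows "integrable M (\<lambda>x. exp (c * g x))" "integrable M (\<lambda>x. g x * exp (c * g x))"
proof -
  have "\<bar>c * g x\<bar> \<le> \<bar>c\<bar> * B" for x using B[of x] by (auto simp: abs_mult intro: mult_left_mono)
  then have e: "exp (c * g x) \<le> exp (\<bar>c\<bar> * B)" for x by (simp add: abs_le_iff)
  have "B \<ge> 0" using B[of undefined] by linarith
  then have "\<bar>g x * exp (c * g x)\<bar> \<le> B * exp (\<bar>c\<bar> * B)" for x
    unfolding abs_mult using e[of x] B[of x] by (intro mult_mono) auto
  then show "integrable M (\<lambda>x. g x * exp (c * g x))" by (intro integrable_bounded) auto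
  show "integrable M (\<lambda>x. exp (c * g x))" using e by (intro integrable_bounded) auto
qed

lemma exp_integral_bounds:
  fixes g :: "'a \<Rightarrow> real"
  assumes [measurable]: "g \<in> borel_measurable M" and B: "\<And>x. \<bar>g x\<bar> \<le> B" and c: "c \<ge> 0"
  shows "exp (- c * B) \<le> (\<integral>x. exp (c * g x) \<partial>M)" "(\<integral>x. exp (c * g x) \<partial>M) \<le> exp (c * B)"
    "(\<integral>x. exp (c * g x) \<partial>M) > 0"
proof -
  have b: "- c * B \<le> c * g x" "c * g x \<le> c * B" for x
    using B[of x] c mult_left_mono[of "- B" "g x" c] mult_left_mono[of "g x" B c] by (auto simp: abs_le_iff)
  have "(\<integral>x. exp (- c * B) \<partial>M) \<le> (\<integral>x. exp (c * g x) \<partial>M)"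
    using b exp_integrable[OF assms(1,2)] by (intro integral_mono) auto
  then show 1: "exp (- c * B) \<le> (\<integral>x. exp (c * g x) \<partial>M)" by (simp add: prob_space)
  have "(\<integral>x. exp (c * g x) \<partial>M) \<le> (\<integral>x. exp (c * B) \<partial>M)"
    using b exp_integrable[OF assms(1,2)] by (intro integral_mono) auto
  then show "(\<integral>x. exp (c * g x) \<partial>M) \<le> exp (c * B)" by (simp add: prob_space)
  show "(\<integral>x. exp (c * g x) \<partial>M) > 0" using 1 by (rule less_le_trans[rotated]) simp
qed

text \<open>With \<open>Z\<close> viewed as a function of \<open>c\<close>, the derivative of
  \<open>ln Z / c\<close> is the entropy divided by \<open>c\<^sup>2 * Z\<close>. Nonnegativity
  follows by integrating \<open>y * ln (y / Z) \<ge> y - Z\<close>, whose right-hand side has mean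
  0.\<close>

lemma Ent_exp:
  fixes g :: "'a \<Rightarrow> real"
  assumes [measurable]: "g \<in> borel_measurable M" and B: "\<And>x. \<bar>g x\<bar> \<le> B" and c: "c \<ge> 0"
  defines "Z \<equiv> \<integral>x. exp (c * g x) \<partial>M"
  shows "Ent M (\<lambda>x. exp (c * g x)) = c * (\<integral>x. g x * exp (c * g x) \<partial>M) - Z * ln Z"
    and "Ent M (\<lambda>x. exp (c * g x)) \<ge> 0"
proof -
  note int = exp_integrable[OF assms(1,2), of c]
  have Z: "Z > 0" using exp_integral_bounds[OF assms(1-3)] by (simp add: Z_def)
  have eq: "exp (c * g x) * ln (exp (c * g x) / Z) = c * (g x * exp (c * g x)) - ln Z * exp (c * g x)" for x
    using Z by (simp add: ln_div algebra_simps)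
  have E: "Ent M (\<lambda>x. exp (c * g x)) = (\<integral>x. c * (g x * exp (c * g x)) - ln Z * exp (c * g x) \<partial>M)"
    unfolding Ent_def Z_def[symmetric] eq ..
  then show "Ent M (\<lambda>x. exp (c * g x)) = c * (\<integral>x. g x * exp (c * g x) \<partial>M) - Z * ln Z"
    using int by (simp add: Z_def)
  have "0 = (\<integral>x. exp (c * g x) - Z \<partial>M)" using int by (simp add: prob_space Z_def)
  also have "\<dots> \<le> (\<integral>x. c * (g x * exp (c * g x)) - ln Z * exp (c * g x) \<partial>M)"
  proof (rule integral_mono)
    fix x
    define y where "y = exp (c * g x)"
    have y: "y > 0" by (simp add: y_def)
    have "ln (Z / y) \<le> Z / y - 1" using Z y by (intro ln_le_minus_one) simp
    then have "y * ln (Z / y) \<le> y * (Z / y - 1)" using y by (intro mult_left_mono) auto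
    then have "y - Z \<le> y * ln (y / Z)" using y Z by (simp add: ln_div algebra_simps)
    then show "exp (c * g x) - Z \<le> c * (g x * exp (c * g x)) - ln Z * exp (c * g x)"
      unfolding y_def eq .
  qed (use int in auto)
  finally show "Ent M (\<lambda>x. exp (c * g x)) \<ge> 0" unfolding E .
qed

end

subsection \<open>Monotonicity along the semigroup\<close>

locale hopf_lax_LSI = hopf_lax \<alpha> \<alpha>' r p f M for \<alpha> \<alpha>' r p and f :: "'a::metric_space \<Rightarrow> real" and M +
  fixes \<mu> :: "'a measure" and C :: real
  assumes prob: "prob_space \<mu>" and sets_\<mu>: "sets \<mu> = sets borel"
    and C_pos: "C > 0" and LSI: "LSI_minus \<alpha> C \<mu>"
begin

interpretation prob_space \<mu> by (rule prob)

definition "t0 = (p - 1) * C"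

definition k :: "real \<Rightarrow> real \<Rightarrow> real" where "k m s = (s / t0) powr (m - 1)"

text \<open>The exponent \<open>m\<close> is \<open>p\<close> up to time \<open>t0\<close>, where \<open>k\<close> reaches \<open>1\<close>, and \<open>r\<close> afterwards.\<close>

definition admissible :: "real \<Rightarrow> real \<Rightarrow> bool" where
  "admissible m s \<longleftrightarrow> (m = p \<and> s \<le> t0) \<or> (m = r \<and> t0 \<le> s)"

definition \<phi> :: "real \<Rightarrow> real \<Rightarrow> real" where
  "\<phi> m s = ln (\<integral>x. exp (k m s * Q s x) \<partial>\<mu>) / k m s"

lemma t0_pos: "t0 > 0" using p_gt_1 C_pos by (simp add: t0_def)

lemma k_pos: "s > 0 \<Longrightarrow> k m s > 0" using t0_pos by (simp add: k_def)

lemma k_deriv: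
  assumes "s > 0" shows "(k m has_real_derivative (m - 1) * k m s / s) (at s)"
proof -
  have "(k m has_real_derivative (m - 1) * (s / t0) powr (m - 1 - 1) * (1 / t0)) (at s)"
    unfolding k_def using assms t0_pos
    by (intro DERIV_chain2[where g = "\<lambda>s. s / t0", OF has_real_derivative_powr])
      (auto intro!: derivative_eq_intros)
  moreover have "(m - 1) * (s / t0) powr (m - 1 - 1) * (1 / t0) = (m - 1) * k m s / s"
    unfolding k_def using assms t0_pos by (subst powr_diff) simp
  ultimately show ?thesis by (simp only:)
qed

lemma Q_measurable [measurable]: "t > 0 \<Longrightarrow> Q t \<in> borel_measurable \<mu>"
  using Q_borel measurable_cong_sets[OF sets_\<mu> refl] by blast

text \<open>The minimizer that controls the slope depends on \<open>x\<close> in no measurable way.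
  The integrand is therefore dominated by a measurable \<open>W\<close> lying above the dissipation
  of every minimizer. The factor \<open>t / t0\<close> arises from
  \<open>l powr m = l * k m t\<close>.\<close>

lemma Ent_le_dissipation:
  assumes t: "t > 0" and m: "admissible m t"
    and W: "W \<in> borel_measurable \<mu>"
    and lower: "\<And>x y. minimizer t x y \<Longrightarrow>
      ennreal (k m t * (dist x y / t * \<alpha>' (dist x y / t) - \<alpha> (dist x y / t)) * exp (k m t * Q t x)) \<le> W x"
    and U: "(\<integral>\<^sup>+x. W x \<partial>\<mu>) \<le> ennreal U" "U \<ge> 0"
  shows "Ent \<mu> (\<lambda>x. exp (k m t * Q t x)) \<le> C * (t / t0) * U"
proof -
  define l where "l = t / t0"
  have l: "l > 0" using t t0_pos by (simp add: l_def)
  have ml: "(m = p \<and> l \<le> 1) \<or> (m = r \<and> 1 \<le> l)"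
    using m t0_pos by (auto simp: admissible_def l_def)
  have kl: "k m t = l powr (m - 1)" by (simp add: k_def l_def)
  have lm: "l powr m = l * k m t" using l by (simp add: kl powr_diff)
  \<comment> \<open>Up to \<open>t0\<close> the coefficient is at most 1, and for
    \<open>r = 1\<close> it stays equal to 1 afterwards.\<close>
  have "k m t \<le> 1 \<or> 1 < r"
    using ml l r_ge_1 p_gt_1 by (cases "r = 1") (auto simp: kl powr_le1)
  then have F: "(\<lambda>x. k m t * Q t x) \<in> F_class \<alpha>" using Q_in_F_class[OF t k_pos[OF t]] by blast
  have "(\<integral>\<^sup>+x. e2ennreal (conj_fun \<alpha> (enn2ereal (neg_slope (\<lambda>x. k m t * Q t x) x)))
             * ennreal (exp (k m t * Q t x)) \<partial>\<mu>) \<le> (\<integral>\<^sup>+x. ennreal l * W x \<partial>\<mu>)"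
  proof (rule nn_integral_mono)
    fix x
    obtain y where y: "minimizer t x y"
      "neg_slope (\<lambda>x. k m t * Q t x) x \<le> ennreal (k m t * \<alpha>' (dist x y / t))"
      using neg_slope_Q_le[OF t k_pos[OF t]] by blast
    define h where "h = dist x y / t"
    have h: "h \<ge> 0" using t by (simp add: h_def)
    have "e2ennreal (conj_fun \<alpha> (enn2ereal (neg_slope (\<lambda>x. k m t * Q t x) x)))
        * ennreal (exp (k m t * Q t x)) \<le> ennreal (l powr m * (h * \<alpha>' h - \<alpha> h)) * ennreal (exp (k m t * Q t x))"
      using y(2) unfolding h_def[symmetric] kl
      by (intro mult_right_mono conj_fun_scale[OF l ml h]) auto
    also have "\<dots> = ennreal (l powr m * (h * \<alpha>' h - \<alpha> h) * exp (k m t * Q t x))"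
      using young_nonneg[OF h] l by (intro ennreal_mult[symmetric]) auto
    also have "l powr m * (h * \<alpha>' h - \<alpha> h) * exp (k m t * Q t x)
        = l * (k m t * (h * \<alpha>' h - \<alpha> h) * exp (k m t * Q t x))" unfolding lm by simp
    also have "ennreal \<dots> = ennreal l * ennreal (k m t * (h * \<alpha>' h - \<alpha> h) * exp (k m t * Q t x))"
      using young_nonneg[OF h] l k_pos[OF t, of m] by (intro ennreal_mult) auto
    also have "\<dots> \<le> ennreal l * W x"
      using lower[OF y(1)] unfolding h_def by (intro mult_left_mono) auto
    finally show "e2ennreal (conj_fun \<alpha> (enn2ereal (neg_slope (\<lambda>x. k m t * Q t x) x)))
        * ennreal (exp (k m t * Q t x)) \<le> ennreal l * W x" .
  qed
  also have "\<dots> = ennreal l * (\<integral>\<^sup>+x. W x \<partial>\<mu>)" using W by (rule nn_integral_cmult)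
  also have "\<dots> \<le> ennreal l * ennreal U" using U by (intro mult_left_mono) auto
  also have "\<dots> = ennreal (l * U)" using l U by (intro ennreal_mult[symmetric]) auto
  finally have "enn2ereal (\<integral>\<^sup>+x. e2ennreal (conj_fun \<alpha> (enn2ereal (neg_slope (\<lambda>x. k m t * Q t x) x)))
             * ennreal (exp (k m t * Q t x)) \<partial>\<mu>) \<le> ereal (l * U)" (is "?I \<le> _")
    using l U by (simp add: enn2ereal_ennreal[symmetric] less_eq_ennreal.rep_eq del: enn2ereal_ennreal)
  have "ereal (Ent \<mu> (\<lambda>x. exp (k m t * Q t x))) \<le> ereal C * ?I"
    by (rule bspec[OF LSI[unfolded LSI_minus_def] F])
  also have "\<dots> \<le> ereal C * ereal (l * U)"
    using \<open>?I \<le> _\<close> C_pos by (intro ereal_mult_left_mono) auto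
  finally show ?thesis by (simp add: l_def mult.assoc)
qed

text \<open>Growth of \<open>\<phi>\<close> beyond slope \<open>\<epsilon>\<close> limits how much
  \<open>Q\<close> can decay. Fatou's lemma turns this limit into a bound on the dissipation, and
  the Sobolev inequality then makes the entropy \<open>E\<close> smaller than itself.\<close>

lemma \<phi>_right:
  assumes t: "t > 0" and m: "admissible m t" "m \<ge> 1" "m \<le> p" and \<epsilon>: "\<epsilon> > 0"
    and S: "S \<longlonglongrightarrow> t" "\<And>n::nat. t < S n"
    and growth: "\<And>n. \<phi> m t + \<epsilon> * (S n - t) < \<phi> m (S n)"
  shows False
proof -
  define kk where "kk = k m t"
  define k' where "k' = (m - 1) * kk / t"
  have Spos: "S n > 0" for n using S(2)[of n] t by simp
  have kk: "kk > 0" using k_pos t by (simp add: kk_def)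
  have kS: "k m (S n) > 0" for n using k_pos Spos by simp
  note Qb = Q_bound[OF t] and meas [measurable] = Q_measurable[OF t] Q_measurable[OF Spos]
  have kd: "(k m has_real_derivative k') (at t)" using k_deriv[OF t] by (simp add: k'_def kk_def)
  have klim: "(\<lambda>n. k m (S n)) \<longlonglongrightarrow> kk"
    using isCont_tendsto_compose[OF DERIV_isCont[OF kd] S(1)] by (simp add: kk_def)
  define Z where "Z = (\<lambda>c. \<integral>x. exp (c * Q t x) \<partial>\<mu>)"
  have Zd: "(Z has_real_derivative (\<integral>x. Q t x * exp (c * Q t x) \<partial>\<mu>)) (at c)" for c
    unfolding Z_def by (rule exp_integral_deriv[OF Q_measurable[OF t] Qb])
  have Zpos: "Z c > 0" if "c > 0" for c
    using exp_integral_bounds(3)[OF Q_measurable[OF t] Qb] that by (simp add: Z_def)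
  define E where "E = Ent \<mu> (\<lambda>x. exp (kk * Q t x))"
  have E: "E = kk * (\<integral>x. Q t x * exp (kk * Q t x) \<partial>\<mu>) - Z kk * ln (Z kk)" "E \<ge> 0"
    using Ent_exp[OF Q_measurable[OF t] Qb, of kk] kk by (auto simp: E_def Z_def)
  \<comment> \<open>The potential is frozen at time \<open>t\<close> and only the coefficient moves.
    This part of \<open>\<phi>\<close> is differentiable, and its derivative is given by the
    entropy.\<close>
  define \<Lambda> where "\<Lambda> = (\<lambda>s. ln (Z (k m s)) / k m s)"
  have "(\<Lambda> has_real_derivative
     ((1 / Z kk * ((\<integral>x. Q t x * exp (kk * Q t x) \<partial>\<mu>) * k')) * kk - ln (Z kk) * k') / (kk * kk)) (at t)"
    unfolding \<Lambda>_def kk_def using kk Zpos[OF kk]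
    by (intro DERIV_divide DERIV_ln_divide[THEN DERIV_chain2] DERIV_chain2[OF Zd] kd) (auto simp: kk_def)
  moreover have "((1 / Z kk * ((\<integral>x. Q t x * exp (kk * Q t x) \<partial>\<mu>) * k')) * kk - ln (Z kk) * k') / (kk * kk)
      = k' * E / (kk * kk * Z kk)"
    using kk Zpos[OF kk] by (simp add: E(1) field_simps)
  ultimately have \<Lambda>d: "(\<Lambda> has_real_derivative k' * E / (kk * kk * Z kk)) (at t)" by simp
  define D where "D n = (\<Lambda> (S n) - \<Lambda> t) / (S n - t)" for n
  have seq: "(\<lambda>n. (F (S n) - F t) / (S n - t)) \<longlonglongrightarrow> d" if "(F has_real_derivative d) (at t)" for F d
    using that S unfolding has_field_derivative_iff tendsto_at_iff_sequentially comp_def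
    by (metis Diff_iff UNIV_I less_irrefl singletonD)
  have Dlim: "D \<longlonglongrightarrow> k' * E / (kk * kk * Z kk)" unfolding D_def by (rule seq[OF \<Lambda>d])
  define U where "U n = k m (S n) * Z (k m (S n)) * (D n - \<epsilon>)" for n
  define UU where "UU = kk * Z kk * (k' * E / (kk * kk * Z kk) - \<epsilon>)"
  have Ulim: "U \<longlonglongrightarrow> UU"
    unfolding U_def UU_def
    by (intro tendsto_intros klim Dlim isCont_tendsto_compose[OF DERIV_isCont[OF Zd]])
  \<comment> \<open>The loss due to the decay of \<open>Q\<close> alone, at the common coefficient
    \<open>k m (S n)\<close>. Monotonicity in time makes it nonnegative, as Fatou's lemma
    requires.\<close>
  define G where "G n x = (exp (k m (S n) * Q t x) - exp (k m (S n) * Q (S n) x)) / (S n - t)" for n x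
  have G_meas [measurable]: "G n \<in> borel_measurable \<mu>" for n
    unfolding G_def using Spos t by measurable
  have G_nonneg: "G n x \<ge> 0" for n x
  proof -
    have "Q (S n) x \<le> Q t x" using Q_antimono[OF t, of "S n" x] S(2)[of n] by simp
    then show ?thesis using kS[of n] S(2)[of n] by (simp add: G_def)
  qed
  have int: "integrable \<mu> (\<lambda>x. exp (c * Q t x))" "integrable \<mu> (\<lambda>x. exp (c * Q (S n) x))" for c n
    using exp_integrable(1)[OF Q_measurable Q_bound] t Spos by auto
  have G_int: "(\<integral>x. G n x \<partial>\<mu>) = (Z (k m (S n)) - (\<integral>x. exp (k m (S n) * Q (S n) x) \<partial>\<mu>)) / (S n - t)" for n
    unfolding G_def Z_def using int by simp
  have G_integrable: "integrable \<mu> (G n)" for n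
    unfolding G_def using int by simp
  have GU: "(\<integral>x. G n x \<partial>\<mu>) \<le> U n" for n
  proof -
    define c where "c = k m (S n)"
    define Y where "Y = (\<integral>x. exp (c * Q (S n) x) \<partial>\<mu>)"
    have c: "c > 0" using kS by (simp add: c_def)
    have Y: "Y > 0" unfolding Y_def
      by (rule exp_integral_bounds(3)[OF Q_measurable[OF Spos] Q_bound[OF Spos]]) (use c in simp)
    \<comment> \<open>Concavity of the logarithm converts the gap between \<open>\<phi>\<close> and
      \<open>\<Lambda>\<close> into an upper bound for the loss \<open>Z c - Y\<close>.\<close>
    have "ln (Y / Z c) \<le> Y / Z c - 1" using Y Zpos[OF c] by (intro ln_le_minus_one) simp
    then have 1: "ln Y - ln (Z c) \<le> (Y - Z c) / Z c" using Y Zpos[OF c] by (simp add: ln_div diff_divide_distrib)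
    have "ln Y / c > \<Lambda> t + \<epsilon> * (S n - t)"
      using growth[of n] by (simp add: \<phi>_def \<Lambda>_def Z_def c_def Y_def)
    moreover have "(D n - \<epsilon>) * (S n - t) = \<Lambda> (S n) - \<Lambda> t - \<epsilon> * (S n - t)"
      using S(2)[of n] by (subst left_diff_distrib) (simp add: D_def)
    moreover have "\<Lambda> (S n) = ln (Z c) / c" by (simp add: \<Lambda>_def c_def)
    ultimately have "(ln Y - ln (Z c)) / c > - (D n - \<epsilon>) * (S n - t)"
      unfolding diff_divide_distrib mult_minus_left by linarith
    moreover have "(ln Y - ln (Z c)) / c \<le> (Y - Z c) / Z c / c"
      using 1 c by (intro divide_right_mono) auto
    ultimately have "- (D n - \<epsilon>) * (S n - t) < (Y - Z c) / Z c / c" by linarith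
    then have "- (D n - \<epsilon>) * (S n - t) * (c * Z c) < Y - Z c"
      using c Zpos[OF c] by (simp add: field_simps)
    then have "Z c - Y < c * Z c * (D n - \<epsilon>) * (S n - t)" by (simp add: algebra_simps)
    then have "(Z c - Y) / (S n - t) < c * Z c * (D n - \<epsilon>)"
      using S(2)[of n] by (subst pos_divide_less_eq) auto
    then show ?thesis by (simp add: G_int U_def c_def Y_def)
  qed
  have U_nonneg: "U n \<ge> 0" for n
    by (rule order_trans[OF _ GU]) (simp add: G_nonneg)
  have UU: "UU \<ge> 0" using Ulim U_nonneg by (intro LIMSEQ_le_const[OF Ulim]) auto
  define W where "W x = liminf (\<lambda>n. ennreal (G n x))" for x
  have W_meas: "W \<in> borel_measurable \<mu>" unfolding W_def by measurable
  have "(\<integral>\<^sup>+x. W x \<partial>\<mu>) \<le> liminf (\<lambda>n. \<integral>\<^sup>+x. ennreal (G n x) \<partial>\<mu>)"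
    unfolding W_def by (rule nn_integral_liminf) measurable
  also have "\<dots> \<le> liminf (\<lambda>n. ennreal (U n))"
    using GU G_nonneg
    by (intro Liminf_mono always_eventually allI)
      (subst nn_integral_eq_integral[OF G_integrable], auto intro: ennreal_leI)
  also have "\<dots> = ennreal UU"
    using Ulim by (intro lim_imp_Liminf tendsto_ennrealI) auto
  finally have W_int: "(\<integral>\<^sup>+x. W x \<partial>\<mu>) \<le> ennreal UU" .
  have "E \<le> C * (t / t0) * UU" unfolding E_def kk_def
  proof (rule Ent_le_dissipation[OF t m(1) W_meas _ W_int UU])
    fix x y assume y: "minimizer t x y"
    define h where "h = dist x y / t"
    \<comment> \<open>The value of the fixed competitor \<open>y\<close> lies above
      \<open>Q s x\<close> and touches it at \<open>s = t\<close>, so its differentiable decay is a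
      lower bound for the decay of \<open>Q\<close>.\<close>
    define w where "w s = f y + s * \<alpha> (dist x y / s)" for s
    have wd: "(w has_real_derivative - (h * \<alpha>' h - \<alpha> h)) (at t)"
      unfolding w_def h_def
      using DERIV_add[OF DERIV_const perspective_deriv[OF t, of "dist x y"], of "f y"] by simp
    have wt: "w t = Q t x" using y by (simp add: minimizer_def w_def)
    \<comment> \<open>Both exponentials carry the moving coefficient, so its derivative cancels at
      \<open>t\<close> and only the decay of \<open>w\<close> remains.\<close>
    define F where "F s = exp (k m s * w t) - exp (k m s * w s)" for s
    have "(F has_real_derivative exp (kk * w t) * (k' * w t)
        - exp (kk * w t) * (k' * w t + - (h * \<alpha>' h - \<alpha> h) * kk)) (at t)"
      unfolding F_def kk_def
      by (intro DERIV_diff DERIV_chain2[where f = exp, OF DERIV_exp] DERIV_mult kd wd DERIV_cmult_right)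
    then have Fd: "(F has_real_derivative kk * (h * \<alpha>' h - \<alpha> h) * exp (kk * w t)) (at t)"
      by (simp add: algebra_simps)
    have "(\<lambda>n. ennreal ((F (S n) - F t) / (S n - t))) \<longlonglongrightarrow> ennreal (kk * (h * \<alpha>' h - \<alpha> h) * exp (kk * w t))"
      by (intro tendsto_ennrealI seq Fd)
    then have "ennreal (kk * (h * \<alpha>' h - \<alpha> h) * exp (kk * w t))
       = liminf (\<lambda>n. ennreal ((F (S n) - F t) / (S n - t)))"
      by (intro lim_imp_Liminf[symmetric]) auto
    also have "\<dots> \<le> W x" unfolding W_def
    proof (intro Liminf_mono always_eventually allI ennreal_leI)
      fix n
      have "Q (S n) x \<le> w (S n)" using Q_le[OF Spos, of n x y] by (simp add: w_def)
      then have "F (S n) - F t \<le> exp (k m (S n) * Q t x) - exp (k m (S n) * Q (S n) x)"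
        using kS[of n] by (simp add: F_def wt mult_left_mono)
      then show "(F (S n) - F t) / (S n - t) \<le> G n x"
        unfolding G_def using S(2)[of n] by (intro divide_right_mono) auto
    qed
    finally show "ennreal (k m t * (dist x y / t * \<alpha>' (dist x y / t) - \<alpha> (dist x y / t)) * exp (k m t * Q t x)) \<le> W x"
      by (simp add: kk_def h_def wt)
  qed
  \<comment> \<open>The choice of \<open>t0\<close> takes effect here: the entropy returns with the
    factor \<open>(m - 1) / (p - 1) \<le> 1\<close>. The term with \<open>\<epsilon>\<close> makes
    the contradiction strict even if \<open>E = 0\<close>.\<close>
  also have "C * (t / t0) * UU = (m - 1) / (p - 1) * E - C * (t / t0) * kk * Z kk * \<epsilon>"
  proof -
    have 1: "UU = (m - 1) / t * E - kk * Z kk * \<epsilon>"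
      using kk Zpos[OF kk] t by (simp add: UU_def k'_def right_diff_distrib)
    have 2: "C * (t / t0) * ((m - 1) / t) = (m - 1) / (p - 1)"
      using t C_pos by (simp add: t0_def)
    show ?thesis unfolding 1 right_diff_distrib
      by (simp only: 2 mult.assoc[symmetric])
  qed
  also have "\<dots> < (m - 1) / (p - 1) * E"
    using kk Zpos[OF kk] t C_pos t0_pos \<epsilon> by simp
  also have "\<dots> \<le> 1 * E"
    using m p_gt_1 E(2) by (intro mult_right_mono) auto
  finally show False by simp
qed

section \<open>Regularity in time, the limit at time 0 and the join of the two phases\<close>

lemma \<phi>_bound: "s > 0 \<Longrightarrow> \<bar>\<phi> m s\<bar> \<le> M"
proof -
  assume s: "s > 0"
  let ?Z = "\<integral>x. exp (k m s * Q s x) \<partial>\<mu>"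
  note b = exp_integral_bounds[OF Q_measurable[OF s] Q_bound[OF s] less_imp_le[OF k_pos[OF s]], of m]
  have "ln (exp (- k m s * M)) \<le> ln ?Z" using b by (subst ln_le_cancel_iff) auto
  moreover have "ln ?Z \<le> ln (exp (k m s * M))" using b by (subst ln_le_cancel_iff) auto
  ultimately show ?thesis using k_pos[OF s, of m]
    by (auto simp: \<phi>_def abs_le_iff field_simps)
qed

text \<open>Since \<open>Q\<close> is nonincreasing in time, only the change of \<open>k\<close> can
  push \<open>\<phi>\<close> upward. It costs \<open>M\<close> once in the exponent and once in the
  normalization by \<open>k\<close>.\<close>

lemma \<phi>_left:
  assumes s: "s > 0" "s \<le> t"
  shows "\<phi> m t \<le> \<phi> m s + 2 * M * \<bar>k m t - k m s\<bar> / k m t"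
proof -
  define d where "d = \<bar>k m t - k m s\<bar>"
  have t: "t > 0" using s by simp
  note k = k_pos[OF s(1), of m] k_pos[OF t, of m]
  define Zs where "Zs = (\<integral>x. exp (k m s * Q s x) \<partial>\<mu>)"
  define Zt where "Zt = (\<integral>x. exp (k m t * Q t x) \<partial>\<mu>)"
  have Z: "Zs > 0" "Zt > 0" unfolding Zs_def Zt_def
    using exp_integral_bounds(3)[OF Q_measurable[OF s(1)] Q_bound[OF s(1)] less_imp_le[OF k(1)]]
      exp_integral_bounds(3)[OF Q_measurable[OF t] Q_bound[OF t] less_imp_le[OF k(2)]] by auto
  have le: "exp (k m t * Q t x) \<le> exp (d * M) * exp (k m s * Q s x)" for x
  proof -
    have "k m t * Q t x \<le> k m t * Q s x" using Q_antimono[OF s] k by simp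
    moreover have "(k m t - k m s) * Q s x \<le> d * M"
      unfolding d_def
      by (rule order_trans[OF abs_ge_self], subst abs_mult) (rule mult_left_mono[OF Q_bound[OF s(1)] abs_ge_zero])
    ultimately have "k m t * Q t x \<le> d * M + k m s * Q s x" by (simp add: left_diff_distrib)
    then have "exp (k m t * Q t x) \<le> exp (d * M + k m s * Q s x)" by (simp only: exp_le_cancel_iff)
    then show ?thesis by (simp only: exp_add)
  qed
  have "Zt \<le> (\<integral>x. exp (d * M) * exp (k m s * Q s x) \<partial>\<mu>)"
    unfolding Zt_def using le exp_integrable(1)[OF Q_measurable Q_bound] s t
    by (intro integral_mono) auto
  then have "Zt \<le> exp (d * M) * Zs" by (simp add: Zs_def)
  then have "ln Zt \<le> ln (exp (d * M) * Zs)" using Z by (subst ln_le_cancel_iff) auto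
  then have 1: "ln Zt \<le> d * M + ln Zs" using Z by (simp add: ln_mult)
  have "ln Zs = k m s * \<phi> m s" using k by (simp add: \<phi>_def Zs_def)
  also have "\<dots> \<le> k m t * \<phi> m s + d * M"
  proof -
    have "(k m s - k m t) * \<phi> m s \<le> d * M"
      unfolding d_def abs_minus_commute[of "k m t"]
      by (rule order_trans[OF abs_ge_self], subst abs_mult) (rule mult_left_mono[OF \<phi>_bound[OF s(1)] abs_ge_zero])
    then show ?thesis by (simp add: left_diff_distrib)
  qed
  finally have "ln Zt \<le> k m t * \<phi> m s + 2 * M * d" using 1 by (simp add: algebra_simps)
  then have "ln Zt / k m t \<le> (k m t * \<phi> m s + 2 * M * d) / k m t"
    using k by (intro divide_right_mono) auto
  then show ?thesis using k by (simp add: \<phi>_def Zt_def d_def add_divide_distrib)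
qed

lemma \<phi>_antimono:
  assumes ab: "0 < a" "a \<le> b" and m: "(m = p \<and> b \<le> t0) \<or> (m = r \<and> t0 \<le> a)"
  shows "\<phi> m b \<le> \<phi> m a"
proof (rule right_Dini_antimono[OF ab(2)])
  fix t \<epsilon> :: real and S :: "nat \<Rightarrow> real"
  assume t: "a \<le> t" "t < b" and S: "\<epsilon> > 0" "S \<longlonglongrightarrow> t" "\<And>n. t < S n"
    "\<And>n. \<phi> m t + \<epsilon> * (S n - t) < \<phi> m (S n)"
  have "admissible m t" "1 \<le> m" "m \<le> p" "t > 0"
    using m t ab r_ge_1 r_le_p p_gt_1 by (auto simp: admissible_def)
  then show False using \<phi>_right S by blast
next
  fix t e :: real assume t: "a < t" "t \<le> b" "e > 0"
  have tp: "t > 0" using t ab by simp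
  have "((\<lambda>s. 2 * M * \<bar>k m t - k m s\<bar> / k m t) \<longlongrightarrow> 2 * M * \<bar>k m t - k m t\<bar> / k m t) (at t)"
    using DERIV_isCont[OF k_deriv[OF tp, of m]] k_pos[OF tp, of m]
    by (intro tendsto_intros) (auto simp: isCont_def)
  then have "eventually (\<lambda>s. 2 * M * \<bar>k m t - k m s\<bar> / k m t < e) (at t)"
    using order_tendstoD(2)[of _ 0] t(3) by simp
  then obtain d where d: "d > 0" "\<And>s. s \<noteq> t \<Longrightarrow> dist s t < d \<Longrightarrow> 2 * M * \<bar>k m t - k m s\<bar> / k m t < e"
    unfolding eventually_at by blast
  show "\<exists>d>0. \<forall>s. t - d < s \<longrightarrow> a \<le> s \<longrightarrow> s < t \<longrightarrow> \<phi> m t \<le> \<phi> m s + e"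
  proof (intro exI[of _ d] conjI allI impI d(1))
    fix s assume s: "t - d < s" "a \<le> s" "s < t"
    then have "\<phi> m t \<le> \<phi> m s + 2 * M * \<bar>k m t - k m s\<bar> / k m t"
      using ab by (intro \<phi>_left) auto
    moreover have "2 * M * \<bar>k m t - k m s\<bar> / k m t < e"
      using d(2)[of s] s by (simp add: dist_real_def)
    ultimately show "\<phi> m t \<le> \<phi> m s + e" by simp
  qed
qed

lemma f_borel: "f \<in> borel_measurable \<mu>"
  using lsc_borel[OF lsc] measurable_cong_sets[OF sets_\<mu> refl] by blast

text \<open>Convergence of \<open>Q t\<close> to \<open>f\<close> as \<open>t\<close> tends to 0 is
  bypassed. At a small time \<open>a\<close> with \<open>k p a = c\<close>, the bounds
  \<open>Q a \<le> f\<close> and \<open>ln z \<le> z - 1\<close> leave a difference quotient in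
  \<open>c\<close> whose limit is the mean of \<open>f\<close>.\<close>

lemma \<phi>_le_integral:
  assumes b: "0 < b" "b \<le> t0"
  shows "\<phi> p b \<le> (\<integral>x. f x \<partial>\<mu>)"
proof -
  have "((\<lambda>c. \<integral>x. exp (c * f x) \<partial>\<mu>) has_real_derivative (\<integral>x. f x * exp (0 * f x) \<partial>\<mu>)) (at 0)"
    by (rule exp_integral_deriv[OF f_borel f_bound])
  then have "((\<lambda>c. ((\<integral>x. exp (c * f x) \<partial>\<mu>) - 1) / c) \<longlongrightarrow> (\<integral>x. f x \<partial>\<mu>)) (at 0)"
    by (simp add: has_field_derivative_iff prob_space)
  then have lim: "((\<lambda>c. ((\<integral>x. exp (c * f x) \<partial>\<mu>) - 1) / c) \<longlongrightarrow> (\<integral>x. f x \<partial>\<mu>)) (at_right 0)"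
    by (rule tendsto_within_subset) auto
  have "eventually (\<lambda>c. \<phi> p b \<le> ((\<integral>x. exp (c * f x) \<partial>\<mu>) - 1) / c) (at_right 0)"
  proof -
    have "eventually (\<lambda>c. c < k p b \<and> 0 < c) (at_right (0::real))"
      by (rule eventually_mono[OF eventually_at_right_real[OF k_pos[OF b(1), of p]]]) simp
    then show ?thesis
    proof (rule eventually_mono)
      fix c assume c: "c < k p b \<and> 0 < c"
      \<comment> \<open>The time at which the coefficient equals \<open>c\<close>; inverting the
        power requires \<open>p > 1\<close>.\<close>
      define a where "a = t0 * c powr (1 / (p - 1))"
      have a: "a > 0" using c t0_pos by (simp add: a_def)
      have ka: "k p a = c" using c t0_pos p_gt_1 by (simp add: k_def a_def powr_powr)
      have "a \<le> b"
      proof (rule ccontr)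
        assume "\<not> a \<le> b"
        then have "k p b \<le> k p a" unfolding k_def using b t0_pos p_gt_1
          by (intro powr_mono2 divide_right_mono) auto
        then show False using ka c by simp
      qed
      then have "\<phi> p b \<le> \<phi> p a" using \<phi>_antimono[OF a] b by simp
      also have "\<dots> \<le> ((\<integral>x. exp (c * f x) \<partial>\<mu>) - 1) / c"
      proof -
        have c0: "c \<ge> 0" using c by simp
        let ?Z = "\<integral>x. exp (c * Q a x) \<partial>\<mu>"
        have "ln ?Z \<le> ?Z - 1"
          using exp_integral_bounds(3)[OF Q_measurable[OF a] Q_bound[OF a] c0] by (intro ln_le_minus_one)
        also have "?Z \<le> (\<integral>x. exp (c * f x) \<partial>\<mu>)"
          using exp_integrable(1)[OF Q_measurable[OF a] Q_bound[OF a]] exp_integrable(1)[OF f_borel f_bound]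
            Q_le_f[OF a] c by (intro integral_mono) auto
        finally show ?thesis unfolding \<phi>_def ka using c by (intro divide_right_mono) auto
      qed
      finally show "\<phi> p b \<le> ((\<integral>x. exp (c * f x) \<partial>\<mu>) - 1) / c" .
    qed
  qed
  then show ?thesis by (intro tendsto_lowerbound[OF lim]) auto
qed

lemma exp_Q_le:
  defines "A \<equiv> max (t0 powr (r - 1)) (t0 powr (p - 1))"
  shows "(\<integral>x. exp (Q 1 x / A) \<partial>\<mu>) \<le> exp ((\<integral>x. f x \<partial>\<mu>) / A)"
proof -
  obtain m where m: "\<phi> m 1 \<le> (\<integral>x. f x \<partial>\<mu>)" "k m 1 = 1 / A"
  \<comment> \<open>If \<open>t0 \<ge> 1\<close>, time 1 is still in the early phase. Otherwise the
    phases are joined at \<open>t0\<close>, where both coefficients equal 1.\<close>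
  proof (cases "1 \<le> t0")
    case True
    have "t0 powr (r - 1) \<le> t0 powr (p - 1)" using True r_le_p by (intro powr_mono) auto
    then have "k p 1 = 1 / A" using t0_pos by (simp add: k_def A_def powr_divide)
    then show ?thesis using \<phi>_le_integral[of 1] True that by simp
  next
    case False
    have "t0 powr (p - 1) \<le> t0 powr (r - 1)" using False t0_pos r_le_p by (intro powr_mono') auto
    then have "k r 1 = 1 / A" using t0_pos by (simp add: k_def A_def powr_divide max_def)
    moreover have "\<phi> r 1 \<le> \<phi> r t0" using \<phi>_antimono[of t0 1 r] t0_pos False by simp
    moreover have "\<phi> r t0 = \<phi> p t0" using t0_pos by (simp add: \<phi>_def k_def)
    moreover have "\<phi> p t0 \<le> (\<integral>x. f x \<partial>\<mu>)" using \<phi>_le_integral[of t0] t0_pos by simp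
    ultimately show ?thesis using that[of r] by linarith
  qed
  have A: "A > 0" using t0_pos by (simp add: A_def less_max_iff_disj)
  let ?Z = "\<integral>x. exp (1 / A * Q 1 x) \<partial>\<mu>"
  have Z: "?Z > 0" using exp_integral_bounds(3)[OF Q_measurable Q_bound, of 1 "1 / A"] A by simp
  have "ln ?Z * A \<le> (\<integral>x. f x \<partial>\<mu>)" using m(1) by (simp only: \<phi>_def m(2)) simp
  then have "ln ?Z \<le> (\<integral>x. f x \<partial>\<mu>) / A" using A by (simp add: field_simps)
  then have "exp (ln ?Z) \<le> exp ((\<integral>x. f x \<partial>\<mu>) / A)" by (simp only: exp_le_cancel_iff)
  also have "exp (ln ?Z) = ?Z" using Z by (rule exp_ln)
  finally show ?thesis by simp
qed

end

subsection \<open>Finite transport duality\<close>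

lemma compact_PiE:
  fixes X :: "'i \<Rightarrow> 'b::topological_space set"
  assumes "\<And>i. i \<in> I \<Longrightarrow> compact (X i)"
  shows "compact (Pi\<^sub>E I X)"
proof -
  \<comment> \<open>The product topology on functions ranges over the whole index type, so the
    coordinates outside \<open>I\<close> are pinned to a singleton.\<close>
  have eq: "Pi\<^sub>E I X = Pi\<^sub>E UNIV (\<lambda>i. if i \<in> I then X i else {undefined})"
    by (auto simp: PiE_def extensional_def Pi_def split: if_splits)
  have "compactin (product_topology (\<lambda>_. euclidean) UNIV) (Pi\<^sub>E UNIV (\<lambda>i. if i \<in> I then X i else {undefined}))"
    unfolding compactin_PiE using assms by auto
  then show ?thesis unfolding eq by (simp add: euclidean_product_topology compactin_euclidean_iff)
qed

text \<open>The first-order conditions at a minimizer of the penalized cost say that \<open>N\<close> times the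
  marginal errors are dual potentials.\<close>

lemma penalized_transport:
  fixes c :: "'i \<Rightarrow> 'i \<Rightarrow> real"
  assumes S: "finite S"
    and a: "\<And>i. i \<in> S \<Longrightarrow> 0 \<le> a i" "sum a S = 1"
    and b: "\<And>i. i \<in> S \<Longrightarrow> 0 \<le> b i" "sum b S = 1"
    and c: "\<And>i j. i \<in> S \<Longrightarrow> j \<in> S \<Longrightarrow> 0 \<le> c i j"
    and B: "\<And>f g. (\<And>i j. i \<in> S \<Longrightarrow> j \<in> S \<Longrightarrow> g j - f i \<le> c i j)
       \<Longrightarrow> (\<Sum>j\<in>S. g j * b j) - (\<Sum>i\<in>S. f i * a i) \<le> B"
    and N: "N > 2 * (\<Sum>i\<in>S. \<Sum>j\<in>S. c i j * (a i * b j))" "N > 0"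
  obtains w where "w \<in> (\<Pi>\<^sub>E z\<in>S \<times> S. {0..2})"
    "(\<Sum>i\<in>S. \<Sum>j\<in>S. c i j * w (i, j))
      + N * ((\<Sum>i\<in>S. ((\<Sum>j\<in>S. w (i, j)) - a i)\<^sup>2) + (\<Sum>j\<in>S. ((\<Sum>i\<in>S. w (i, j)) - b j)\<^sup>2)) \<le> B"
proof -
  \<comment> \<open>The upper bound 2 provides compactness and is never attained at the minimizer:
    the prescribed masses are at most 1 and the marginal errors turn out smaller than 1.\<close>
  define P where "P = (\<Pi>\<^sub>E z\<in>S \<times> S. {0..2::real})"
  define cost where "cost w = (\<Sum>i\<in>S. \<Sum>j\<in>S. c i j * w (i, j))" for w :: "'i \<times> 'i \<Rightarrow> real"
  define rowerr where "rowerr w i = (\<Sum>j\<in>S. w (i, j)) - a i" for w i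
  define colerr where "colerr w j = (\<Sum>i\<in>S. w (i, j)) - b j" for w j
  define err where "err w = (\<Sum>i\<in>S. (rowerr w i)\<^sup>2) + (\<Sum>j\<in>S. (colerr w j)\<^sup>2)" for w
  \<comment> \<open>With the factor \<open>N / 2\<close>, the derivative of \<open>J\<close> in the
    entry \<open>(i, j)\<close> is \<open>c i j + f i - g j\<close> for the potentials defined
    below.\<close>
  define J where "J w = cost w + N / 2 * err w" for w
  have Pc: "compact P" unfolding P_def by (rule compact_PiE) simp
  have Jc: "continuous_on P J"
    unfolding J_def cost_def err_def rowerr_def colerr_def
    by (intro continuous_intros continuous_on_subset[OF continuous_on_product_coordinates]) auto
  \<comment> \<open>The product plan has exact marginals. Comparison with it, together with the size
    of \<open>N\<close>, forces \<open>err w < 1\<close>.\<close>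
  define w0 where "w0 z = (if z \<in> S \<times> S then a (fst z) * b (snd z) else undefined)" for z
  have a1: "a i \<le> 1" if "i \<in> S" for i
    using member_le_sum[of i S a] S a that by simp
  have b1: "b i \<le> 1" if "i \<in> S" for i
    using member_le_sum[of i S b] S b that by simp
  have "a i * b j \<le> 1 * 1" if "i \<in> S" "j \<in> S" for i j
    using that a(1) b(1) a1 b1 by (intro mult_mono) auto
  then have ab2: "a i * b j \<le> 2" if "i \<in> S" "j \<in> S" for i j
    using that by fastforce
  have w0P: "w0 \<in> P" unfolding P_def
  proof (rule PiE_I)
    fix z assume "z \<in> S \<times> S"
    then show "w0 z \<in> {0..2}" using a(1) b(1) ab2 by (auto simp: w0_def)
  qed (simp add: w0_def)
  have w0e: "rowerr w0 i = 0" "colerr w0 i = 0" if "i \<in> S" for i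
    using that by (simp_all add: rowerr_def colerr_def w0_def sum_distrib_left[symmetric] sum_distrib_right[symmetric] a b)
  have Jw0: "J w0 = cost w0" by (simp add: J_def err_def w0e)
  have cw0: "cost w0 = (\<Sum>i\<in>S. \<Sum>j\<in>S. c i j * (a i * b j))"
    unfolding cost_def by (intro sum.cong) (auto simp: w0_def)
  obtain w where w: "w \<in> P" "\<And>v. v \<in> P \<Longrightarrow> J w \<le> J v"
    using continuous_attains_inf[OF Pc _ Jc] w0P by blast
  have w_nonneg: "w (i, j) \<ge> 0" if "i \<in> S" "j \<in> S" for i j
    using w(1) that unfolding P_def by (metis PiE_mem SigmaI atLeastAtMost_iff)
  have cost_nonneg: "cost w \<ge> 0" unfolding cost_def using c w_nonneg by (intro sum_nonneg mult_nonneg_nonneg)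
  have "N / 2 * err w \<le> cost w0" using w(2)[OF w0P, unfolded Jw0] cost_nonneg unfolding J_def by linarith
  also have "\<dots> < N / 2" using N cw0 by simp
  finally have err1: "err w < 1" using N(2) by simp
  have row1: "(rowerr w i)\<^sup>2 < 1" if "i \<in> S" for i
  proof -
    have "(rowerr w i)\<^sup>2 \<le> (\<Sum>i\<in>S. (rowerr w i)\<^sup>2)" using S that by (intro member_le_sum) auto
    also have "\<dots> \<le> err w" unfolding err_def by (simp add: sum_nonneg)
    finally show ?thesis using err1 by simp
  qed
  have w_lt: "w (i, j) < 2" if ij: "i \<in> S" "j \<in> S" for i j
  proof -
    have "w (i, j) \<le> (\<Sum>j\<in>S. w (i, j))"
      using S ij w_nonneg by (intro member_le_sum) auto
    also have "\<dots> = rowerr w i + a i" by (simp add: rowerr_def)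
    also have "\<dots> < 1 + 1" using row1[OF ij(1)] a1[OF ij(1)] by (simp add: abs_square_less_1 abs_less_iff)
    finally show ?thesis by simp
  qed
  define f where "f i = N * rowerr w i" for i
  define g where "g j = - N * colerr w j" for j
  \<comment> \<open>The expansion is exact: the changed row and the changed column each contribute
    \<open>N / 2 * t\<^sup>2\<close>.\<close>
  have perturb: "0 \<le> t * (c i j + f i - g j) + N * t\<^sup>2"
    if ij: "i \<in> S" "j \<in> S" and t: "0 \<le> w (i, j) + t" "w (i, j) + t \<le> 2" for i j t
  proof -
    define v where "v = w((i, j) := w (i, j) + t)"
    have vP: "v \<in> P" using w(1) ij t unfolding P_def v_def by (auto simp: PiE_def extensional_def Pi_def)
    have vx: "v (i', j') = w (i', j') + (if i' = i \<and> j' = j then t else 0)" for i' j' by (simp add: v_def)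
    have row: "rowerr v i' = rowerr w i' + (if i' = i then t else 0)" for i'
      using S ij by (cases "i' = i") (simp_all add: rowerr_def vx sum.distrib)
    have col: "colerr v j' = colerr w j' + (if j' = j then t else 0)" for j'
      using S ij by (cases "j' = j") (simp_all add: colerr_def vx sum.distrib)
    have sq: "(x + (if Q then t else 0))\<^sup>2 = x\<^sup>2 + (if Q then 2 * x * t + t\<^sup>2 else 0)" for x Q
      by (simp add: power2_sum algebra_simps)
    have "cost v = (\<Sum>i'\<in>S. \<Sum>j'\<in>S. c i' j' * w (i', j') + (if i' = i then if j' = j then c i j * t else 0 else 0))"
      unfolding cost_def vx by (intro sum.cong) (auto simp: algebra_simps)
    also have "\<dots> = cost w + c i j * t"
      unfolding cost_def sum.distrib
    proof -
      have "(\<Sum>i'\<in>S. \<Sum>j'\<in>S. if i' = i then if j' = j then c i j * t else 0 else 0)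
          = (\<Sum>i'\<in>S. if i' = i then c i j * t else 0)"
        using S ij by (intro sum.cong) auto
      also have "\<dots> = c i j * t" using S ij by simp
      finally show "(\<Sum>i\<in>S. \<Sum>j\<in>S. c i j * w (i, j)) +
        (\<Sum>i'\<in>S. \<Sum>j'\<in>S. if i' = i then if j' = j then c i j * t else 0 else 0)
        = (\<Sum>i\<in>S. \<Sum>j\<in>S. c i j * w (i, j)) + c i j * t" by simp
    qed
    finally have cv: "cost v = cost w + c i j * t" .
    have "err v = err w + (2 * rowerr w i * t + t\<^sup>2) + (2 * colerr w j * t + t\<^sup>2)"
      unfolding err_def row col sq sum.distrib using S ij by simp
    then have "J v = J w + t * (c i j + f i - g j) + N * t\<^sup>2"
      unfolding J_def cv f_def g_def by (simp add: algebra_simps)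
    then show ?thesis using w(2)[OF vP] by simp
  qed
  have fg: "g j - f i \<le> c i j" if ij: "i \<in> S" "j \<in> S" for i j
  proof (rule ccontr)
    assume neg: "\<not> g j - f i \<le> c i j"
    define d where "d = g j - f i - c i j"
    have dp: "d > 0" using neg by (simp add: d_def)
    \<comment> \<open>Short enough to stay in the box and to keep the quadratic term below the
      linear gain \<open>d\<close>.\<close>
    define t where "t = min (2 - w (i, j)) (d / (2 * N))"
    have t: "t > 0" "w (i, j) + t \<le> 2" "N * t \<le> d / 2"
      using dp w_lt[OF ij] N(2) by (auto simp: t_def field_simps min_def)
    have "0 \<le> t * (c i j + f i - g j) + N * t\<^sup>2"
      using perturb[OF ij, of t] t w_nonneg[OF ij] by simp
    then have "0 \<le> t * (N * t - d)" by (simp add: d_def algebra_simps power2_eq_square)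
    then have "d \<le> N * t" using t(1) by (simp add: zero_le_mult_iff)
    then show False using t(3) dp by linarith
  qed
  \<comment> \<open>Complementary slackness: a positive entry can also be decreased, so its dual
    constraint is tight.\<close>
  have slack: "c i j * w (i, j) = (g j - f i) * w (i, j)" if ij: "i \<in> S" "j \<in> S" for i j
  proof (cases "w (i, j) = 0")
    case False
    then have wp: "w (i, j) > 0" using w_nonneg[OF ij] by simp
    have "c i j = g j - f i"
    proof (rule ccontr)
      assume "c i j \<noteq> g j - f i"
      define d where "d = c i j + f i - g j"
      have dp: "d > 0" using \<open>c i j \<noteq> g j - f i\<close> fg[OF ij] by (simp add: d_def)
      define t where "t = min (w (i, j)) (d / (2 * N))"
      have t: "t > 0" "t \<le> w (i, j)" "N * t \<le> d / 2"
        using dp wp N(2) by (auto simp: t_def field_simps min_def)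
      have "0 \<le> (- t) * d + N * (- t)\<^sup>2"
        using perturb[OF ij, of "- t"] t w_lt[OF ij] unfolding d_def by simp
      then have "0 \<le> t * (N * t - d)" by (simp add: algebra_simps power2_eq_square)
      then have "d \<le> N * t" using t(1) by (simp add: zero_le_mult_iff)
      then show False using t(3) dp by linarith
    qed
    then show ?thesis by simp
  qed simp
  have "cost w = (\<Sum>i\<in>S. \<Sum>j\<in>S. g j * w (i, j) - f i * w (i, j))"
    unfolding cost_def using slack by (intro sum.cong) (auto simp: algebra_simps)
  also have "\<dots> = (\<Sum>j\<in>S. g j * (\<Sum>i\<in>S. w (i, j))) - (\<Sum>i\<in>S. f i * (\<Sum>j\<in>S. w (i, j)))"
    unfolding sum_subtractf sum_distrib_left by (subst sum.swap) simp
  also have "\<dots> = (\<Sum>j\<in>S. g j * (b j + colerr w j)) - (\<Sum>i\<in>S. f i * (a i + rowerr w i))"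
    by (simp add: colerr_def rowerr_def)
  also have "\<dots> = ((\<Sum>j\<in>S. g j * b j) - (\<Sum>i\<in>S. f i * a i)) - N * err w"
    by (simp add: f_def g_def err_def distrib_left sum.distrib sum_distrib_left sum_negf sum_subtractf power2_eq_square algebra_simps)
  finally have "cost w + N * err w \<le> B" using B[of g f] fg by simp
  then show ?thesis using that[of w] w(1)
    unfolding P_def cost_def err_def rowerr_def colerr_def by blast
qed

text \<open>Lets the penalty grow. The conditions for increasing \<open>N\<close> are nested closed
  subsets of a compact box, so some plan satisfies all of them. Its cost is nonnegative and
  \<open>N * err\<close> stays bounded, hence its marginals are exact.\<close>

lemma transport_duality_finite:
  fixes c :: "'i \<Rightarrow> 'i \<Rightarrow> real"
  assumes S: "finite S"
    and a: "\<And>i. i \<in> S \<Longrightarrow> 0 \<le> a i" "sum a S = 1"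
    and b: "\<And>i. i \<in> S \<Longrightarrow> 0 \<le> b i" "sum b S = 1"
    and c: "\<And>i j. i \<in> S \<Longrightarrow> j \<in> S \<Longrightarrow> 0 \<le> c i j"
    and B: "\<And>f g. (\<And>i j. i \<in> S \<Longrightarrow> j \<in> S \<Longrightarrow> g j - f i \<le> c i j)
       \<Longrightarrow> (\<Sum>j\<in>S. g j * b j) - (\<Sum>i\<in>S. f i * a i) \<le> B"
  obtains w where "\<And>i j. i \<in> S \<Longrightarrow> j \<in> S \<Longrightarrow> 0 \<le> w i j"
    "\<And>i. i \<in> S \<Longrightarrow> (\<Sum>j\<in>S. w i j) = a i" "\<And>j. j \<in> S \<Longrightarrow> (\<Sum>i\<in>S. w i j) = b j"
    "(\<Sum>i\<in>S. \<Sum>j\<in>S. c i j * w i j) \<le> B"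
proof -
  define P where "P = (\<Pi>\<^sub>E z\<in>S \<times> S. {0..2::real})"
  define cost where "cost w = (\<Sum>i\<in>S. \<Sum>j\<in>S. c i j * w (i, j))" for w :: "'i \<times> 'i \<Rightarrow> real"
  define err where "err w = (\<Sum>i\<in>S. ((\<Sum>j\<in>S. w (i, j)) - a i)\<^sup>2) + (\<Sum>j\<in>S. ((\<Sum>i\<in>S. w (i, j)) - b j)\<^sup>2)" for w
  define N0 where "N0 = 2 * (\<Sum>i\<in>S. \<Sum>j\<in>S. c i j * (a i * b j))"
  define F where "F n = {w \<in> P. cost w + (\<bar>N0\<bar> + 1 + real n) * err w \<le> B}" for n :: nat
  have Pc: "compact P" unfolding P_def by (rule compact_PiE) simp
  have cont: "continuous_on UNIV cost" "continuous_on UNIV err"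
    unfolding cost_def err_def
    by (intro continuous_intros continuous_on_product_coordinates)+
  have Fc: "F n = P \<inter> {w. cost w + (\<bar>N0\<bar> + 1 + real n) * err w \<le> B}" for n by (auto simp: F_def)
  have closed: "closed {w. cost w + (\<bar>N0\<bar> + 1 + real n) * err w \<le> B}" for n
    by (intro closed_Collect_le continuous_intros cont)
  have err_nonneg: "err w \<ge> 0" for w by (simp add: err_def sum_nonneg)
  have "P \<inter> (\<Inter>n\<in>UNIV. {w. cost w + (\<bar>N0\<bar> + 1 + real n) * err w \<le> B}) \<noteq> {}"
  proof (rule compact_imp_fip_image[OF Pc])
    fix I :: "nat set" assume "finite I"
    then obtain n where n: "\<And>i. i \<in> I \<Longrightarrow> i \<le> n" using finite_nat_set_iff_bounded_le by auto
    have "\<exists>w. w \<in> P \<and> cost w + (\<bar>N0\<bar> + 1 + real n) * err w \<le> B"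
    proof (rule penalized_transport[of S a b c B "\<bar>N0\<bar> + 1 + real n"])
      show "2 * (\<Sum>i\<in>S. \<Sum>j\<in>S. c i j * (a i * b j)) < \<bar>N0\<bar> + 1 + real n"
        unfolding N0_def[symmetric] by linarith
    qed (fact S a b c B | linarith | auto simp: P_def cost_def err_def)+
    then obtain w where w: "w \<in> P" "cost w + (\<bar>N0\<bar> + 1 + real n) * err w \<le> B" by blast
    have "cost w + (\<bar>N0\<bar> + 1 + real i) * err w \<le> B" if "i \<in> I" for i
    proof -
      have "(\<bar>N0\<bar> + 1 + real i) * err w \<le> (\<bar>N0\<bar> + 1 + real n) * err w"
        using n[OF that] err_nonneg by (intro mult_right_mono) auto
      then show ?thesis using w(2) by linarith
    qed
    then show "P \<inter> (\<Inter>n\<in>I. {w. cost w + (\<bar>N0\<bar> + 1 + real n) * err w \<le> B}) \<noteq> {}"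
      using w(1) by blast
  qed (rule closed)
  then obtain w where w: "w \<in> P" "\<And>n. cost w + (\<bar>N0\<bar> + 1 + real n) * err w \<le> B" by blast
  have w_nonneg: "w (i, j) \<ge> 0" if "i \<in> S" "j \<in> S" for i j
    using w(1) that unfolding P_def by (metis PiE_mem SigmaI atLeastAtMost_iff)
  have cost_nonneg: "cost w \<ge> 0" unfolding cost_def using c w_nonneg by (intro sum_nonneg mult_nonneg_nonneg)
  have "err w = 0"
  proof (rule ccontr)
    assume "err w \<noteq> 0"
    then have e: "err w > 0" using err_nonneg[of w] by simp
    obtain n where n: "real n > \<bar>B\<bar> / err w" using reals_Archimedean2 by blast
    then have "\<bar>B\<bar> < real n * err w" using e by (simp add: field_simps)
    moreover have "real n * err w \<le> (\<bar>N0\<bar> + 1 + real n) * err w" using e by (intro mult_right_mono) auto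
    ultimately show False using w(2)[of n] cost_nonneg by linarith
  qed
  then have "(\<Sum>i\<in>S. ((\<Sum>j\<in>S. w (i, j)) - a i)\<^sup>2) = 0" "(\<Sum>j\<in>S. ((\<Sum>i\<in>S. w (i, j)) - b j)\<^sup>2) = 0"
    unfolding err_def by (smt (verit) sum_nonneg zero_le_power2)+
  then have "(\<Sum>j\<in>S. w (i, j)) = a i" "(\<Sum>j\<in>S. w (j, i)) = b i" if "i \<in> S" for i
    using that S by (simp_all add: sum_nonneg_eq_0_iff)
  then show ?thesis
    using that[of "\<lambda>i j. w (i, j)"] w_nonneg w(2)[of 0] \<open>err w = 0\<close> by (simp add: cost_def)
qed

subsection \<open>Quantization and couplings\<close>

text \<open>The index set may be uncountable; lower semicontinuity still makes the supremum
  measurable and admissible as a dual test function.\<close>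

lemma lsc_SUP:
  fixes F :: "'b \<Rightarrow> 'a::topological_space \<Rightarrow> real"
  assumes cont: "\<And>z. continuous_on UNIV (F z)" and B: "\<And>z y. F z y \<le> B"
  shows "lsc (\<lambda>y. SUP z. F z y)"
  unfolding lsc_def
proof (intro allI impI)
  have bdd: "bdd_above (range (\<lambda>z. F z y))" for y using B by (intro bdd_aboveI2[where M = B]) auto
  fix x c assume "c < (SUP z. F z x)"
  then obtain z where z: "c < F z x" using less_cSUP_iff[OF _ bdd] by blast
  have "open {y. c < F z y}" by (intro open_Collect_less continuous_intros cont)
  then have "eventually (\<lambda>y. y \<in> {y. c < F z y}) (nhds x)"
    using z by (intro eventually_nhds_in_open) auto
  then show "eventually (\<lambda>y. c < (SUP z. F z y)) (nhds x)"
  proof (rule eventually_mono)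
    fix y assume "y \<in> {y. c < F z y}"
    then have "c < F z y" by simp
    also have "F z y \<le> (SUP z. F z y)" using bdd by (intro cSUP_upper) auto
    finally show "c < (SUP z. F z y)" .
  qed
qed

text \<open>A finite net of \<open>K\<close> is turned into nested case distinctions, one ball at a
  time. The constant value off \<open>K\<close> makes the quantized cost comparable to the distance
  from \<open>x0\<close> there.\<close>

lemma quantization:
  fixes K :: "'a::{metric_space, second_countable_topology} set"
  assumes "compact K" "x0 \<in> K" "\<delta> > 0"
  obtains T S where "T \<in> measurable borel borel" "finite S" "S \<subseteq> K" "\<And>x. T x \<in> S"
    "\<And>x. x \<in> K \<Longrightarrow> dist x (T x) < \<delta>" "\<And>x. x \<notin> K \<Longrightarrow> T x = x0"
proof -
  have "seq_compact K" using assms(1) by (simp add: compact_eq_seq_compact_metric)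
  then obtain k where k: "finite k" "k \<subseteq> K" "K \<subseteq> (\<Union>c\<in>k. ball c \<delta>)"
    using seq_compact_imp_totally_bounded[rule_format, OF _ assms(3)] by metis
  have "\<exists>T. T \<in> measurable borel borel \<and> range T \<subseteq> insert x0 k \<and> (\<forall>x\<in>(\<Union>c\<in>k. ball c \<delta>). dist x (T x) < \<delta>)"
    using k(1)
  proof (induction k)
    case empty
    show ?case by (rule exI[of _ "\<lambda>_. x0"]) auto
  next
    case (insert c k)
    then obtain T where T: "T \<in> measurable borel borel" "range T \<subseteq> insert x0 k"
      "\<forall>x\<in>(\<Union>c\<in>k. ball c \<delta>). dist x (T x) < \<delta>" by blast
    show ?case
    proof (intro exI[of _ "\<lambda>x. if dist x c < \<delta> then c else T x"] conjI)
      have "{x \<in> space borel. dist x c < \<delta>} \<in> sets borel" by measurable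
      then show "(\<lambda>x. if dist x c < \<delta> then c else T x) \<in> measurable borel borel"
        using T(1) by (intro measurable_If) simp_all
      show "range (\<lambda>x. if dist x c < \<delta> then c else T x) \<subseteq> insert x0 (insert c k)" using T(2) by auto
      show "\<forall>x\<in>(\<Union>c\<in>insert c k. ball c \<delta>). dist x (if dist x c < \<delta> then c else T x) < \<delta>"
        using T(3) by (auto simp: dist_commute)
    qed
  qed
  then obtain T where T: "T \<in> measurable borel borel" "range T \<subseteq> insert x0 k"
    "\<forall>x\<in>(\<Union>c\<in>k. ball c \<delta>). dist x (T x) < \<delta>" by blast
  have "K \<in> sets borel" using assms(1) by (simp add: compact_imp_closed)
  then have "(\<lambda>x. if x \<in> K then T x else x0) \<in> measurable borel borel"
    using T(1) by (intro measurable_If) (simp_all add: Collect_mem_eq)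
  moreover have "T x \<in> insert x0 k" for x using T(2) by blast
  moreover have "dist x (T x) < \<delta>" if "x \<in> K" for x using T(3) k(3) that by blast
  ultimately show ?thesis
    using that[of "\<lambda>x. if x \<in> K then T x else x0" "insert x0 k"] k assms(2) by simp
qed

lemma (in prob_space) integral_finite_range:
  fixes T :: "'a \<Rightarrow> 'b::metric_space" and \<phi> :: "'b \<Rightarrow> real"
  assumes T: "T \<in> measurable M borel" and S: "finite S" "\<And>x. T x \<in> S"
  defines "a \<equiv> \<lambda>s. measure M {x \<in> space M. T x = s}"
  shows "integrable M (\<lambda>x. \<phi> (T x))" "(\<integral>x. \<phi> (T x) \<partial>M) = (\<Sum>s\<in>S. \<phi> s * a s)"
    "(\<And>s. s \<in> S \<Longrightarrow> 0 \<le> \<phi> s) \<Longrightarrow> (\<integral>\<^sup>+x. ennreal (\<phi> (T x)) \<partial>M) = ennreal (\<Sum>s\<in>S. \<phi> s * a s)"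
    "sum a S = 1"
proof -
  have sets: "{x \<in> space M. T x = s} \<in> sets M" for s
  proof -
    have "T -` {s} \<inter> space M \<in> sets M" by (rule measurable_sets[OF T]) simp
    moreover have "T -` {s} \<inter> space M = {x \<in> space M. T x = s}" by auto
    ultimately show ?thesis by simp
  qed
  have eq: "\<psi> (T x) = (\<Sum>s\<in>S. \<psi> s * indicator {x \<in> space M. T x = s} x)" if "x \<in> space M"
    for x and \<psi> :: "'b \<Rightarrow> real"
  proof -
    have "(\<Sum>s\<in>S. \<psi> s * indicator {x \<in> space M. T x = s} x) = (\<Sum>s\<in>S. if s = T x then \<psi> s else 0)"
      using that by (intro sum.cong) (auto simp: indicator_def)
    then show ?thesis using S by simp
  qed
  have int: "integrable M (\<lambda>x. \<Sum>s\<in>S. \<psi> s * indicator {x \<in> space M. T x = s} x)" for \<psi> :: "'b \<Rightarrow> real"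
    using sets by (intro Bochner_Integration.integrable_sum integrable_mult_right integrable_real_indicator)
      (auto simp: less_top[symmetric])
  have i: "integrable M (\<lambda>x. \<psi> (T x))" for \<psi> :: "'b \<Rightarrow> real"
    using int[of \<psi>] by (subst Bochner_Integration.integrable_cong[OF refl eq]) auto
  have val: "(\<integral>x. \<psi> (T x) \<partial>M) = (\<Sum>s\<in>S. \<psi> s * a s)" for \<psi> :: "'b \<Rightarrow> real"
  proof -
    have "(\<integral>x. \<psi> (T x) \<partial>M) = (\<integral>x. (\<Sum>s\<in>S. \<psi> s * indicator {x \<in> space M. T x = s} x) \<partial>M)"
      by (rule Bochner_Integration.integral_cong[OF refl eq])
    also have "\<dots> = (\<Sum>s\<in>S. \<psi> s * a s)"
      using sets by (subst Bochner_Integration.integral_sum)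
        (auto simp: a_def less_top[symmetric] intro!: integrable_mult_right integrable_real_indicator)
    finally show ?thesis .
  qed
  show "integrable M (\<lambda>x. \<phi> (T x))" "(\<integral>x. \<phi> (T x) \<partial>M) = (\<Sum>s\<in>S. \<phi> s * a s)"
    by (rule i, rule val)
  show "sum a S = 1" using val[of "\<lambda>_. 1"] by (simp add: prob_space)
  assume "\<And>s. s \<in> S \<Longrightarrow> 0 \<le> \<phi> s"
  then show "(\<integral>\<^sup>+x. ennreal (\<phi> (T x)) \<partial>M) = ennreal (\<Sum>s\<in>S. \<phi> s * a s)"
    using S(2) by (subst nn_integral_eq_integral[OF i]) (auto simp: val)
qed

lemma density_coupling:
  fixes \<mu> \<nu> :: "'a::{metric_space, second_countable_topology} measure"
  assumes "prob_space \<mu>" "prob_space \<nu>" and sets: "sets \<mu> = sets borel" "sets \<nu> = sets borel"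
    and \<rho>: "\<rho> \<in> borel_measurable (borel \<Otimes>\<^sub>M borel)"
    and fst: "AE x in \<mu>. (\<integral>\<^sup>+y. \<rho> (x, y) \<partial>\<nu>) = 1"
    and snd: "AE y in \<nu>. (\<integral>\<^sup>+x. \<rho> (x, y) \<partial>\<mu>) = 1"
  shows "density (\<mu> \<Otimes>\<^sub>M \<nu>) \<rho> \<in> couplings \<mu> \<nu>"
proof -
  interpret \<mu>: prob_space \<mu> by fact
  interpret \<nu>: prob_space \<nu> by fact
  interpret pair_sigma_finite \<mu> \<nu> ..
  have sp: "sets (\<mu> \<Otimes>\<^sub>M \<nu>) = sets (borel \<Otimes>\<^sub>M borel)" by (rule sets_pair_measure_cong[OF sets])
  have space: "space \<mu> = UNIV" "space \<nu> = UNIV"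
    using sets_eq_imp_space_eq[OF sets(1)] sets_eq_imp_space_eq[OF sets(2)] by auto
  have space2: "space (\<mu> \<Otimes>\<^sub>M \<nu>) = UNIV" by (simp add: space_pair_measure space)
  have \<rho>' [measurable]: "\<rho> \<in> borel_measurable (\<mu> \<Otimes>\<^sub>M \<nu>)"
    using \<rho> measurable_cong_sets[OF sp refl] by blast
  define \<pi> where "\<pi> = density (\<mu> \<Otimes>\<^sub>M \<nu>) \<rho>"
  have s\<pi>: "sets \<pi> = sets (borel \<Otimes>\<^sub>M borel)" by (simp add: \<pi>_def sp)
  have "fst \<in> measurable (borel \<Otimes>\<^sub>M borel) (borel :: 'a measure)"
    "snd \<in> measurable (borel \<Otimes>\<^sub>M borel) (borel :: 'a measure)" by simp_all
  then have meas: "fst \<in> measurable \<pi> borel" "snd \<in> measurable \<pi> borel"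
    unfolding measurable_cong_sets[OF s\<pi> refl] .
  have 1: "distr \<pi> borel fst = \<mu>"
  proof (rule measure_eqI)
    fix X assume "X \<in> sets (distr \<pi> borel fst)"
    then have X: "X \<in> sets borel" by simp
    then have X\<mu> [measurable]: "X \<in> sets \<mu>" using sets by simp
    have XU: "X \<times> UNIV \<in> sets (\<mu> \<Otimes>\<^sub>M \<nu>)" using X\<mu> space sets.top[of \<nu>] by (intro pair_measureI) auto
    have "emeasure (distr \<pi> borel fst) X = emeasure \<pi> (X \<times> UNIV)"
      using X meas by (subst emeasure_distr) (auto simp: \<pi>_def space2 intro!: arg_cong[where f = "emeasure _"])
    also have "\<dots> = (\<integral>\<^sup>+z. \<rho> z * indicator (X \<times> UNIV) z \<partial>(\<mu> \<Otimes>\<^sub>M \<nu>))"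
      unfolding \<pi>_def using XU by (intro emeasure_density) auto
    also have "\<dots> = (\<integral>\<^sup>+x. \<integral>\<^sup>+y. \<rho> (x, y) * indicator (X \<times> UNIV) (x, y) \<partial>\<nu> \<partial>\<mu>)"
      using XU by (intro \<nu>.nn_integral_fst[symmetric]) auto
    also have "\<dots> = (\<integral>\<^sup>+x. (\<integral>\<^sup>+y. \<rho> (x, y) \<partial>\<nu>) * indicator X x \<partial>\<mu>)"
      by (intro nn_integral_cong) (auto simp: indicator_def)
    also have "\<dots> = (\<integral>\<^sup>+x. indicator X x \<partial>\<mu>)"
      by (rule nn_integral_cong_AE, use fst in eventually_elim) simp
    also have "\<dots> = emeasure \<mu> X" using X\<mu> by simp
    finally show "emeasure (distr \<pi> borel fst) X = emeasure \<mu> X" .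
  qed (simp add: sets)
  have 2: "distr \<pi> borel snd = \<nu>"
  proof (rule measure_eqI)
    fix X assume "X \<in> sets (distr \<pi> borel snd)"
    then have X: "X \<in> sets borel" by simp
    then have X\<nu> [measurable]: "X \<in> sets \<nu>" using sets by simp
    have XU: "UNIV \<times> X \<in> sets (\<mu> \<Otimes>\<^sub>M \<nu>)" using X\<nu> space sets.top[of \<mu>] by (intro pair_measureI) auto
    have "emeasure (distr \<pi> borel snd) X = emeasure \<pi> (UNIV \<times> X)"
      using X meas by (subst emeasure_distr) (auto simp: \<pi>_def space2 intro!: arg_cong[where f = "emeasure _"])
    also have "\<dots> = (\<integral>\<^sup>+z. \<rho> z * indicator (UNIV \<times> X) z \<partial>(\<mu> \<Otimes>\<^sub>M \<nu>))"
      unfolding \<pi>_def using XU by (intro emeasure_density) auto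
    also have "\<dots> = (\<integral>\<^sup>+y. \<integral>\<^sup>+x. \<rho> (x, y) * indicator (UNIV \<times> X) (x, y) \<partial>\<mu> \<partial>\<nu>)"
      using XU by (intro nn_integral_snd[symmetric]) auto
    also have "\<dots> = (\<integral>\<^sup>+y. (\<integral>\<^sup>+x. \<rho> (x, y) \<partial>\<mu>) * indicator X y \<partial>\<nu>)"
      by (intro nn_integral_cong) (auto simp: indicator_def)
    also have "\<dots> = (\<integral>\<^sup>+y. indicator X y \<partial>\<nu>)"
      by (rule nn_integral_cong_AE, use snd in eventually_elim) simp
    also have "\<dots> = emeasure \<nu> X" using X\<nu> by simp
    finally show "emeasure (distr \<pi> borel snd) X = emeasure \<nu> X" .
  qed (simp add: sets)
  have "prob_space \<pi>"
  proof
    have "emeasure \<pi> (space \<pi>) = emeasure (distr \<pi> borel fst) UNIV"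
      using meas by (subst emeasure_distr) (auto simp: \<pi>_def space2)
    also have "\<dots> = 1" unfolding 1 using \<mu>.emeasure_space_1 space by simp
    finally show "emeasure \<pi> (space \<pi>) = 1" .
  qed
  then show ?thesis using 1 2 s\<pi> unfolding couplings_def \<pi>_def by blast
qed

text \<open>Division by \<open>b s = 0\<close> is harmless because then \<open>w s = 0\<close>.\<close>

lemma (in prob_space) plan_kernel_integral:
  fixes T :: "'a \<Rightarrow> 'b::metric_space" and w c :: "'b \<Rightarrow> real"
  assumes T: "T \<in> measurable M borel" and S: "finite S" "\<And>x. T x \<in> S"
  defines "b \<equiv> \<lambda>s. measure M {x \<in> space M. T x = s}"
  assumes w: "\<And>s. s \<in> S \<Longrightarrow> 0 \<le> w s" "\<And>s. s \<in> S \<Longrightarrow> b s = 0 \<Longrightarrow> w s = 0"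
    and c: "\<And>s. s \<in> S \<Longrightarrow> 0 \<le> c s" and a: "0 \<le> a"
  shows "(\<integral>\<^sup>+y. ennreal (c (T y) * w (T y) / (a * b (T y))) \<partial>M) = ennreal ((\<Sum>s\<in>S. c s * w s) / a)"
proof -
  have "(\<integral>\<^sup>+y. ennreal (c (T y) * w (T y) / (a * b (T y))) \<partial>M)
      = ennreal (\<Sum>s\<in>S. c s * w s / (a * b s) * b s)"
    unfolding b_def
    by (rule integral_finite_range(3)[OF T S,
          where \<phi> = "\<lambda>s. c s * w s / (a * measure M {x \<in> space M. T x = s})"]) (use w(1) c a in simp)
  also have "(\<Sum>s\<in>S. c s * w s / (a * b s) * b s) = (\<Sum>s\<in>S. c s * w s / a)"
    using w(2) by (intro sum.cong) (auto simp: field_simps)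
  finally show ?thesis by (simp add: sum_divide_distrib)
qed

lemma measurable_finite_range2:
  fixes T :: "'a::metric_space \<Rightarrow> 'b::metric_space" and F :: "'b \<Rightarrow> 'b \<Rightarrow> real"
  assumes T: "T \<in> measurable borel borel" and S: "finite S" "\<And>x. T x \<in> S"
  shows "(\<lambda>z. F (T (fst z)) (T (snd z))) \<in> borel_measurable (borel \<Otimes>\<^sub>M borel)"
proof -
  have Tf: "(\<lambda>z. T (fst z)) \<in> measurable (borel \<Otimes>\<^sub>M borel) borel"
    and Ts: "(\<lambda>z. T (snd z)) \<in> measurable (borel \<Otimes>\<^sub>M borel) borel"
    by (rule measurable_compose[OF measurable_fst T], rule measurable_compose[OF measurable_snd T])
  have level: "{z \<in> space N. h z = s} \<in> sets N" if "h \<in> measurable N borel"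
    for h :: "'a \<times> 'a \<Rightarrow> 'b" and N s
  proof -
    have "h -` {s} \<inter> space N \<in> sets N" by (rule measurable_sets[OF that]) simp
    moreover have "h -` {s} \<inter> space N = {z \<in> space N. h z = s}" by auto
    ultimately show ?thesis by simp
  qed
  have eq: "F (T x) (T y) = (\<Sum>i\<in>S. if T x = i then \<Sum>j\<in>S. if T y = j then F i j else 0 else 0)" for x y
    using S by (simp add: sum.delta' sum.delta)
  show ?thesis unfolding eq
    by (intro borel_measurable_sum measurable_If level[OF Tf] level[OF Ts]) simp_all
qed

subsection \<open>From the dual inequality to transport\<close>

text \<open>The inequality \<open>ln u \<le> u - 1\<close> is integrated against
  \<open>\<nu>\<close>, where \<open>u\<close> is the density of the measure tilted by
  \<open>exp g\<close>, relative to \<open>\<nu>\<close>.\<close>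

lemma Donsker_Varadhan:
  fixes g :: "'a \<Rightarrow> real"
  assumes "prob_space \<mu>" "prob_space \<nu>" and sets: "sets \<nu> = sets \<mu>"
    and ac: "absolutely_continuous \<mu> \<nu>"
    and int: "integrable \<nu> (entropy_density (exp 1) \<mu> \<nu>)"
    and g [measurable]: "g \<in> borel_measurable \<mu>" and B: "\<And>x. \<bar>g x\<bar> \<le> B"
  shows "(\<integral>x. g x \<partial>\<nu>) \<le> KL_divergence (exp 1) \<mu> \<nu> + ln (\<integral>x. exp (g x) \<partial>\<mu>)"
proof -
  interpret \<mu>: prob_space \<mu> by fact
  interpret \<nu>: prob_space \<nu> by fact
  define D where "D = RN_deriv \<mu> \<nu>"
  have D [measurable]: "D \<in> borel_measurable \<mu>" unfolding D_def by simp
  have \<nu>: "\<nu> = density \<mu> D" unfolding D_def using \<mu>.density_RN_deriv[OF ac sets] by simp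
  have g\<nu> [measurable]: "g \<in> borel_measurable \<nu>" using g measurable_cong_sets[OF sets refl] by blast
  have "AE x in \<mu>. D x \<noteq> \<infinity>"
    unfolding D_def by (rule \<mu>.RN_deriv_finite[OF _ ac sets]) unfold_locales
  then have fin: "AE x in \<mu>. D x < \<infinity>" by (simp add: less_top)
  have pos: "AE x in \<nu>. 0 < enn2real (D x)"
    unfolding \<nu> AE_density[OF D] using fin
    by eventually_elim (auto simp: enn2real_positive_iff less_top)
  define Z where "Z = (\<integral>x. exp (g x) \<partial>\<mu>)"
  have Z: "Z > 0" using \<mu>.exp_integral_bounds(3)[OF g B, of 1] by (simp add: Z_def)
  \<comment> \<open>Where \<open>D\<close> vanishes, division by zero gives \<open>u x = 0\<close>.
    Part of the tilted mass may be lost there, so the integral of \<open>u\<close> is only bounded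
    by 1.\<close>
  define u where "u x = exp (g x) / (enn2real (D x) * Z)" for x
  have u_meas [measurable]: "u \<in> borel_measurable \<mu>" unfolding u_def by measurable
  have u_meas' [measurable]: "u \<in> borel_measurable \<nu>" using u_meas measurable_cong_sets[OF sets refl] by blast
  have u_nonneg: "u x \<ge> 0" for x using Z by (simp add: u_def)
  have "(\<integral>\<^sup>+x. ennreal (u x) \<partial>\<nu>) = (\<integral>\<^sup>+x. D x * ennreal (u x) \<partial>\<mu>)"
    unfolding \<nu> by (rule nn_integral_density) measurable
  also have "\<dots> \<le> (\<integral>\<^sup>+x. ennreal (exp (g x) / Z) \<partial>\<mu>)"
  proof (rule nn_integral_mono_AE)
    show "AE x in \<mu>. D x * ennreal (u x) \<le> ennreal (exp (g x) / Z)"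
      using fin
    proof eventually_elim
      fix x assume "D x < \<infinity>"
      then have "D x * ennreal (u x) = ennreal (enn2real (D x) * u x)"
        using u_nonneg[of x] by (simp add: ennreal_mult less_top)
      also have "\<dots> \<le> ennreal (exp (g x) / Z)" using Z
        by (intro ennreal_leI) (simp add: u_def)
      finally show "D x * ennreal (u x) \<le> ennreal (exp (g x) / Z)" .
    qed
  qed
  also have "\<dots> = ennreal (\<integral>x. exp (g x) / Z \<partial>\<mu>)"
    using \<mu>.exp_integrable(1)[OF g B, of 1] Z by (intro nn_integral_eq_integral) auto
  also have "(\<integral>x. exp (g x) / Z \<partial>\<mu>) = 1" using Z by (simp add: Z_def)
  finally have u1: "(\<integral>\<^sup>+x. ennreal (u x) \<partial>\<nu>) \<le> 1" by simp
  have u_int: "integrable \<nu> u"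
    using u_nonneg u1 by (intro integrableI_nonneg) (auto simp: le_less_trans)
  have "ennreal (\<integral>x. u x \<partial>\<nu>) \<le> 1"
    using u1 nn_integral_eq_integral[OF u_int] u_nonneg by simp
  then have u_le: "(\<integral>x. u x \<partial>\<nu>) \<le> 1"
    using u_nonneg by (metis ennreal_1 ennreal_le_iff zero_le_one)
  have g_int: "integrable \<nu> g" using \<nu>.integrable_bounded[OF g\<nu> B] .
  have ed: "entropy_density (exp 1) \<mu> \<nu> x = ln (enn2real (D x))" for x
    by (simp add: entropy_density_def D_def log_ln)
  have "(\<integral>x. g x - entropy_density (exp 1) \<mu> \<nu> x - ln Z \<partial>\<nu>) \<le> (\<integral>x. u x - 1 \<partial>\<nu>)"
  proof (rule integral_mono_AE)
    show "AE x in \<nu>. g x - entropy_density (exp 1) \<mu> \<nu> x - ln Z \<le> u x - 1"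
      using pos
    proof eventually_elim
      fix x assume d: "0 < enn2real (D x)"
      have "g x - ln (enn2real (D x)) - ln Z = ln (u x)"
        using d Z by (simp add: u_def ln_div ln_mult)
      also have "\<dots> \<le> u x - 1" using d Z by (intro ln_le_minus_one) (simp add: u_def)
      finally show "g x - entropy_density (exp 1) \<mu> \<nu> x - ln Z \<le> u x - 1" by (simp add: ed)
    qed
  qed (use g_int int u_int in auto)
  then show ?thesis
    using g_int int u_int u_le by (simp add: KL_divergence_def Z_def[symmetric] \<nu>.prob_space)
qed

text \<open>The semigroup is hidden: \<open>g\<close> stands for any bounded measurable function
  below the Hopf-Lax infimum of \<open>f\<close> at time 1. This leaves room for convenient lower
  bounds in place of the infimum itself.\<close>

locale dual_transport = power_cost \<alpha> \<alpha>' r p for \<alpha> \<alpha>' r p +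
  fixes \<mu> :: "'a::polish_space measure" and A :: real
  assumes proper: "compact (cball (x::'a) \<rho>)"
    and prob: "prob_space \<mu>" and sets_\<mu>: "sets \<mu> = sets borel"
    and A_pos: "A > 0"
    and exp_dual: "lsc f \<Longrightarrow> (\<And>x. \<bar>f x\<bar> \<le> M) \<Longrightarrow> g \<in> borel_measurable borel \<Longrightarrow> (\<And>x. \<bar>g x\<bar> \<le> M)
       \<Longrightarrow> (\<And>z y. g z \<le> f y + \<alpha> (dist z y)) \<Longrightarrow> (\<integral>x. exp (g x / A) \<partial>\<mu>) \<le> exp ((\<integral>x. f x \<partial>\<mu>) / A)"

lemma (in power_cost) LSI_imp_dual_transport:
  fixes \<mu> :: "'a::polish_space measure"
  assumes proper: "\<And>(x::'a) \<rho>. compact (cball x \<rho>)"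
    and \<mu>: "prob_space \<mu>" "sets \<mu> = sets borel" and C: "C > 0" and LSI: "LSI_minus \<alpha> C \<mu>"
  shows "dual_transport \<alpha> \<alpha>' r p \<mu> (max (((p - 1) * C) powr (r - 1)) (((p - 1) * C) powr (p - 1)))"
    (is "dual_transport _ _ _ _ _ ?A")
proof (intro dual_transport.intro power_cost_axioms dual_transport_axioms.intro)
  have t0: "(p - 1) * C > 0" using p_gt_1 C by simp
  then show A: "?A > 0" using p_gt_1 C by (simp add: less_max_iff_disj)
  fix f g :: "'a \<Rightarrow> real" and M
  assume f: "lsc f" "\<And>x. \<bar>f x\<bar> \<le> M" and g: "g \<in> borel_measurable borel" "\<And>x. \<bar>g x\<bar> \<le> M"
    and gf: "\<And>z y. g z \<le> f y + \<alpha> (dist z y)"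
  interpret H: hopf_lax_LSI \<alpha> \<alpha>' r p f M \<mu> C
    by (intro hopf_lax_LSI.intro hopf_lax.intro hopf_lax_axioms.intro hopf_lax_LSI_axioms.intro
        power_cost_axioms proper f \<mu> C LSI)
  interpret prob_space \<mu> by fact
  have gm: "g \<in> borel_measurable \<mu>" using g measurable_cong_sets[OF \<mu>(2) refl] by blast
  have "(\<integral>x. exp (1 / ?A * g x) \<partial>\<mu>) \<le> (\<integral>x. exp (1 / ?A * H.Q 1 x) \<partial>\<mu>)"
  proof (rule integral_mono)
    show "exp (1 / ?A * g x) \<le> exp (1 / ?A * H.Q 1 x)" for x
      using H.Q_greatest[of "g x" 1 x] gf A by (simp add: divide_right_mono del: max_less_iff_conj)
  qed (rule exp_integrable(1)[OF gm g(2)] exp_integrable(1)[OF H.Q_measurable H.Q_bound] zero_less_one)+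
  also have "\<dots> \<le> exp ((\<integral>x. f x \<partial>\<mu>) / ?A)" using H.exp_Q_le by (simp add: H.t0_def)
  finally show "(\<integral>x. exp (g x / ?A) \<partial>\<mu>) \<le> exp ((\<integral>x. f x \<partial>\<mu>) / ?A)" by simp
qed (rule proper \<mu>)+

context dual_transport begin

interpretation prob_space \<mu> by (rule prob)

declare sets_\<mu> [measurable_cong]

lemma measurable_\<mu>: "g \<in> measurable borel N \<Longrightarrow> g \<in> measurable \<mu> N"
  by (simp add: measurable_cong_sets[OF sets_\<mu> refl])

lemma space_\<mu> [simp]: "space \<mu> = UNIV"
  using sets_eq_imp_space_eq[OF sets_\<mu>] by simp

lemma cost_continuous [continuous_intros]:
  "continuous_on X u \<Longrightarrow> continuous_on X v \<Longrightarrow> continuous_on X (\<lambda>x. \<alpha> (dist (u x) (v x)))"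
  by (rule continuous_on_compose2[OF cont continuous_on_dist]) auto

lemma dual_bound:
  assumes "prob_space \<nu>" and sets: "sets \<nu> = sets borel" and ac: "absolutely_continuous \<mu> \<nu>"
    and int: "integrable \<nu> (entropy_density (exp 1) \<mu> \<nu>)"
    and f: "lsc f" "\<And>x. \<bar>f x\<bar> \<le> B" and g: "g \<in> borel_measurable borel" "\<And>x. \<bar>g x\<bar> \<le> B"
    and gf: "\<And>z y. g z \<le> f y + \<alpha> (dist z y)"
  shows "(\<integral>x. g x \<partial>\<nu>) \<le> A * KL_divergence (exp 1) \<mu> \<nu> + (\<integral>x. f x \<partial>\<mu>)"
proof -
  have "(\<integral>x. g x / A \<partial>\<nu>) \<le> KL_divergence (exp 1) \<mu> \<nu> + ln (\<integral>x. exp (g x / A) \<partial>\<mu>)"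
    using g A_pos sets sets_\<mu>
    by (intro Donsker_Varadhan[where B = "B / A"] assms(1) prob ac int)
      (auto simp: divide_right_mono intro: measurable_\<mu>)
  also have "ln (\<integral>x. exp (g x / A) \<partial>\<mu>) \<le> ln (exp ((\<integral>x. f x \<partial>\<mu>) / A))"
  proof (subst ln_le_cancel_iff)
    show "(\<integral>x. exp (g x / A) \<partial>\<mu>) > 0"
      using exp_integral_bounds(3)[OF measurable_\<mu>[OF g(1)] g(2), of "1 / A"] A_pos by simp
  qed (use exp_dual[OF f g gf] in auto)
  finally have "(\<integral>x. g x \<partial>\<nu>) / A \<le> KL_divergence (exp 1) \<mu> \<nu> + (\<integral>x. f x \<partial>\<mu>) / A" by simp
  then show ?thesis using A_pos by (simp add: field_simps)
qed

section \<open>Exponential moments of the transport cost\<close>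

definition excess :: "'a \<Rightarrow> real \<Rightarrow> 'a \<Rightarrow> real" where
  "excess x0 R x = \<alpha> (max 0 (dist x x0 - R))"

lemma excess_borel [measurable]: "excess x0 R \<in> borel_measurable borel"
proof -
  have "continuous_on UNIV (\<lambda>x. max 0 (dist x x0 - R))" by (intro continuous_intros)
  then have "continuous_on UNIV (\<lambda>x. \<alpha> (max 0 (dist x x0 - R)))"
    by (rule continuous_on_compose2[OF cont]) auto
  then show ?thesis unfolding excess_def by (rule borel_measurable_continuous_onI)
qed

lemma excess_nonneg: "excess x0 R x \<ge> 0" unfolding excess_def by (rule nonneg) simp

lemma half_mass_ball: obtains R where "R \<ge> 0" "measure \<mu> (cball x0 R) \<ge> 1 / 2"
proof -
  have "(\<lambda>n. measure \<mu> (cball x0 (real n))) \<longlonglongrightarrow> measure \<mu> (\<Union>n. cball x0 (real n))"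
  proof (rule finite_Lim_measure_incseq)
    show "range (\<lambda>n. cball x0 (real n)) \<subseteq> events" unfolding sets_\<mu> by auto
    show "incseq (\<lambda>n. cball x0 (real n))" by (intro incseq_SucI subset_cball) simp
  qed
  moreover have "(\<Union>n. cball x0 (real n)) = space \<mu>"
  proof -
    have "\<exists>n. x \<in> cball x0 (real n)" for x using real_arch_simple[of "dist x0 x"] by simp
    then show ?thesis by auto
  qed
  ultimately have "(\<lambda>n. measure \<mu> (cball x0 (real n))) \<longlonglongrightarrow> 1" using prob_space by simp
  then have "eventually (\<lambda>n. measure \<mu> (cball x0 (real n)) > 1 / 2) sequentially"
    by (rule order_tendstoD(1)) simp
  then obtain n where "measure \<mu> (cball x0 (real n)) > 1 / 2"
    unfolding eventually_sequentially by blast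
  then show ?thesis using that[of "real n"] by simp
qed

text \<open>Test the dual inequality with \<open>N\<close> times the indicator of the complement of a ball of mass
  at least one half, and apply Markov's inequality.\<close>

lemma excess_tail:
  assumes R: "R \<ge> 0" "measure \<mu> (cball x0 R) \<ge> 1 / 2" and N: "N > 0"
  shows "measure \<mu> {x. N \<le> excess x0 R x} \<le> exp (- N / (2 * A))"
proof -
  define f where "f x = (if x \<in> cball x0 R then 0 else N)" for x
  define g where "g x = min N (excess x0 R x)" for x
  have gm [measurable]: "g \<in> borel_measurable borel" unfolding g_def by measurable
  have lsc: "lsc f" unfolding lsc_def
  proof (intro allI impI)
    fix x c assume c: "c < f x"
    show "eventually (\<lambda>y. c < f y) (nhds x)"
    proof (cases "x \<in> cball x0 R")
      case True
      then have "c < f y" for y using c N by (simp add: f_def)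
      then show ?thesis by simp
    next
      case False
      then have "c < N" using c by (simp add: f_def)
      have "eventually (\<lambda>y. y \<in> - cball x0 R) (nhds x)"
        using False by (intro eventually_nhds_in_open) auto
      then show ?thesis by (rule eventually_mono) (use \<open>c < N\<close> in \<open>simp add: f_def\<close>)
    qed
  qed
  have fb: "\<bar>f x\<bar> \<le> N" and gb: "\<bar>g x\<bar> \<le> N" for x
    using N excess_nonneg[of x0 R x] by (auto simp: f_def g_def)
  \<comment> \<open>Reaching a point \<open>y\<close> of the ball from \<open>z\<close> costs at
    least \<open>excess x0 R z\<close>; outside the ball \<open>f y = N\<close> already dominates
    \<open>g z\<close>.\<close>
  have "g z \<le> f y + \<alpha> (dist z y)" for z y
  proof (cases "y \<in> cball x0 R")
    case True
    then have "dist z x0 - R \<le> dist z y"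
      using dist_triangle[of z x0 y] by (simp add: dist_commute)
    then have "excess x0 R z \<le> \<alpha> (dist z y)" unfolding excess_def by (intro mono) auto
    then show ?thesis using True by (simp add: f_def g_def)
  next
    case False
    then show ?thesis using nonneg[of "dist z y"] by (simp add: f_def g_def)
  qed
  then have "(\<integral>x. exp (g x / A) \<partial>\<mu>) \<le> exp ((\<integral>x. f x \<partial>\<mu>) / A)"
    using lsc fb gb by (intro exp_dual[where M = N]) auto
  also have "(\<integral>x. f x \<partial>\<mu>) = N * (1 - measure \<mu> (cball x0 R))"
  proof -
    have "f = (\<lambda>x. N * indicator (- cball x0 R) x)" by (auto simp: f_def)
    then show ?thesis using sets_\<mu> prob_compl[of "cball x0 R"] by (simp add: Compl_eq_Diff_UNIV)
  qed
  \<comment> \<open>Half of the mass in the ball halves the exponent, so dividing by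
    \<open>exp (N / A)\<close> in Markov's inequality leaves decay of rate
    \<open>1 / (2 * A)\<close>.\<close>
  also have "exp (N * (1 - measure \<mu> (cball x0 R)) / A) \<le> exp (N / (2 * A))"
  proof -
    have "N * (1 - measure \<mu> (cball x0 R)) \<le> N * (1 / 2)"
      using N R by (intro mult_left_mono) auto
    then show ?thesis using A_pos by (simp add: field_simps)
  qed
  finally have 1: "(\<integral>x. exp (g x / A) \<partial>\<mu>) \<le> exp (N / (2 * A))" .
  have set: "{x. N \<le> excess x0 R x} \<in> sets \<mu>" unfolding sets_\<mu> by measurable
  have "exp (N / A) * measure \<mu> {x. N \<le> excess x0 R x}
      = (\<integral>x. exp (N / A) * indicator {x. N \<le> excess x0 R x} x \<partial>\<mu>)"
    using set by simp
  also have "\<dots> \<le> (\<integral>x. exp (g x / A) \<partial>\<mu>)"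
  proof (rule integral_mono)
    show "integrable \<mu> (\<lambda>x. exp (g x / A))"
      using exp_integrable(1)[OF measurable_\<mu>[OF gm] gb, of "1 / A"] by simp
    show "exp (N / A) * indicator {x. N \<le> excess x0 R x} x \<le> exp (g x / A)" for x
      by (auto simp: indicator_def g_def min_def)
    show "integrable \<mu> (\<lambda>x. exp (N / A) * indicator {x. N \<le> excess x0 R x} x)"
      using set by (intro integrable_mult_right integrable_real_indicator) (auto simp: less_top[symmetric])
  qed
  finally have "exp (N / A) * measure \<mu> {x. N \<le> excess x0 R x} \<le> exp (N / (2 * A))" using 1 by linarith
  then have "measure \<mu> {x. N \<le> excess x0 R x} \<le> exp (N / (2 * A)) / exp (N / A)" by (simp add: field_simps)
  also have "\<dots> = exp (- N / (2 * A))" using A_pos by (simp add: exp_diff[symmetric] field_simps)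
  finally show ?thesis .
qed

text \<open>The rate \<open>1 / (4 * A)\<close> is half the tail rate, so summing over integer
  levels of the excess gives a geometric series with ratio \<open>exp (- \<theta>)\<close>.\<close>

lemma excess_exp_moment:
  assumes R: "R \<ge> 0" "measure \<mu> (cball x0 R) \<ge> 1 / 2"
  shows "(\<integral>\<^sup>+x. ennreal (exp (excess x0 R x / (4 * A))) \<partial>\<mu>) < \<infinity>"
proof -
  define \<theta> where "\<theta> = 1 / (4 * A)"
  have \<theta>: "\<theta> > 0" using A_pos by (simp add: \<theta>_def)
  have set: "{x. real n \<le> excess x0 R x} \<in> sets \<mu>" for n unfolding sets_\<mu> by measurable
  have tail: "measure \<mu> {x. real n \<le> excess x0 R x} \<le> exp (- (2 * \<theta>) * real n)" for n
    using excess_tail[OF R, of "real n"] by (cases "n = 0") (auto simp: \<theta>_def)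
  have "(\<integral>\<^sup>+x. ennreal (exp (\<theta> * excess x0 R x)) \<partial>\<mu>)
      \<le> (\<integral>\<^sup>+x. (\<Sum>n. ennreal (exp (\<theta> * (real n + 1))) * indicator {x. real n \<le> excess x0 R x} x) \<partial>\<mu>)"
  proof (rule nn_integral_mono)
    fix x
    define n where "n = nat \<lfloor>excess x0 R x\<rfloor>"
    have n: "real n \<le> excess x0 R x" "excess x0 R x \<le> real n + 1"
      using excess_nonneg[of x0 R x] by (auto simp: n_def)
    have "ennreal (exp (\<theta> * excess x0 R x)) \<le> ennreal (exp (\<theta> * (real n + 1)))"
      using n \<theta> by (intro ennreal_leI) simp
    also have "\<dots> = (\<Sum>n\<in>{n}. ennreal (exp (\<theta> * (real n + 1))) * indicator {x. real n \<le> excess x0 R x} x)"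
      using n by simp
    also have "\<dots> \<le> (\<Sum>n. ennreal (exp (\<theta> * (real n + 1))) * indicator {x. real n \<le> excess x0 R x} x)"
      by (intro sum_le_suminf) auto
    finally show "ennreal (exp (\<theta> * excess x0 R x)) \<le> \<dots>" .
  qed
  also have "\<dots> = (\<Sum>n. \<integral>\<^sup>+x. ennreal (exp (\<theta> * (real n + 1))) * indicator {x. real n \<le> excess x0 R x} x \<partial>\<mu>)"
    by (rule nn_integral_suminf) measurable
  also have "\<dots> = (\<Sum>n. ennreal (exp (\<theta> * (real n + 1)) * measure \<mu> {x. real n \<le> excess x0 R x}))"
  proof (rule suminf_cong)
    fix n
    show "(\<integral>\<^sup>+x. ennreal (exp (\<theta> * (real n + 1))) * indicator {x. real n \<le> excess x0 R x} x \<partial>\<mu>)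
        = ennreal (exp (\<theta> * (real n + 1)) * measure \<mu> {x. real n \<le> excess x0 R x})"
      unfolding nn_integral_cmult_indicator[OF set] emeasure_eq_measure by (simp only: ennreal_mult'' measure_nonneg)
  qed
  also have "\<dots> \<le> (\<Sum>n. ennreal (exp \<theta> * exp (- \<theta>) ^ n))"
  proof (intro suminf_le ennreal_leI)
    fix n
    have "exp (\<theta> * (real n + 1)) * measure \<mu> {x. real n \<le> excess x0 R x}
        \<le> exp (\<theta> * (real n + 1)) * exp (- (2 * \<theta>) * real n)"
      using tail by (intro mult_left_mono) auto
    also have "\<dots> = exp \<theta> * exp (- \<theta>) ^ n"
    proof -
      have "\<theta> * (real n + 1) + - (2 * \<theta>) * real n = \<theta> + real n * (- \<theta>)" by (simp add: algebra_simps)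
      then show ?thesis by (simp only: mult_exp_exp exp_of_nat_mult[symmetric])
    qed
    finally show "exp (\<theta> * (real n + 1)) * measure \<mu> {x. real n \<le> excess x0 R x} \<le> exp \<theta> * exp (- \<theta>) ^ n" .
  qed auto
  also have "\<dots> < \<infinity>"
  proof -
    have "summable (\<lambda>n. exp \<theta> * exp (- \<theta>) ^ n)"
      using \<theta> by (intro summable_mult summable_geometric) simp
    then have "(\<Sum>n. ennreal (exp \<theta> * exp (- \<theta>) ^ n)) = ennreal (\<Sum>n. exp \<theta> * exp (- \<theta>) ^ n)"
      by (intro suminf_ennreal2) auto
    then show ?thesis by simp
  qed
  finally show ?thesis by (simp add: \<theta>_def)
qed

text \<open>Finite entropy transfers integrability of the excess from \<open>\<mu>\<close> to
  \<open>\<nu>\<close> through its exponential moment. The quasi-triangle inequality then passes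
  from the excess to the cost from \<open>x0\<close>.\<close>

lemma cost_moment_\<mu>: "integrable \<mu> (\<lambda>x. \<alpha> (dist x x0))"
  and cost_moment:
    "prob_space \<nu> \<Longrightarrow> sets \<nu> = sets borel \<Longrightarrow> absolutely_continuous \<mu> \<nu> \<Longrightarrow>
     integrable \<nu> (entropy_density (exp 1) \<mu> \<nu>) \<Longrightarrow> integrable \<nu> (\<lambda>x. \<alpha> (dist x x0))"
proof -
  obtain R where R: "R \<ge> 0" "measure \<mu> (cball x0 R) \<ge> 1 / 2" using half_mass_ball by blast
  define \<theta> where "\<theta> = 1 / (4 * A)"
  have \<theta>: "\<theta> > 0" using A_pos by (simp add: \<theta>_def)
  let ?Y = "excess x0 R"
  have Y0: "?Y x \<ge> 0" for x by (rule excess_nonneg)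
  have fin: "(\<integral>\<^sup>+x. ennreal (exp (\<theta> * ?Y x)) \<partial>\<mu>) < \<infinity>"
    using excess_exp_moment[OF R] by (simp add: \<theta>_def)
  have Eint: "integrable \<mu> (\<lambda>x. exp (\<theta> * ?Y x))"
    by (rule integrableI_nonneg) (use fin in auto)
  have from_excess: "integrable \<nu> (\<lambda>x. \<alpha> (dist x x0))"
    if \<nu>: "prob_space \<nu>" "sets \<nu> = sets borel" and Y: "integrable \<nu> ?Y" for \<nu>
  proof -
    interpret \<nu>: prob_space \<nu> by fact
    have "integrable \<nu> (\<lambda>x. 2 powr p * (?Y x + \<alpha> R))" using Y by simp
    then show ?thesis
    proof (rule Bochner_Integration.integrable_bound)
      have "(\<lambda>x. \<alpha> (dist x x0)) \<in> borel_measurable borel"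
        by (intro borel_measurable_continuous_onI continuous_intros)
      then show "(\<lambda>x. \<alpha> (dist x x0)) \<in> borel_measurable \<nu>"
        using measurable_cong_sets[OF \<nu>(2) refl] by blast
      have "\<alpha> (dist x x0) \<le> 2 powr p * (?Y x + \<alpha> R)" for x
        unfolding excess_def using R by (intro quasi_triangle) auto
      then show "AE x in \<nu>. norm (\<alpha> (dist x x0)) \<le> norm (2 powr p * (?Y x + \<alpha> R))"
        using nonneg Y0 R by (auto intro!: AE_I2 simp: abs_of_nonneg)
    qed
  qed
  have "integrable \<mu> (\<lambda>x. exp (\<theta> * ?Y x) / \<theta>)" using Eint by simp
  then have "integrable \<mu> ?Y"
  proof (rule Bochner_Integration.integrable_bound)
    have "\<theta> * ?Y x \<le> exp (\<theta> * ?Y x)" for x using exp_ge_add_one_self[of "\<theta> * ?Y x"] by linarith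
    then show "AE x in \<mu>. norm (?Y x) \<le> norm (exp (\<theta> * ?Y x) / \<theta>)"
      using Y0 \<theta> by (intro AE_I2) (auto simp: field_simps)
  qed measurable
  then show "integrable \<mu> (\<lambda>x. \<alpha> (dist x x0))" using from_excess prob sets_\<mu> by blast
  assume \<nu>: "prob_space \<nu>" "sets \<nu> = sets borel" and ac: "absolutely_continuous \<mu> \<nu>"
    and ent: "integrable \<nu> (entropy_density (exp 1) \<mu> \<nu>)"
  interpret \<nu>: prob_space \<nu> by fact
  note \<nu>(2) [measurable_cong]
  have meas: "?Y \<in> borel_measurable \<nu>" using excess_borel measurable_cong_sets[OF \<nu>(2) refl] by blast
  define K where "K = (KL_divergence (exp 1) \<mu> \<nu> + ln (\<integral>x. exp (\<theta> * ?Y x) \<partial>\<mu>)) / \<theta>"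
  \<comment> \<open>The entropy inequality takes bounded functions. The bound \<open>K\<close> is
    uniform in the truncation because it contains the exponential moment of the untruncated
    excess.\<close>
  have trunc: "(\<integral>\<^sup>+x. ennreal (min (real n) (?Y x)) \<partial>\<nu>) \<le> ennreal K" for n
  proof -
    let ?g = "\<lambda>x. min (real n) (?Y x)"
    have gm: "?g \<in> borel_measurable \<mu>" by measurable
    have gb: "\<bar>?g x\<bar> \<le> real n" for x using Y0[of x] by simp
    have "(\<integral>x. \<theta> * ?g x \<partial>\<nu>) \<le> KL_divergence (exp 1) \<mu> \<nu> + ln (\<integral>x. exp (\<theta> * ?g x) \<partial>\<mu>)"
      using gb \<theta> \<nu>(2) sets_\<mu> gm
      by (intro Donsker_Varadhan[where B = "\<theta> * real n"] \<nu>(1) prob ac ent) (auto simp: abs_mult)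
    also have "ln (\<integral>x. exp (\<theta> * ?g x) \<partial>\<mu>) \<le> ln (\<integral>x. exp (\<theta> * ?Y x) \<partial>\<mu>)"
    proof -
      have "(\<integral>x. exp (\<theta> * ?g x) \<partial>\<mu>) \<le> (\<integral>x. exp (\<theta> * ?Y x) \<partial>\<mu>)"
        using exp_integrable(1)[OF gm gb] Eint \<theta> by (intro integral_mono) auto
      moreover have "(\<integral>x. exp (\<theta> * ?g x) \<partial>\<mu>) > 0"
        using exp_integral_bounds(3)[OF gm gb] \<theta> by simp
      ultimately show ?thesis by (subst ln_le_cancel_iff) auto
    qed
    finally have "\<theta> * (\<integral>x. ?g x \<partial>\<nu>) \<le> \<theta> * K" using \<theta> by (simp add: K_def)
    then have "(\<integral>x. ?g x \<partial>\<nu>) \<le> K" using \<theta> by simp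
    moreover have "integrable \<nu> ?g" using meas gb by (intro \<nu>.integrable_bounded) auto
    ultimately show ?thesis using Y0 by (subst nn_integral_eq_integral) (auto intro: ennreal_leI)
  qed
  have "ennreal (?Y x) = liminf (\<lambda>n. ennreal (min (real n) (?Y x)))" for x
  proof -
    obtain N where N: "?Y x \<le> real N" using real_arch_simple by blast
    have "eventually (\<lambda>n. min (real n) (?Y x) = ?Y x) sequentially"
      using eventually_ge_at_top[of N] by (rule eventually_mono) (use N in auto)
    then have "(\<lambda>n. min (real n) (?Y x)) \<longlonglongrightarrow> ?Y x" by (rule tendsto_eventually)
    then show ?thesis by (intro lim_imp_Liminf[symmetric] tendsto_ennrealI) auto
  qed
  then have "(\<integral>\<^sup>+x. ennreal (?Y x) \<partial>\<nu>) = (\<integral>\<^sup>+x. liminf (\<lambda>n. ennreal (min (real n) (?Y x))) \<partial>\<nu>)" by simp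
  also have "\<dots> \<le> liminf (\<lambda>n. \<integral>\<^sup>+x. ennreal (min (real n) (?Y x)) \<partial>\<nu>)"
    by (rule nn_integral_liminf) measurable
  also have "\<dots> \<le> ennreal K"
    using Liminf_mono[of "\<lambda>n. \<integral>\<^sup>+x. ennreal (min (real n) (?Y x)) \<partial>\<nu>" "\<lambda>_. ennreal K" sequentially] trunc
    by (simp add: Liminf_const)
  finally have "integrable \<nu> ?Y"
    using meas Y0 by (intro integrableI_nonneg) (auto simp: le_less_trans)
  then show "integrable \<nu> (\<lambda>x. \<alpha> (dist x x0))" using from_excess \<nu> by blast
qed

text \<open>Outside the ball, where \<open>T\<close> is constant, the quasi-triangle inequality absorbs the cost into the
  error terms. That the error separates into functions of \<open>x\<close> and \<open>y\<close> is what lets it be integrated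
  against every coupling.\<close>

lemma quantized_cost:
  fixes x0 :: 'a
  assumes "\<eta> > 0" "R \<ge> 0"
  obtains T :: "'a \<Rightarrow> 'a" and S where "T \<in> measurable borel borel" "finite S" "\<And>x. T x \<in> S"
    "\<And>x y. \<bar>\<alpha> (dist x y) - \<alpha> (dist (T x) (T y))\<bar> \<le> \<eta>
       + 2 * 2 powr p * (\<alpha> (dist x x0) * indicator (- cball x0 R) x)
       + 2 * 2 powr p * (\<alpha> (dist y x0) * indicator (- cball x0 R) y)"
proof -
  define L where "L = \<alpha>' (2 * R) + 1"
  have L: "L > 0" using deriv_nonneg[of "2 * R"] assms by (simp add: L_def)
  \<comment> \<open>Moving both points by less than \<open>\<delta>\<close> changes their distance
    by at most \<open>2 * \<delta>\<close>, and \<open>\<alpha>\<close> has slope at most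
    \<open>L\<close> up to the diameter bound \<open>2 * R\<close>.\<close>
  define \<delta> where "\<delta> = \<eta> / (2 * L)"
  have \<delta>: "\<delta> > 0" using assms L by (simp add: \<delta>_def)
  have x0: "x0 \<in> cball x0 R" using assms by simp
  obtain T S where T: "T \<in> measurable borel borel" "finite S" "S \<subseteq> cball x0 R" "\<And>x. T x \<in> S"
    "\<And>x. x \<in> cball x0 R \<Longrightarrow> dist x (T x) < \<delta>" "\<And>x. x \<notin> cball x0 R \<Longrightarrow> T x = x0"
    using quantization[OF proper[of x0 R] x0 \<delta>] by blast
  have T_in: "dist (T x) x0 \<le> R" for x using T(3) T(4)[of x] by (auto simp: dist_commute)
  define E where "E = 2 powr p"
  have E: "E \<ge> 1" using p_gt_1 by (simp add: E_def ge_one_powr_ge_zero)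
  define e where "e x = 2 * E * (\<alpha> (dist x x0) * indicator (- cball x0 R) x)" for x
  have e0: "e x \<ge> 0" for x using E nonneg by (simp add: e_def)
  have tri: "\<alpha> (dist x y) \<le> E * (\<alpha> (dist x x0) + \<alpha> (dist y x0))" for x y
    unfolding E_def using dist_triangle[of x y x0]
    by (intro quasi_triangle) (simp_all add: dist_commute)
  have mixed: "\<bar>\<alpha> (dist x y) - \<alpha> (dist (T x) (T y))\<bar> \<le> e x"
    if x: "x \<notin> cball x0 R" and y: "y \<in> cball x0 R" for x y
  proof -
    have "\<alpha> (dist y x0) \<le> \<alpha> (dist x x0)" using x y by (intro mono) (auto simp: dist_commute)
    then have "E * (\<alpha> (dist x x0) + \<alpha> (dist y x0)) \<le> E * (2 * \<alpha> (dist x x0))"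
      using E by (intro mult_left_mono) auto
    then have 1: "\<alpha> (dist x y) \<le> e x" using tri[of x y] x by (simp add: e_def)
    have "\<alpha> (dist (T x) (T y)) \<le> \<alpha> (dist x x0)"
      using T(6)[OF x] T_in[of y] x by (intro mono) (auto simp: dist_commute)
    also have "\<alpha> (dist x x0) \<le> 2 * E * \<alpha> (dist x x0)"
      using E nonneg[of "dist x x0"] mult_right_mono[of 1 "2 * E" "\<alpha> (dist x x0)"] by simp
    also have "\<dots> = e x" using x by (simp add: e_def)
    finally show ?thesis using 1 nonneg[of "dist x y"] nonneg[of "dist (T x) (T y)"] by simp
  qed
  have main: "\<bar>\<alpha> (dist x y) - \<alpha> (dist (T x) (T y))\<bar> \<le> \<eta> + e x + e y" for x y
  proof (cases "x \<in> cball x0 R"; cases "y \<in> cball x0 R")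
    assume xy: "x \<in> cball x0 R" "y \<in> cball x0 R"
    have "\<bar>dist x y - dist (T x) (T y)\<bar> \<le> 2 * \<delta>"
      using T(5)[OF xy(1)] T(5)[OF xy(2)]
        dist_triangle[of x y "T x"] dist_triangle[of "T x" y "T y"]
        dist_triangle[of "T x" "T y" x] dist_triangle[of x "T y" y]
        dist_commute[of "T x" x] dist_commute[of "T y" y] by linarith
    then have "\<alpha>' (2 * R) * \<bar>dist x y - dist (T x) (T y)\<bar> \<le> L * (2 * \<delta>)"
      using deriv_nonneg[of "2 * R"] assms by (intro mult_mono) (auto simp: L_def)
    also have "\<dots> = \<eta>" using L by (simp add: \<delta>_def)
    finally have 2: "\<alpha>' (2 * R) * \<bar>dist x y - dist (T x) (T y)\<bar> \<le> \<eta>" .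
    have "dist x y \<le> 2 * R" using xy dist_triangle[of x y x0] by (simp add: dist_commute)
    moreover have "dist (T x) (T y) \<le> 2 * R"
      using T_in[of x] T_in[of y] dist_triangle[of "T x" "T y" x0] by (simp add: dist_commute)
    ultimately have "\<bar>\<alpha> (dist x y) - \<alpha> (dist (T x) (T y))\<bar> \<le> \<alpha>' (2 * R) * \<bar>dist x y - dist (T x) (T y)\<bar>"
      by (intro abs_diff_le) auto
    then show ?thesis using 2 e0[of x] e0[of y] by linarith
  next
    assume "x \<in> cball x0 R" "y \<notin> cball x0 R"
    then show ?thesis using mixed[of y x] e0[of x] assms(1) by (simp add: dist_commute)
  next
    assume "x \<notin> cball x0 R" "y \<in> cball x0 R"
    then show ?thesis using mixed[of x y] e0[of y] assms(1) by simp
  next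
    assume xy: "x \<notin> cball x0 R" "y \<notin> cball x0 R"
    have "E * (\<alpha> (dist x x0) + \<alpha> (dist y x0)) \<le> e x + e y"
      using xy E nonneg[of "dist x x0"] nonneg[of "dist y x0"] by (simp add: e_def algebra_simps)
    then show ?thesis
      using tri[of x y] nonneg[of "dist x y"] T(6)[OF xy(1)] T(6)[OF xy(2)] zero assms(1) by simp
  qed
  show ?thesis
    by (rule that[OF T(1,2,4)]) (use main in \<open>simp add: e_def E_def\<close>)
qed

text \<open>Potentials on the finite set must become bounded functions on the whole space that
  satisfy the dual constraint exactly. The error terms are subtracted from the second potential, and
  the first is then rebuilt as a supremum.\<close>

lemma finite_dual_bound:
  fixes T :: "'a \<Rightarrow> 'a"
  assumes \<nu>: "prob_space \<nu>" "sets \<nu> = sets borel" and ac: "absolutely_continuous \<mu> \<nu>"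
    and ent: "integrable \<nu> (entropy_density (exp 1) \<mu> \<nu>)"
    and T: "T \<in> measurable borel borel" and S: "finite S" "\<And>x. T x \<in> S"
    and e: "e \<in> borel_measurable borel" "\<And>x. 0 \<le> e x" "integrable \<mu> e" "integrable \<nu> e"
    and TT: "\<And>x y. \<alpha> (dist (T x) (T y)) \<le> \<alpha> (dist x y) + \<eta> + e x + e y"
    and fg: "\<And>i j. i \<in> S \<Longrightarrow> j \<in> S \<Longrightarrow> g j - f i \<le> \<alpha> (dist i j)"
  shows "(\<Sum>j\<in>S. g j * measure \<nu> {x. T x = j}) - (\<Sum>i\<in>S. f i * measure \<mu> {x. T x = i})
     \<le> A * KL_divergence (exp 1) \<mu> \<nu> + \<eta> + (\<integral>x. e x \<partial>\<mu>) + (\<integral>x. e x \<partial>\<nu>)"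
proof -
  interpret \<nu>: prob_space \<nu> by fact
  have sp: "space \<nu> = UNIV" using sets_eq_imp_space_eq[OF \<nu>(2)] by simp
  have m\<nu>: "h \<in> borel_measurable \<nu>" if "h \<in> borel_measurable borel" for h :: "'a \<Rightarrow> real"
    using that measurable_cong_sets[OF \<nu>(2) refl] by blast
  have T\<nu>: "T \<in> measurable \<nu> borel" using T measurable_cong_sets[OF \<nu>(2) refl] by blast
  note T\<mu> = measurable_\<mu>[OF T]
  have Sne: "S \<noteq> {}" using S(2) by auto
  \<comment> \<open>As \<open>e\<close> may be unbounded, \<open>g (T z) - e z - \<eta>\<close> need
    not be bounded below. Cutting at \<open>lo\<close> repairs this and preserves the later bound on
    \<open>ff\<close>, since \<open>lo \<le> f (T y)\<close>.\<close>
  define lo where "lo = Min (f ` S)"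
  define hi where "hi = Max (g ` S)"
  have lo: "lo \<le> f (T x)" and hi: "g (T x) \<le> hi" for x
    using S Sne by (auto simp: lo_def hi_def)
  \<comment> \<open>The smallest function with values at least \<open>lo\<close> that satisfies the
    dual constraint against \<open>g (T z) - e z - \<eta>\<close>.\<close>
  define ff where "ff y = (SUP z. max lo (g (T z) - e z - \<eta> - \<alpha> (dist z y)))" for y
  define gg where "gg z = max lo (g (T z) - e z - \<eta>)" for z
  define B where "B = \<bar>lo\<bar> + \<bar>hi\<bar> + \<bar>\<eta>\<bar>"
  have gub: "g (T z) - e z - \<eta> \<le> \<bar>hi\<bar> + \<bar>\<eta>\<bar>" for z using hi[of z] e(2)[of z] by linarith
  have Fub: "max lo (g (T z) - e z - \<eta> - \<alpha> (dist z y)) \<le> B" for z y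
    using gub[of z] nonneg[OF zero_le_dist[of z y]] unfolding B_def by (intro max.boundedI) linarith+
  have bdd: "bdd_above (range (\<lambda>z. max lo (g (T z) - e z - \<eta> - \<alpha> (dist z y))))" for y
    using Fub by (intro bdd_aboveI2[where M = B]) auto
  have ff_ge: "max lo (g (T z) - e z - \<eta> - \<alpha> (dist z y)) \<le> ff y" for z y
    unfolding ff_def using bdd by (intro cSUP_upper) auto
  have lsc: "lsc ff" unfolding ff_def
    by (rule lsc_SUP[OF _ Fub]) (intro continuous_intros)
  have ff_ub: "ff y \<le> B" for y unfolding ff_def using Fub by (intro cSUP_least) auto
  have ffB: "\<bar>ff y\<bar> \<le> B" for y
    using max.cobounded1[of lo, THEN order_trans, OF ff_ge[of y y]] ff_ub[of y] unfolding B_def by linarith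
  have ggB: "\<bar>gg z\<bar> \<le> B" for z
  proof -
    have "gg z \<le> B" using gub[of z] unfolding gg_def B_def by (intro max.boundedI) linarith+
    moreover have "lo \<le> gg z" by (simp add: gg_def)
    ultimately show ?thesis unfolding B_def by linarith
  qed
  have T_comp: "(\<lambda>x. h (T x)) \<in> borel_measurable borel" for h :: "'a \<Rightarrow> real"
  proof -
    have "(\<lambda>x. h (T x)) \<in> borel_measurable \<mu>"
      using integral_finite_range(1)[OF T\<mu> S, of h] by (rule borel_measurable_integrable)
    then show ?thesis using measurable_cong_sets[OF sets_\<mu> refl] by blast
  qed
  have gg_meas: "gg \<in> borel_measurable borel"
    unfolding gg_def using T_comp[of g] e(1) by (intro borel_measurable_max borel_measurable_diff) auto
  have ggff: "gg z \<le> ff y + \<alpha> (dist z y)" for z y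
    using ff_ge[of z y] nonneg[of "dist z y"] by (simp add: gg_def)
  have key: "(\<integral>x. gg x \<partial>\<nu>) \<le> A * KL_divergence (exp 1) \<mu> \<nu> + (\<integral>x. ff x \<partial>\<mu>)"
    by (rule dual_bound[OF \<nu> ac ent lsc ffB gg_meas ggB ggff])
  \<comment> \<open>Subtracting \<open>e z\<close> and \<open>\<eta>\<close> has paid for the
    quantization error of the cost at \<open>z\<close>, so only the share \<open>e y\<close>
    remains.\<close>
  have "ff y \<le> f (T y) + e y" for y
    unfolding ff_def
  proof (rule cSUP_least)
    fix z
    have "g (T z) \<le> f (T y) + \<alpha> (dist (T y) (T z))" using fg[OF S(2) S(2), of z y] by simp
    then show "max lo (g (T z) - e z - \<eta> - \<alpha> (dist z y)) \<le> f (T y) + e y"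
      using TT[of z y] lo[of y] e(2)[of y] by (simp add: dist_commute)
  qed simp
  moreover have "integrable \<mu> ff"
    using lsc_borel[OF lsc] ffB by (intro integrable_bounded measurable_\<mu>)
  ultimately have "(\<integral>x. ff x \<partial>\<mu>) \<le> (\<integral>x. f (T x) + e x \<partial>\<mu>)"
    using integral_finite_range(1)[OF T\<mu> S, of f] e(3) by (intro integral_mono) auto
  also have "\<dots> = (\<Sum>i\<in>S. f i * measure \<mu> {x. T x = i}) + (\<integral>x. e x \<partial>\<mu>)"
    using integral_finite_range(1,2)[OF T\<mu> S, of f] e(3) by simp
  finally have 1: "(\<integral>x. ff x \<partial>\<mu>) \<le> (\<Sum>i\<in>S. f i * measure \<mu> {x. T x = i}) + (\<integral>x. e x \<partial>\<mu>)" .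
  have "(\<integral>x. g (T x) - e x - \<eta> \<partial>\<nu>) \<le> (\<integral>x. gg x \<partial>\<nu>)"
    using \<nu>.integral_finite_range(1)[OF T\<nu> S, of g] e(4) \<nu>.integrable_bounded[OF m\<nu>[OF gg_meas] ggB]
    by (intro integral_mono) (auto simp: gg_def)
  moreover have "(\<integral>x. g (T x) - e x - \<eta> \<partial>\<nu>) = (\<Sum>j\<in>S. g j * measure \<nu> {x. T x = j}) - (\<integral>x. e x \<partial>\<nu>) - \<eta>"
    using \<nu>.integral_finite_range(1,2)[OF T\<nu> S, of g] e(4) by (simp add: sp \<nu>.prob_space[unfolded sp])
  ultimately show ?thesis using key 1 by linarith
qed

section \<open>Far-away remainder and assembly of the coupling\<close>

lemma small_remainder:
  assumes "prob_space \<nu>" "sets \<nu> = sets borel" "integrable \<nu> (\<lambda>x. \<alpha> (dist x x0))"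
  shows "(\<lambda>n. \<integral>x. c * (\<alpha> (dist x x0) * indicator (- cball x0 (real n)) x) \<partial>\<nu>) \<longlonglongrightarrow> 0"
    and "integrable \<nu> (\<lambda>x. c * (\<alpha> (dist x x0) * indicator (- cball x0 R) x))"
proof -
  have meas: "(\<lambda>x. c * (\<alpha> (dist x x0) * indicator (- cball x0 R) x)) \<in> borel_measurable \<nu>" for R
  proof -
    have "(\<lambda>x. \<alpha> (dist x x0)) \<in> borel_measurable borel"
      by (intro borel_measurable_continuous_onI continuous_intros)
    then have "(\<lambda>x. c * (\<alpha> (dist x x0) * indicator (- cball x0 R) x)) \<in> borel_measurable borel" by simp
    then show ?thesis using measurable_cong_sets[OF assms(2) refl] by blast
  qed
  have dom: "norm (c * (\<alpha> (dist x x0) * indicator (- cball x0 R) x)) \<le> norm (c * \<alpha> (dist x x0))" for x R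
    by (auto simp: indicator_def)
  have int: "integrable \<nu> (\<lambda>x. c * \<alpha> (dist x x0))" using assms(3) by simp
  show "integrable \<nu> (\<lambda>x. c * (\<alpha> (dist x x0) * indicator (- cball x0 R) x))"
    by (rule Bochner_Integration.integrable_bound[OF int meas]) (rule AE_I2, rule dom)
  have "(\<lambda>n. \<integral>x. c * (\<alpha> (dist x x0) * indicator (- cball x0 (real n)) x) \<partial>\<nu>) \<longlonglongrightarrow> (\<integral>x. 0 \<partial>\<nu>)"
  proof (rule integral_dominated_convergence[where w = "\<lambda>x. norm (c * \<alpha> (dist x x0))"])
    show "AE x in \<nu>. (\<lambda>n. c * (\<alpha> (dist x x0) * indicator (- cball x0 (real n)) x)) \<longlonglongrightarrow> 0"
    proof (rule AE_I2)
      fix x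
      obtain N where N: "dist x x0 \<le> real N" using real_arch_simple by blast
      have "eventually (\<lambda>n. c * (\<alpha> (dist x x0) * indicator (- cball x0 (real n)) x) = 0) sequentially"
        using eventually_ge_at_top[of N]
        by (rule eventually_mono) (use N in \<open>auto simp: indicator_def dist_commute\<close>)
      then show "(\<lambda>n. c * (\<alpha> (dist x x0) * indicator (- cball x0 (real n)) x)) \<longlonglongrightarrow> 0"
        by (rule tendsto_eventually)
    qed
    show "integrable \<nu> (\<lambda>x. norm (c * \<alpha> (dist x x0)))" using int by (rule integrable_norm)
    show "AE x in \<nu>. norm (c * (\<alpha> (dist x x0) * indicator (- cball x0 (real n)) x)) \<le> norm (c * \<alpha> (dist x x0))" for n
      by (rule AE_I2, rule dom)
  qed (use meas in simp_all)
  then show "(\<lambda>n. \<integral>x. c * (\<alpha> (dist x x0) * indicator (- cball x0 (real n)) x) \<partial>\<nu>) \<longlonglongrightarrow> 0" by simp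
qed

text \<open>The plan on the finite set is lifted to a coupling of \<open>\<mu>\<close> and
  \<open>\<nu>\<close> themselves by a density that is constant on products of cells of
  \<open>T\<close>. The quantization error then has the same integral under every coupling.\<close>

lemma transport_cost_le:
  assumes \<nu>: "prob_space \<nu>" "sets \<nu> = sets borel" and ac: "absolutely_continuous \<mu> \<nu>"
    and ent: "integrable \<nu> (entropy_density (exp 1) \<mu> \<nu>)" and \<epsilon>: "\<epsilon> > 0"
  shows "transport_cost \<alpha> \<mu> \<nu> \<le> ennreal (A * KL_divergence (exp 1) \<mu> \<nu> + \<epsilon>)"
proof -
  interpret \<nu>: prob_space \<nu> by fact
  have sp: "space \<nu> = UNIV" using sets_eq_imp_space_eq[OF \<nu>(2)] by simp
  \<comment> \<open>Four shares: \<open>B\<close> exceeds the entropy term by less than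
    \<open>2 * \<eta>\<close>, and comparing the cost with its quantization adds less than
    \<open>2 * \<eta>\<close> again.\<close>
  define \<eta> where "\<eta> = \<epsilon> / 4"
  have \<eta>: "\<eta> > 0" using \<epsilon> by (simp add: \<eta>_def)
  define x0 :: 'a where "x0 = undefined"
  define e where "e n x = 2 * 2 powr p * (\<alpha> (dist x x0) * indicator (- cball x0 (real n)) x)" for n x
  have "(\<lambda>n. (\<integral>x. e n x \<partial>\<mu>) + (\<integral>x. e n x \<partial>\<nu>)) \<longlonglongrightarrow> 0 + 0"
    unfolding e_def by (intro tendsto_add small_remainder(1) prob sets_\<mu> cost_moment_\<mu> \<nu> cost_moment ac ent)
  then have "eventually (\<lambda>n. (\<integral>x. e n x \<partial>\<mu>) + (\<integral>x. e n x \<partial>\<nu>) < \<eta>) sequentially"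
    using \<eta> by (intro order_tendstoD(2)) simp_all
  then obtain n where n: "(\<integral>x. e n x \<partial>\<mu>) + (\<integral>x. e n x \<partial>\<nu>) < \<eta>"
    unfolding eventually_sequentially by blast
  have e_int: "integrable \<mu> (e n)" "integrable \<nu> (e n)"
    unfolding e_def by (intro small_remainder(2) prob sets_\<mu> cost_moment_\<mu> \<nu> cost_moment ac ent)+
  have e_nonneg: "e n x \<ge> 0" for x using nonneg[OF zero_le_dist, of x x0] by (simp add: e_def indicator_def)
  have e_meas: "e n \<in> borel_measurable borel"
  proof -
    have "e n \<in> borel_measurable \<mu>" using e_int(1) by (rule borel_measurable_integrable)
    then show ?thesis using measurable_cong_sets[OF sets_\<mu> refl] by blast
  qed
  obtain T :: "'a \<Rightarrow> 'a" and S where T: "T \<in> measurable borel borel" and S: "finite S" "\<And>x. T x \<in> S"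
    and TT: "\<And>x y. \<bar>\<alpha> (dist x y) - \<alpha> (dist (T x) (T y))\<bar> \<le> \<eta> + e n x + e n y"
    using quantized_cost[OF \<eta>, of "real n" x0, folded e_def] by auto
  have T\<nu>: "T \<in> measurable \<nu> borel" using T measurable_cong_sets[OF \<nu>(2) refl] by blast
  note T\<mu> = measurable_\<mu>[OF T]
  define a where "a s = measure \<mu> {x. T x = s}" for s
  define b where "b s = measure \<nu> {x. T x = s}" for s
  define c where "c i j = \<alpha> (dist i j)" for i j :: 'a
  define B where "B = A * KL_divergence (exp 1) \<mu> \<nu> + \<eta> + (\<integral>x. e n x \<partial>\<mu>) + (\<integral>x. e n x \<partial>\<nu>)"
  have ab: "a s \<ge> 0" "b s \<ge> 0" for s by (simp_all add: a_def b_def)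
  have sums: "sum a S = 1" "sum b S = 1"
    using integral_finite_range(4)[OF T\<mu> S] \<nu>.integral_finite_range(4)[OF T\<nu> S]
    by (simp_all add: a_def b_def sp)
  have c: "c i j \<ge> 0" for i j using nonneg by (simp add: c_def)
  have dual: "(\<Sum>j\<in>S. g j * b j) - (\<Sum>i\<in>S. f i * a i) \<le> B"
    if fg: "\<And>i j. i \<in> S \<Longrightarrow> j \<in> S \<Longrightarrow> g j - f i \<le> c i j" for f g
    unfolding a_def b_def B_def
  proof (rule finite_dual_bound[OF \<nu> ac ent T S e_meas e_nonneg e_int])
    show "\<alpha> (dist (T x) (T y)) \<le> \<alpha> (dist x y) + \<eta> + e n x + e n y" for x y
      using TT[of x y] by linarith
    show "g j - f i \<le> \<alpha> (dist i j)" if "i \<in> S" "j \<in> S" for i j using fg[OF that] by (simp add: c_def)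
  qed
  obtain w where w: "\<And>i j. i \<in> S \<Longrightarrow> j \<in> S \<Longrightarrow> 0 \<le> w i j"
    and row: "\<And>i. i \<in> S \<Longrightarrow> (\<Sum>j\<in>S. w i j) = a i" and col: "\<And>j. j \<in> S \<Longrightarrow> (\<Sum>i\<in>S. w i j) = b j"
    and wB: "(\<Sum>i\<in>S. \<Sum>j\<in>S. c i j * w i j) \<le> B"
  proof (rule transport_duality_finite[of S a b c B])
    show "(\<Sum>j\<in>S. g j * b j) - (\<Sum>i\<in>S. f i * a i) \<le> B"
      if "\<And>i j. i \<in> S \<Longrightarrow> j \<in> S \<Longrightarrow> g j - f i \<le> c i j" for f g
      using that by (rule dual)
  qed (rule S(1) ab sums c that; assumption?)+
  have w0: "w i j = 0" if "i \<in> S" "j \<in> S" "a i = 0 \<or> b j = 0" for i j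
    using that row[of i] col[of j] w S(1) sum_nonneg_eq_0_iff[of S "\<lambda>j. w i j"] sum_nonneg_eq_0_iff[of S "\<lambda>i. w i j"]
    by auto
  \<comment> \<open>The mass \<open>w i j\<close> is spread over the product of cells
    \<open>i\<close> and \<open>j\<close> in proportion to the product measure, which restores the
    exact marginals.\<close>
  define F where "F i j = w i j / (a i * b j)" for i j
  define \<rho> where "\<rho> z = ennreal (F (T (fst z)) (T (snd z)))" for z
  have F_nonneg: "F (T x) (T y) \<ge> 0" for x y using w S(2) ab by (simp add: F_def)
  have \<rho>_meas: "\<rho> \<in> borel_measurable (borel \<Otimes>\<^sub>M borel)"
    unfolding \<rho>_def using measurable_finite_range2[OF T S, of F] by simp
  have inner: "(\<integral>\<^sup>+y. ennreal (h (T y) * F (T x) (T y)) \<partial>\<nu>) = ennreal ((\<Sum>j\<in>S. h j * w (T x) j) / a (T x))"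
    if h: "\<And>j. j \<in> S \<Longrightarrow> 0 \<le> h j" for x h
  proof -
    have "(\<integral>\<^sup>+y. ennreal (h (T y) * w (T x) (T y) / (a (T x) * measure \<nu> {x \<in> space \<nu>. T x = T y})) \<partial>\<nu>)
       = ennreal ((\<Sum>j\<in>S. h j * w (T x) j) / a (T x))"
      by (rule \<nu>.plan_kernel_integral[OF T\<nu> S]) (use w w0 S(2) h ab in \<open>auto simp: b_def sp\<close>)
    then show ?thesis by (simp add: F_def b_def sp)
  qed
  have inner': "(\<integral>\<^sup>+x. \<rho> (x, y) \<partial>\<mu>) = ennreal ((\<Sum>i\<in>S. 1 * w i (T y)) / b (T y))" for y
  proof -
    have "(\<integral>\<^sup>+x. ennreal (1 * w (T x) (T y) / (b (T y) * measure \<mu> {x' \<in> space \<mu>. T x' = T x})) \<partial>\<mu>)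
       = ennreal ((\<Sum>i\<in>S. 1 * w i (T y)) / b (T y))"
      by (rule plan_kernel_integral[OF T\<mu> S, where c = "\<lambda>_. 1" and w = "\<lambda>i. w i (T y)"])
        (use w w0 S(2) ab in \<open>auto simp: a_def\<close>)
    then show ?thesis by (simp add: \<rho>_def F_def a_def mult.commute)
  qed
  \<comment> \<open>The marginal identities can fail only in cells of measure zero; these are
    finitely many and form a null set.\<close>
  have AE_pos: "AE x in N. measure N {x'. T x' = T x} \<noteq> 0"
    if N: "prob_space N" "sets N = sets borel" for N
  proof -
    interpret N: prob_space N by fact
    have TN: "T \<in> measurable N borel" using T measurable_cong_sets[OF N(2) refl] by blast
    have spN: "space N = UNIV" using sets_eq_imp_space_eq[OF N(2)] by simp
    define z where "z s = (if measure N {x'. T x' = s} = 0 then 1 else 0 :: real)" for s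
    have "(\<integral>\<^sup>+x. ennreal (z (T x)) \<partial>N) = ennreal (\<Sum>s\<in>S. z s * measure N {x \<in> space N. T x = s})"
      by (rule N.integral_finite_range(3)[OF TN S]) (simp add: z_def)
    also have "(\<Sum>s\<in>S. z s * measure N {x \<in> space N. T x = s}) = 0"
      by (intro sum.neutral) (simp add: z_def spN)
    finally have "(\<integral>\<^sup>+x. ennreal (z (T x)) \<partial>N) = 0" by simp
    moreover have "(\<lambda>x. ennreal (z (T x))) \<in> borel_measurable N"
      using borel_measurable_integrable[OF N.integral_finite_range(1)[OF TN S, of z]] by simp
    ultimately have "AE x in N. ennreal (z (T x)) = 0" by (simp add: nn_integral_0_iff_AE)
    then show ?thesis by (rule eventually_mono) (auto simp: z_def split: if_splits)
  qed
  have pi: "density (\<mu> \<Otimes>\<^sub>M \<nu>) \<rho> \<in> couplings \<mu> \<nu>"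
  proof (rule density_coupling[OF prob \<nu>(1) sets_\<mu> \<nu>(2) \<rho>_meas])
    show "AE x in \<mu>. (\<integral>\<^sup>+y. \<rho> (x, y) \<partial>\<nu>) = 1"
      using AE_pos[OF prob sets_\<mu>]
    proof (rule eventually_mono)
      fix x assume "measure \<mu> {x'. T x' = T x} \<noteq> 0"
      then show "(\<integral>\<^sup>+y. \<rho> (x, y) \<partial>\<nu>) = 1"
        using inner[of "\<lambda>_. 1" x] row[OF S(2), of x] by (simp add: \<rho>_def a_def)
    qed
    show "AE y in \<nu>. (\<integral>\<^sup>+x. \<rho> (x, y) \<partial>\<mu>) = 1"
      using AE_pos[OF \<nu>]
    proof (rule eventually_mono)
      fix y assume "measure \<nu> {x'. T x' = T y} \<noteq> 0"
      then show "(\<integral>\<^sup>+x. \<rho> (x, y) \<partial>\<mu>) = 1"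
        using inner'[of y] col[OF S(2), of y] by (simp add: b_def)
    qed
  qed
  define \<pi> where "\<pi> = density (\<mu> \<Otimes>\<^sub>M \<nu>) \<rho>"
  have \<pi>: "prob_space \<pi>" "sets \<pi> = sets (borel \<Otimes>\<^sub>M borel)" "distr \<pi> borel fst = \<mu>" "distr \<pi> borel snd = \<nu>"
    using pi unfolding couplings_def \<pi>_def by auto
  interpret \<pi>: prob_space \<pi> by (rule \<pi>(1))
  have meas\<pi>: "h \<in> borel_measurable \<pi>" if "h \<in> borel_measurable (borel \<Otimes>\<^sub>M borel)" for h :: "'a \<times> 'a \<Rightarrow> ennreal"
    using that measurable_cong_sets[OF \<pi>(2) refl] by blast
  have sp2: "sets (\<mu> \<Otimes>\<^sub>M \<nu>) = sets (borel \<Otimes>\<^sub>M borel)" by (rule sets_pair_measure_cong[OF sets_\<mu> \<nu>(2)])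
  have meas2: "h \<in> borel_measurable (\<mu> \<Otimes>\<^sub>M \<nu>)" if "h \<in> borel_measurable (borel \<Otimes>\<^sub>M borel)" for h :: "'a \<times> 'a \<Rightarrow> ennreal"
    using that measurable_cong_sets[OF sp2 refl] by blast
  have fs: "fst \<in> measurable \<pi> (borel :: 'a measure)" "snd \<in> measurable \<pi> (borel :: 'a measure)"
    using measurable_cong_sets[OF \<pi>(2) refl, of "borel :: 'a measure"] by simp_all
  define e' where "e' x = ennreal (e n x)" for x
  have e'_meas: "e' \<in> borel_measurable borel" unfolding e'_def using e_meas by simp
  have ef: "(\<integral>\<^sup>+z. e' (fst z) \<partial>\<pi>) = ennreal (\<integral>x. e n x \<partial>\<mu>)"
  proof -
    have "(\<integral>\<^sup>+z. e' (fst z) \<partial>\<pi>) = (\<integral>\<^sup>+x. e' x \<partial>distr \<pi> borel fst)"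
      using fs(1) e'_meas by (intro nn_integral_distr[symmetric]) auto
    also have "\<dots> = ennreal (\<integral>x. e n x \<partial>\<mu>)"
      unfolding \<pi>(3) e'_def using e_nonneg by (intro nn_integral_eq_integral e_int) auto
    finally show ?thesis .
  qed
  have es: "(\<integral>\<^sup>+z. e' (snd z) \<partial>\<pi>) = ennreal (\<integral>x. e n x \<partial>\<nu>)"
  proof -
    have "(\<integral>\<^sup>+z. e' (snd z) \<partial>\<pi>) = (\<integral>\<^sup>+x. e' x \<partial>distr \<pi> borel snd)"
      using fs(2) e'_meas by (intro nn_integral_distr[symmetric]) auto
    also have "\<dots> = ennreal (\<integral>x. e n x \<partial>\<nu>)"
      unfolding \<pi>(4) e'_def using e_nonneg by (intro nn_integral_eq_integral e_int) auto
    finally show ?thesis .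
  qed
  define cT where "cT z = ennreal (c (T (fst z)) (T (snd z)))" for z
  have cT_meas: "cT \<in> borel_measurable (borel \<Otimes>\<^sub>M borel)"
    unfolding cT_def using measurable_finite_range2[OF T S, of c] by simp
  have "(\<integral>\<^sup>+z. cT z \<partial>\<pi>) = (\<integral>\<^sup>+z. \<rho> z * cT z \<partial>(\<mu> \<Otimes>\<^sub>M \<nu>))"
    unfolding \<pi>_def using meas2[OF \<rho>_meas] meas2[OF cT_meas] by (rule nn_integral_density)
  also have "\<dots> = (\<integral>\<^sup>+x. \<integral>\<^sup>+y. \<rho> (x, y) * cT (x, y) \<partial>\<nu> \<partial>\<mu>)"
    using meas2[OF \<rho>_meas] meas2[OF cT_meas] by (intro \<nu>.nn_integral_fst[symmetric]) simp
  also have "\<dots> = (\<integral>\<^sup>+x. \<integral>\<^sup>+y. ennreal (c (T x) (T y) * F (T x) (T y)) \<partial>\<nu> \<partial>\<mu>)"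
    using F_nonneg c by (intro nn_integral_cong) (simp add: \<rho>_def cT_def ennreal_mult[symmetric] mult.commute)
  also have "\<dots> = (\<integral>\<^sup>+x. ennreal ((\<Sum>j\<in>S. c (T x) j * w (T x) j) / a (T x)) \<partial>\<mu>)"
    using c by (intro nn_integral_cong inner)
  also have "\<dots> = ennreal (\<Sum>i\<in>S. (\<Sum>j\<in>S. c i j * w i j) / a i * measure \<mu> {x \<in> space \<mu>. T x = i})"
    by (rule integral_finite_range(3)[OF T\<mu> S, where \<phi> = "\<lambda>i. (\<Sum>j\<in>S. c i j * w i j) / a i"])
      (use c w ab in \<open>auto intro!: divide_nonneg_nonneg sum_nonneg mult_nonneg_nonneg\<close>)
  also have "\<dots> \<le> ennreal B"
  proof (rule ennreal_leI)
    have "(\<Sum>i\<in>S. (\<Sum>j\<in>S. c i j * w i j) / a i * measure \<mu> {x \<in> space \<mu>. T x = i}) \<le> (\<Sum>i\<in>S. \<Sum>j\<in>S. c i j * w i j)"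
    proof (rule sum_mono)
      fix i assume "i \<in> S"
      then have "0 \<le> (\<Sum>j\<in>S. c i j * w i j)" using c w by (intro sum_nonneg mult_nonneg_nonneg) auto
      then show "(\<Sum>j\<in>S. c i j * w i j) / a i * measure \<mu> {x \<in> space \<mu>. T x = i} \<le> (\<Sum>j\<in>S. c i j * w i j)"
        by (cases "a i = 0") (simp_all add: a_def)
    qed
    then show "(\<Sum>i\<in>S. (\<Sum>j\<in>S. c i j * w i j) / a i * measure \<mu> {x \<in> space \<mu>. T x = i}) \<le> B"
      using wB by linarith
  qed
  finally have cT_int: "(\<integral>\<^sup>+z. cT z \<partial>\<pi>) \<le> ennreal B" .
  have B: "B \<ge> 0"
  proof -
    have "0 \<le> (\<Sum>i\<in>S. \<Sum>j\<in>S. c i j * w i j)" using c w by (intro sum_nonneg mult_nonneg_nonneg) auto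
    then show ?thesis using wB by linarith
  qed
  have ei: "0 \<le> (\<integral>x. e n x \<partial>\<mu>)" "0 \<le> (\<integral>x. e n x \<partial>\<nu>)" using e_nonneg by simp_all
  have "transport_cost \<alpha> \<mu> \<nu> \<le> (\<integral>\<^sup>+z. ennreal (\<alpha> (dist (fst z) (snd z))) \<partial>\<pi>)"
    unfolding transport_cost_def \<pi>_def by (rule INF_lower[OF pi])
  also have "\<dots> \<le> (\<integral>\<^sup>+z. cT z + ennreal \<eta> + e' (fst z) + e' (snd z) \<partial>\<pi>)"
  proof (rule nn_integral_mono)
    fix z
    have "\<alpha> (dist (fst z) (snd z)) \<le> c (T (fst z)) (T (snd z)) + \<eta> + e n (fst z) + e n (snd z)"
      using TT[of "fst z" "snd z"] by (simp add: c_def)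
    then have "ennreal (\<alpha> (dist (fst z) (snd z))) \<le> ennreal (c (T (fst z)) (T (snd z)) + \<eta> + e n (fst z) + e n (snd z))"
      by (rule ennreal_leI)
    then show "ennreal (\<alpha> (dist (fst z) (snd z))) \<le> cT z + ennreal \<eta> + e' (fst z) + e' (snd z)"
      using c \<eta> e_nonneg by (simp add: cT_def e'_def)
  qed
  also have "\<dots> = (\<integral>\<^sup>+z. cT z \<partial>\<pi>) + ennreal \<eta> + (\<integral>\<^sup>+z. e' (fst z) \<partial>\<pi>) + (\<integral>\<^sup>+z. e' (snd z) \<partial>\<pi>)"
  proof -
    have m: "cT \<in> borel_measurable \<pi>" "(\<lambda>z. e' (fst z)) \<in> borel_measurable \<pi>" "(\<lambda>z. e' (snd z)) \<in> borel_measurable \<pi>"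
      using meas\<pi>[OF cT_meas] measurable_compose[OF fs(1) e'_meas] measurable_compose[OF fs(2) e'_meas] by auto
    then show ?thesis by (simp add: nn_integral_add \<pi>.emeasure_space_1)
  qed
  also have "\<dots> \<le> ennreal B + ennreal \<eta> + ennreal (\<integral>x. e n x \<partial>\<mu>) + ennreal (\<integral>x. e n x \<partial>\<nu>)"
    unfolding ef es by (intro add_mono cT_int) auto
  also have "\<dots> = ennreal (B + \<eta> + (\<integral>x. e n x \<partial>\<mu>) + (\<integral>x. e n x \<partial>\<nu>))"
    using B \<eta> ei by simp
  also have "\<dots> \<le> ennreal (A * KL_divergence (exp 1) \<mu> \<nu> + \<epsilon>)"
    using n by (intro ennreal_leI) (simp add: B_def \<eta>_def)
  finally show ?thesis .
qed

lemma transport_ineq_\<mu>: "transport_ineq \<alpha> A \<mu>"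
  unfolding transport_ineq_def
proof (intro allI impI)
  fix \<nu> :: "'a measure" assume "borel_prob \<nu>"
  then have \<nu>: "prob_space \<nu>" "sets \<nu> = sets borel" by (auto simp: borel_prob_def)
  show "enn2ereal (transport_cost \<alpha> \<mu> \<nu>) \<le> ereal A * rel_entropy \<nu> \<mu>"
  proof (cases "absolutely_continuous \<mu> \<nu> \<and> integrable \<nu> (entropy_density (exp 1) \<mu> \<nu>)")
    case True
    \<comment> \<open>The dual inequality with both potentials 0.\<close>
    have KL: "0 \<le> A * KL_divergence (exp 1) \<mu> \<nu>"
      using dual_bound[OF \<nu> conjunct1[OF True] conjunct2[OF True], of "\<lambda>_. 0" 0 "\<lambda>_. 0"] nonneg
      by (simp add: lsc_def)
    have "transport_cost \<alpha> \<mu> \<nu> \<le> ennreal (A * KL_divergence (exp 1) \<mu> \<nu>)"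
    proof (rule ennreal_le_epsilon)
      fix \<epsilon> :: real assume "0 < \<epsilon>"
      then show "transport_cost \<alpha> \<mu> \<nu> \<le> ennreal (A * KL_divergence (exp 1) \<mu> \<nu>) + ennreal \<epsilon>"
        using transport_cost_le[OF \<nu> conjunct1[OF True] conjunct2[OF True], of \<epsilon>] KL by simp
    qed
    then have "enn2ereal (transport_cost \<alpha> \<mu> \<nu>) \<le> enn2ereal (ennreal (A * KL_divergence (exp 1) \<mu> \<nu>))"
      by (simp only: less_eq_ennreal.rep_eq)
    then show ?thesis using KL True by (simp add: rel_entropy_def enn2ereal_ennreal)
  next
    case False
    then have "rel_entropy \<nu> \<mu> = \<infinity>" by (simp add: rel_entropy_def)
    \<comment> \<open>As \<open>A > 0\<close>, the right-hand side is infinite.\<close>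
    then show ?thesis using A_pos by simp
  qed
qed

end

theorem theorem1p13:
  fixes \<mu> :: "'a::polish_space measure" and \<alpha> :: "real \<Rightarrow> real" and C r p :: real
  assumes "\<And>(x::'a) \<rho>. compact (cball x \<rho>)"
    and "borel_prob \<mu>"
    and "\<And>x. x \<ge> 0 \<Longrightarrow> \<alpha> x \<ge> 0"
    and "mono_on {0..} \<alpha>"
    and "convex_on {0..} \<alpha>"
    and "C1_halfline \<alpha>"
    and "\<alpha> 0 = 0"
    and "Delta2 \<alpha>"
    and "r = lower_exponent \<alpha>"
    and "p = upper_exponent \<alpha>"
    and "1 < p"
    and "C > 0"
    and "LSI_minus \<alpha> C \<mu>"
  shows "transport_ineq \<alpha> (max (((p - 1) * C) powr (r - 1)) (((p - 1) * C) powr (p - 1))) \<mu>"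
proof -
  obtain \<alpha>' where "power_cost \<alpha> \<alpha>' r p"
    using power_costI[OF assms(3,5,6,7,8)] assms(9-11) by auto
  then interpret power_cost \<alpha> \<alpha>' r p .
  have "dual_transport \<alpha> \<alpha>' r p \<mu> (max (((p - 1) * C) powr (r - 1)) (((p - 1) * C) powr (p - 1)))"
    using assms(1,2,12,13) by (intro LSI_imp_dual_transport) (auto simp: borel_prob_def)
  then show ?thesis by (rule dual_transport.transport_ineq_\<mu>)
qed

end
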